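(* The completed projective tensor product $s\,\hat{\otimes}_{\pi}\,s'$ of the space $s$ of rapidly decreasing sequences and its dual $s'$, the space of slowly increasing sequences, is a bornological locally convex space.
   Context: Here $\mathbb{N}=\{1,2,3,\dots\}$ and all spaces are over $\mathbb{C}$. The space of rapidly decreasing sequences is $s=\{(x_j)_{j\in\mathbb{N}}\in\mathbb{C}^{\mathbb{N}} : \forall k\in\mathbb{N}:\ \sup_{j\in\mathbb{N}} j^k|x_j|<\infty\}$, with the Fréchet topology given by the norms $x\mapsto\sup_j j^k|x_j|$, $k\in\mathbb{N}$. Its dual, with the strong dual topology, is the space of slowly increasing sequences $s'=\{(x_j)_{j\in\mathbb{N}}\in\mathbb{C}^{\mathbb{N}} : \exists k\in\mathbb{N}:\ \sup_{j\in\mathbb{N}} j^{-k}|x_j|<\infty\}$. $s\,\hat{\otimes}_{\pi}\,s'$ denotes the completion of $s\otimes s'$ with respect to the projective tensor product topology. It is canonically isomorphic, as a locally convex space, to the space of double sequences $$\Big\{x\in\mathbb{C}^{\mathbb{N}\times\mathbb{N}} : \forall n\in\mathbb{N}\ \exists N\in\mathbb{N}:\ \sup_{i,j\in\mathbb{N}} i^n j^{-N}|x_{i,j}|<\infty\Big\}=\bigcap_{n\in\mathbb{N}}Y_n,\qquad Y_n=\bigcup_{N\in\mathbb{N}}Y_{n,N},$$ where $Y_{n,N}=\{x\in\mathbb{C}^{\mathbb{N}\times\mathbb{N}} : \|x\|_{n,N}=\sup_{i,j} i^nj^{-N}|x_{i,j}|<\infty\}$ is a Banach space with norm $\|\cdot\|_{n,N}$,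 each $Y_n$ carries the locally convex inductive limit topology of the spaces $Y_{n,N}$ ($N\in\mathbb{N}$), and the intersection carries the projective limit topology (the coarsest topology making all inclusions into the $Y_n$ continuous). The paper represents and identifies $s\,\hat{\otimes}_{\pi}\,s'$ with this space. A locally convex space is bornological if every absolutely convex subset that absorbs all bounded sets is a neighbourhood of $0$. *)

theory Defs
  imports "HOL-Analysis.Analysis" "HOL-Library.Function_Algebras"
begin

text \<open>
  A topological vector space over the complex numbers is given by a scalar multiplication
  \<open>sc\<close> on an additive group type together with a topology \<open>T\<close> whose \<open>topspace\<close> is the
  underlying vector space, a linear subspace of the type.
\<close>

definition fun_scale :: "complex \<Rightarrow> ('a \<Rightarrow> complex) \<Rightarrow> 'a \<Rightarrow> complex" where
  "fun_scale c f = (\<lambda>i. c * f i)"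

definition zero_nhd :: "'a::ab_group_add topology \<Rightarrow> 'a set \<Rightarrow> bool" where
  "zero_nhd T U \<longleftrightarrow> U \<subseteq> topspace T \<and> (\<exists>V. openin T V \<and> 0 \<in> V \<and> V \<subseteq> U)"

definition absolutely_convex :: "(complex \<Rightarrow> 'a::ab_group_add \<Rightarrow> 'a) \<Rightarrow> 'a set \<Rightarrow> bool" where
  "absolutely_convex sc A \<longleftrightarrow>
     (\<forall>x\<in>A. \<forall>y\<in>A. \<forall>a b. cmod a + cmod b \<le> 1 \<longrightarrow> sc a x + sc b y \<in> A)"

definition absorbs :: "(complex \<Rightarrow> 'a::ab_group_add \<Rightarrow> 'a) \<Rightarrow> 'a set \<Rightarrow> 'a set \<Rightarrow> bool" where
  "absorbs sc A B \<longleftrightarrow> (\<exists>r>0. \<forall>c. r \<le> cmod c \<longrightarrow> B \<subseteq> sc c ` A)"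

definition bounded_in :: "(complex \<Rightarrow> 'a::ab_group_add \<Rightarrow> 'a) \<Rightarrow> 'a topology \<Rightarrow> 'a set \<Rightarrow> bool" where
  "bounded_in sc T B \<longleftrightarrow> B \<subseteq> topspace T \<and> (\<forall>U. zero_nhd T U \<longrightarrow> absorbs sc U B)"

definition locally_convex_space :: "(complex \<Rightarrow> 'a::ab_group_add \<Rightarrow> 'a) \<Rightarrow> 'a topology \<Rightarrow> bool" where
  "locally_convex_space sc T \<longleftrightarrow>
     vector_space sc \<and> module.subspace sc (topspace T) \<and>
     continuous_map (prod_topology T T) T (\<lambda>(x, y). x + y) \<and>
     continuous_map (prod_topology euclidean T) T (\<lambda>(c, x). sc c x) \<and>
     (\<forall>U. zero_nhd T U \<longrightarrow> (\<exists>V. zero_nhd T V \<and> absolutely_convex sc V \<and> V \<subseteq> U))"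

definition bornological :: "(complex \<Rightarrow> 'a::ab_group_add \<Rightarrow> 'a) \<Rightarrow> 'a topology \<Rightarrow> bool" where
  "bornological sc T \<longleftrightarrow>
     locally_convex_space sc T \<and>
     (\<forall>U. U \<subseteq> topspace T \<and> absolutely_convex sc U \<and>
          (\<forall>B. bounded_in sc T B \<longrightarrow> absorbs sc U B) \<longrightarrow> zero_nhd T U)"

definition linear_on ::
  "(complex \<Rightarrow> 'a::ab_group_add \<Rightarrow> 'a) \<Rightarrow> 'a set \<Rightarrow> (complex \<Rightarrow> 'b::ab_group_add \<Rightarrow> 'b) \<Rightarrow> ('a \<Rightarrow> 'b) \<Rightarrow> bool" where
  "linear_on sc V sc' f \<longleftrightarrow>
     (\<forall>x\<in>V. \<forall>y\<in>V. f (x + y) = f x + f y) \<and> (\<forall>c. \<forall>x\<in>V. f (sc c x) = sc' c (f x))"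

definition seminorm_on :: "(complex \<Rightarrow> 'a::ab_group_add \<Rightarrow> 'a) \<Rightarrow> 'a set \<Rightarrow> ('a \<Rightarrow> real) \<Rightarrow> bool" where
  "seminorm_on sc V p \<longleftrightarrow>
     (\<forall>x\<in>V. \<forall>y\<in>V. p (x + y) \<le> p x + p y) \<and> (\<forall>c. \<forall>x\<in>V. p (sc c x) = cmod c * p x)"

definition continuous_seminorm ::
  "(complex \<Rightarrow> 'a::ab_group_add \<Rightarrow> 'a) \<Rightarrow> 'a topology \<Rightarrow> ('a \<Rightarrow> real) \<Rightarrow> bool" where
  "continuous_seminorm sc T p \<longleftrightarrow>
     seminorm_on sc (topspace T) p \<and> continuous_map T euclideanreal p"

text \<open>Meaningful only for nonempty \<open>P\<close>: otherwise the \<open>topspace\<close> is empty, not \<open>V\<close>.\<close>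

definition seminorm_topology :: "'a::ab_group_add set \<Rightarrow> ('a \<Rightarrow> real) set \<Rightarrow> 'a topology" where
  "seminorm_topology V P =
     topology_generated_by {{y \<in> V. p (y - x) < e} |p x e. p \<in> P \<and> x \<in> V \<and> 0 < e}"

definition cauchy_filter_on :: "'a::ab_group_add topology \<Rightarrow> 'a filter \<Rightarrow> bool" where
  "cauchy_filter_on T F \<longleftrightarrow>
     F \<noteq> bot \<and> eventually (\<lambda>x. x \<in> topspace T) F \<and>
     (\<forall>U. zero_nhd T U \<longrightarrow> (\<exists>A. eventually (\<lambda>x. x \<in> A) F \<and> (\<forall>x\<in>A. \<forall>y\<in>A. x - y \<in> U)))"

definition complete_tvs :: "'a::ab_group_add topology \<Rightarrow> bool" where
  "complete_tvs T \<longleftrightarrow> (\<forall>F. cauchy_filter_on T F \<longrightarrow> (\<exists>l. limitin T (\<lambda>x. x) l F))"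

text \<open>
  \<open>E\<close> together with \<open>\<iota>\<close> is a completion of the locally convex space \<open>X\<close>. For Hausdorff \<open>X\<close>
  such a pair exists (on a suitable type) and is unique up to a topological linear isomorphism respecting \<open>\<iota>\<close>.
\<close>

definition is_completion ::
  "(complex \<Rightarrow> 'a::ab_group_add \<Rightarrow> 'a) \<Rightarrow> 'a topology \<Rightarrow>
   (complex \<Rightarrow> 'e::ab_group_add \<Rightarrow> 'e) \<Rightarrow> 'e topology \<Rightarrow> ('a \<Rightarrow> 'e) \<Rightarrow> bool" where
  "is_completion sc X sc' E \<iota> \<longleftrightarrow>
     locally_convex_space sc' E \<and> Hausdorff_space E \<and> complete_tvs E \<and>
     linear_on sc (topspace X) sc' \<iota> \<and> embedding_map X E \<iota> \<and>
     E closure_of (\<iota> ` topspace X) = topspace E"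

definition bilinear_form_on ::
  "(complex \<Rightarrow> 'a::ab_group_add \<Rightarrow> 'a) \<Rightarrow> 'a set \<Rightarrow> (complex \<Rightarrow> 'b::ab_group_add \<Rightarrow> 'b) \<Rightarrow> 'b set \<Rightarrow>
   ('a \<Rightarrow> 'b \<Rightarrow> complex) \<Rightarrow> bool" where
  "bilinear_form_on sc V sc' W A \<longleftrightarrow>
     (\<forall>y\<in>W. linear_on sc V (*) (\<lambda>x. A x y)) \<and> (\<forall>x\<in>V. linear_on sc' W (*) (A x))"

text \<open>
  The algebraic tensor product of \<open>V\<close> and \<open>W\<close> is constructed inside the algebraic dual of the
  space of all bilinear forms on \<open>V \<times> W\<close>: the elementary tensor of \<open>x\<close> and \<open>y\<close> is evaluation
  at \<open>(x, y)\<close>. Bilinear forms are represented by functions on the whole types, so these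
  functionals are set to \<open>0\<close> on functions that are not bilinear on \<open>V \<times> W\<close>.
\<close>

definition elem_tensor ::
  "(complex \<Rightarrow> 'a::ab_group_add \<Rightarrow> 'a) \<Rightarrow> 'a set \<Rightarrow> (complex \<Rightarrow> 'b::ab_group_add \<Rightarrow> 'b) \<Rightarrow> 'b set \<Rightarrow>
   'a \<Rightarrow> 'b \<Rightarrow> ('a \<Rightarrow> 'b \<Rightarrow> complex) \<Rightarrow> complex" where
  "elem_tensor sc V sc' W x y = (\<lambda>A. if bilinear_form_on sc V sc' W A then A x y else 0)"

definition alg_tensor ::
  "(complex \<Rightarrow> 'a::ab_group_add \<Rightarrow> 'a) \<Rightarrow> 'a set \<Rightarrow> (complex \<Rightarrow> 'b::ab_group_add \<Rightarrow> 'b) \<Rightarrow> 'b set \<Rightarrow>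
   (('a \<Rightarrow> 'b \<Rightarrow> complex) \<Rightarrow> complex) set" where
  "alg_tensor sc V sc' W =
     module.span fun_scale {elem_tensor sc V sc' W x y |x y. x \<in> V \<and> y \<in> W}"

definition tensor_seminorm ::
  "(complex \<Rightarrow> 'a::ab_group_add \<Rightarrow> 'a) \<Rightarrow> 'a set \<Rightarrow> (complex \<Rightarrow> 'b::ab_group_add \<Rightarrow> 'b) \<Rightarrow> 'b set \<Rightarrow>
   ('a \<Rightarrow> real) \<Rightarrow> ('b \<Rightarrow> real) \<Rightarrow> (('a \<Rightarrow> 'b \<Rightarrow> complex) \<Rightarrow> complex) \<Rightarrow> real" where
  "tensor_seminorm sc V sc' W p q t =
     Inf {\<Sum>i<n. p (x i) * q (y i) |(n::nat) x y.
            (\<forall>i<n. x i \<in> V \<and> y i \<in> W) \<and> t = (\<Sum>i<n. elem_tensor sc V sc' W (x i) (y i))}"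

definition projective_tensor ::
  "(complex \<Rightarrow> 'a::ab_group_add \<Rightarrow> 'a) \<Rightarrow> 'a topology \<Rightarrow>
   (complex \<Rightarrow> 'b::ab_group_add \<Rightarrow> 'b) \<Rightarrow> 'b topology \<Rightarrow>
   (('a \<Rightarrow> 'b \<Rightarrow> complex) \<Rightarrow> complex) topology" where
  "projective_tensor sc X sc' Y =
     seminorm_topology (alg_tensor sc (topspace X) sc' (topspace Y))
       {tensor_seminorm sc (topspace X) sc' (topspace Y) p q |p q.
          continuous_seminorm sc X p \<and> continuous_seminorm sc' Y q}"

definition is_completed_projective_tensor ::
  "(complex \<Rightarrow> 'a::ab_group_add \<Rightarrow> 'a) \<Rightarrow> 'a topology \<Rightarrow>
   (complex \<Rightarrow> 'b::ab_group_add \<Rightarrow> 'b) \<Rightarrow> 'b topology \<Rightarrow>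
   (complex \<Rightarrow> 'e::ab_group_add \<Rightarrow> 'e) \<Rightarrow> 'e topology \<Rightarrow>
   ((('a \<Rightarrow> 'b \<Rightarrow> complex) \<Rightarrow> complex) \<Rightarrow> 'e) \<Rightarrow> bool" where
  "is_completed_projective_tensor sc X sc' Y scE E \<iota> \<longleftrightarrow>
     is_completion fun_scale (projective_tensor sc X sc' Y) scE E \<iota>"

text \<open>
  Sequences indexed by \<open>1, 2, 3, \<dots>\<close> are functions on \<open>nat\<close> whose value at \<open>j\<close> is the entry
  with index \<open>Suc j\<close>.
\<close>

definition rapid_seqs :: "(nat \<Rightarrow> complex) set" where
  "rapid_seqs = {x. \<forall>k\<ge>1. bdd_above (range (\<lambda>j. real (Suc j) ^ k * cmod (x j)))}"

definition rapid_norm :: "nat \<Rightarrow> (nat \<Rightarrow> complex) \<Rightarrow> real" where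
  "rapid_norm k x = (SUP j. real (Suc j) ^ k * cmod (x j))"

definition s_top :: "(nat \<Rightarrow> complex) topology" where
  "s_top = seminorm_topology rapid_seqs {rapid_norm k |k. k \<ge> 1}"

definition slow_seqs :: "(nat \<Rightarrow> complex) set" where
  "slow_seqs = {y. \<exists>k\<ge>1. bdd_above (range (\<lambda>j. cmod (y j) / real (Suc j) ^ k))}"

text \<open>
  The strong dual topology: a slowly increasing \<open>y\<close> acts on rapidly decreasing \<open>x\<close> by
  \<open>\<Sum>j. x j * y j\<close>, and convergence is uniform on bounded subsets of \<open>s\<close>. The empty bounded
  set is excluded because its supremum in \<open>real\<close> is unspecified.
\<close>

definition polar_seminorm :: "(nat \<Rightarrow> complex) set \<Rightarrow> (nat \<Rightarrow> complex) \<Rightarrow> real" where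
  "polar_seminorm B y = (SUP x\<in>B. cmod (\<Sum>j. x j * y j))"

definition s_dual_top :: "(nat \<Rightarrow> complex) topology" where
  "s_dual_top =
     seminorm_topology slow_seqs {polar_seminorm B |B. bounded_in fun_scale s_top B \<and> B \<noteq> {}}"

end

theory Submission
  imports Defs
begin

text \<open>
  A double sequence \<open>g\<close> belongs to the completion iff \<open>sup i\<^sup>n b\<^sub>j \<bar>g\<^sub>i\<^sub>j\<bar>\<close> is finite for all \<open>n\<close> and all
  positive rapidly decreasing weights \<open>b\<close>, and these seminorms define its topology. Let \<open>W\<close> be absolutely
  convex and absorb the bounded sets. Some \<open>n\<close> exists such that \<open>W\<close> absorbs \<open>{g. i\<^sup>n \<bar>g\<^sub>i\<^sub>j\<bar> \<le> j\<^sup>N}\<close> for every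
  \<open>N\<close>, with a factor \<open>C\<^sub>N\<close>. A sequence supported in the column \<open>j\<close> and bounded there by \<open>i\<^sup>-\<^sup>n\<close> then lies in
  \<open>C\<^sub>N j\<^sup>-\<^sup>N W\<close> for every \<open>N\<close>, hence in \<open>b\<^sub>j W\<close> for a rapidly decreasing \<open>b\<close>; summing over the columns
  (the tails from column \<open>J\<close> on, multiplied by \<open>J\<close>, form a bounded set) shows that \<open>W\<close> contains a neighbourhood of \<open>0\<close>.

  An arbitrary completion is reached through the closure of the graph of \<open>t \<mapsto> \<iota> t\<close>, where \<open>t\<close> in the algebraic
  tensor product is identified with its matrix of entries.
\<close>

section \<open>Rapidly decreasing weights and weighted double sequences\<close>

text \<open>The space mixes a countable intersection with inductive limits, so it offers neither a
  metric nor a single inductive limit from which bornologicity could be read off. The delicate point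
  is the order of quantifiers: one row exponent \<open>n\<close> must serve all \<open>N\<close>,
  and only the constants may depend on \<open>N\<close>. These constants are then condensed into a
  single rapidly decreasing weight.

  The same condensation works on the dual side: the bounded subsets of \<open>s\<close> are those
  dominated by a rapid weight, so the strong dual topology is given by weighted sup norms, and the
  projective topology by the weights \<open>i^n b_j\<close> on matrix entries.

  The completion lives on an arbitrary type and is known only through its defining properties. Four
  facts about the graph closure carry the transfer: small double sequences represent small elements,
  an element is determined by any double sequence representing it, every double sequence represents
  some element (completeness), and elements near 0 are represented by small double sequences
  (density and the embedding property).\<close>

definition rapid_weights :: "(nat \<Rightarrow> real) set" where
  "rapid_weights = {b. (\<forall>j. 0 < b j) \<and> (\<forall>k. \<exists>C. \<forall>j. real (Suc j) ^ k * b j \<le> C)}"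

lemma rapid_weights_pos: "b \<in> rapid_weights \<Longrightarrow> 0 < b j"
  by (simp add: rapid_weights_def)

lemma rapid_weights_bound:
  assumes "b \<in> rapid_weights"
  obtains C where "0 < C" "\<And>j. real (Suc j) ^ k * b j \<le> C"
proof -
  obtain C where C: "\<And>j. real (Suc j) ^ k * b j \<le> C"
    using assms unfolding rapid_weights_def by blast
  have "0 < real (Suc 0) ^ k * b 0" using rapid_weights_pos[OF assms] by simp
  then show thesis using that[of C] C by (meson less_le_trans)
qed

lemma rapid_weights_pow:
  assumes "b \<in> rapid_weights"
  shows "(\<lambda>j. real (Suc j) ^ k * b j) \<in> rapid_weights"
  unfolding rapid_weights_def
proof (intro CollectI conjI allI)
  fix j show "0 < real (Suc j) ^ k * b j" using rapid_weights_pos[OF assms] by simp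
next
  fix m
  obtain C where "\<And>j. real (Suc j) ^ (m + k) * b j \<le> C"
    using rapid_weights_bound[OF assms, of "m + k"] by metis
  then show "\<exists>C. \<forall>j. real (Suc j) ^ m * (real (Suc j) ^ k * b j) \<le> C"
    by (auto simp: power_add mult.assoc)
qed

lemma rapid_weights_scale:
  assumes "b \<in> rapid_weights" "0 < c"
  shows "(\<lambda>j. c * b j) \<in> rapid_weights"
  unfolding rapid_weights_def
proof (intro CollectI conjI allI)
  fix j show "0 < c * b j" using rapid_weights_pos[OF assms(1)] assms by simp
next
  fix m
  obtain C where "\<And>j. real (Suc j) ^ m * b j \<le> C"
    using rapid_weights_bound[OF assms(1), of m] by metis
  then have "\<forall>j. real (Suc j) ^ m * (c * b j) \<le> c * C"
    using assms(2) by (simp add: mult.left_commute)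
  then show "\<exists>C. \<forall>j. real (Suc j) ^ m * (c * b j) \<le> C" by blast
qed

text \<open>The sum dominates both weights, which makes the families of weighted balls
  directed.\<close>

lemma rapid_weights_add:
  assumes "b \<in> rapid_weights" "b' \<in> rapid_weights"
  shows "(\<lambda>j. b j + b' j) \<in> rapid_weights"
  unfolding rapid_weights_def
proof (intro CollectI conjI allI)
  fix j show "0 < b j + b' j" using rapid_weights_pos assms by (simp add: add_pos_pos)
next
  fix m
  obtain C where C: "\<And>j. real (Suc j) ^ m * b j \<le> C"
    using rapid_weights_bound[OF assms(1), of m] by metis
  obtain C' where C': "\<And>j. real (Suc j) ^ m * b' j \<le> C'"
    using rapid_weights_bound[OF assms(2), of m] by metis
  have "\<forall>j. real (Suc j) ^ m * (b j + b' j) \<le> C + C'"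
    unfolding distrib_left using add_mono[OF C C'] by blast
  then show "\<exists>C. \<forall>j. real (Suc j) ^ m * (b j + b' j) \<le> C" by blast
qed

lemma rapid_weights_nonempty: "(\<lambda>j. (1/2) ^ j) \<in> rapid_weights"
  unfolding rapid_weights_def
proof (intro CollectI conjI allI)
  fix k
  have "summable (\<lambda>j. real (Suc j) ^ k * (1/2) ^ j)"
  \<comment> \<open>Any ratio strictly between 1/2 and 1 absorbs the polynomial factor.\<close>
  proof (rule summable_comparison_test_bigo[where g = "\<lambda>j. (3/4 :: real) ^ j"])
    show "summable (\<lambda>j. norm ((3/4 :: real) ^ j))" by (simp add: summable_geometric)
    show "(\<lambda>j. real (Suc j) ^ k * (1/2) ^ j) \<in> O(\<lambda>j. (3/4) ^ j)" by real_asymp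
  qed
  then have "Bseq (\<lambda>j. real (Suc j) ^ k * (1/2) ^ j)"
    by (intro convergent_imp_Bseq) (auto simp: convergent_def dest: summable_LIMSEQ_zero)
  then obtain K where "\<forall>j. norm (real (Suc j) ^ k * (1/2) ^ j) \<le> K" by (auto elim: BseqE)
  then show "\<exists>C. \<forall>j. real (Suc j) ^ k * (1/2) ^ j \<le> C"
    by (metis abs_ge_self order_trans real_norm_def)
qed simp

text \<open>For fixed \<open>n\<close> this says that the row-weighted entries grow at most
  polynomially in \<open>j\<close>: growth beyond every power of \<open>j\<close> would be detected
  by some rapidly decreasing weight. Universal quantification over \<open>b\<close> thus replaces
  the existential one over \<open>N\<close> and yields seminorms directly.\<close>

definition double_seqs :: "(nat \<Rightarrow> nat \<Rightarrow> complex) set" where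
  "double_seqs =
     {g. \<forall>n. \<forall>b\<in>rapid_weights. \<exists>c. \<forall>i j. real (Suc i) ^ n * b j * cmod (g i j) \<le> c}"

definition double_bounded :: "(nat \<Rightarrow> nat \<Rightarrow> complex) set \<Rightarrow> bool" where
  "double_bounded B \<longleftrightarrow>
     (\<forall>n. \<forall>b\<in>rapid_weights. \<exists>c. \<forall>g\<in>B. \<forall>i j. real (Suc i) ^ n * b j * cmod (g i j) \<le> c)"

definition double_ball :: "nat \<Rightarrow> (nat \<Rightarrow> real) \<Rightarrow> (nat \<Rightarrow> nat \<Rightarrow> complex) set" where
  "double_ball n b = {g. \<forall>i j. real (Suc i) ^ n * b j * cmod (g i j) \<le> 1}"

text \<open>\<open>fun_scale\<close> acts on complex-valued functions of one argument; curried
  double sequences need their own scaling.\<close>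

definition double_scale :: "complex \<Rightarrow> (nat \<Rightarrow> nat \<Rightarrow> complex) \<Rightarrow> nat \<Rightarrow> nat \<Rightarrow> complex" where
  "double_scale c g = (\<lambda>i j. c * g i j)"

lemma double_bounded_subset: "double_bounded B \<Longrightarrow> B \<subseteq> double_seqs"
  unfolding double_bounded_def double_seqs_def by blast

lemma double_seqsD:
  "\<lbrakk>g \<in> double_seqs; b \<in> rapid_weights\<rbrakk> \<Longrightarrow> \<exists>c. \<forall>i j. real (Suc i) ^ n * b j * cmod (g i j) \<le> c"
  unfolding double_seqs_def by blast

text \<open>Solidity of the space: it permits cutting a double sequence down to a region, a column
  or a tail.\<close>

lemma double_seqs_mono:
  assumes "g \<in> double_seqs" "\<And>i j. cmod (h i j) \<le> C * cmod (g i j)"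
  shows "h \<in> double_seqs"
  unfolding double_seqs_def
proof (intro CollectI allI ballI)
  fix n b assume b: "b \<in> rapid_weights"
  then obtain c where c: "\<And>i j. real (Suc i) ^ n * b j * cmod (g i j) \<le> c"
    using assms(1) unfolding double_seqs_def by blast
  have "real (Suc i) ^ n * b j * cmod (h i j) \<le> \<bar>C\<bar> * c" for i j
  proof -
    have "real (Suc i) ^ n * b j * cmod (h i j) \<le> real (Suc i) ^ n * b j * (\<bar>C\<bar> * cmod (g i j))"
      using assms(2)[of i j] rapid_weights_pos[OF b, of j]
      by (intro mult_left_mono order_trans[OF assms(2)] mult_right_mono) auto
    also have "\<dots> = \<bar>C\<bar> * (real (Suc i) ^ n * b j * cmod (g i j))" by simp
    also have "\<dots> \<le> \<bar>C\<bar> * c" using c by (intro mult_left_mono) auto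
    finally show ?thesis .
  qed
  then show "\<exists>c. \<forall>i j. real (Suc i) ^ n * b j * cmod (h i j) \<le> c" by blast
qed

lemma double_seqs_add:
  assumes "g \<in> double_seqs" "h \<in> double_seqs"
  shows "g + h \<in> double_seqs"
  unfolding double_seqs_def
proof (intro CollectI allI ballI)
  fix n b assume b: "b \<in> rapid_weights"
  obtain c where c: "\<And>i j. real (Suc i) ^ n * b j * cmod (g i j) \<le> c"
    using assms(1) b unfolding double_seqs_def by blast
  obtain d where d: "\<And>i j. real (Suc i) ^ n * b j * cmod (h i j) \<le> d"
    using assms(2) b unfolding double_seqs_def by blast
  have "real (Suc i) ^ n * b j * cmod ((g + h) i j) \<le> c + d" for i j
  proof -
    have "real (Suc i) ^ n * b j * cmod ((g + h) i j)
        \<le> real (Suc i) ^ n * b j * (cmod (g i j) + cmod (h i j))"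
      using rapid_weights_pos[OF b, of j] by (intro mult_left_mono) (auto simp: norm_triangle_ineq)
    also have "\<dots> \<le> c + d" unfolding distrib_left using c d by (intro add_mono)
    finally show ?thesis .
  qed
  then show "\<exists>c. \<forall>i j. real (Suc i) ^ n * b j * cmod ((g + h) i j) \<le> c" by blast
qed

lemma double_seqs_scale: "g \<in> double_seqs \<Longrightarrow> double_scale c g \<in> double_seqs"
  by (erule double_seqs_mono[where C = "cmod c"]) (simp add: double_scale_def norm_mult)

text \<open>A rapid weight absorbs the growth \<open>j^m\<close>. Here \<open>m\<close> and
  \<open>C\<close> may depend on the row exponent \<open>k\<close>, but not on
  \<open>g\<close>.\<close>

lemma double_boundedI:
  assumes "\<And>k. \<exists>m C. \<forall>g\<in>B. \<forall>i j. real (Suc i) ^ k * cmod (g i j) \<le> C * real (Suc j) ^ m"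
  shows "double_bounded B"
  unfolding double_bounded_def
proof (intro allI ballI)
  fix n b assume b: "b \<in> rapid_weights"
  obtain m C where C: "\<And>g i j. g \<in> B \<Longrightarrow> real (Suc i) ^ n * cmod (g i j) \<le> C * real (Suc j) ^ m"
    using assms by blast
  obtain D where D: "\<And>j. real (Suc j) ^ m * b j \<le> D" using rapid_weights_bound[OF b] by metis
  have "real (Suc i) ^ n * b j * cmod (g i j) \<le> \<bar>C\<bar> * D" if "g \<in> B" for g i j
  proof -
    have "real (Suc i) ^ n * b j * cmod (g i j) = b j * (real (Suc i) ^ n * cmod (g i j))" by simp
    also have "\<dots> \<le> b j * (\<bar>C\<bar> * real (Suc j) ^ m)"
      using C[OF that, of i j] rapid_weights_pos[OF b, of j]
      by (intro mult_left_mono order_trans[OF C[OF that]] mult_right_mono) auto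
    also have "\<dots> = \<bar>C\<bar> * (real (Suc j) ^ m * b j)" by simp
    also have "\<dots> \<le> \<bar>C\<bar> * D" using D by (intro mult_left_mono) auto
    finally show ?thesis .
  qed
  then show "\<exists>c. \<forall>g\<in>B. \<forall>i j. real (Suc i) ^ n * b j * cmod (g i j) \<le> c" by blast
qed

text \<open>Telescoping against \<open>1 / (j * (j + 1))\<close>. The constant 2 determines the
  factors 4 and 16 in the weights chosen later.\<close>

lemma sum_inverse_squares_le: "(\<Sum>j<m. 1 / real (Suc j) ^ 2) \<le> 2"
proof -
  have "(\<Sum>j<Suc m. 1 / real (Suc j) ^ 2) \<le> 2 - 1 / real (Suc m)" for m
  proof (induction m)
    case (Suc m)
    have "1 / real (Suc (Suc m)) ^ 2 \<le> 1 / (real (Suc m) * real (Suc (Suc m)))"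
      by (intro divide_left_mono) (auto simp: power2_eq_square intro!: mult_right_mono)
    also have "\<dots> = 1 / real (Suc m) - 1 / real (Suc (Suc m))"
      by (simp add: field_simps)
    finally have "1 / real (Suc (Suc m)) ^ 2 \<le> 1 / real (Suc m) - 1 / real (Suc (Suc m))" .
    then show ?case using Suc by simp
  qed simp
  moreover have "(\<Sum>j<m. 1 / real (Suc j) ^ 2) \<le> (\<Sum>j<Suc m. 1 / real (Suc j) ^ 2)" by simp
  moreover have "2 - 1 / real (Suc m) \<le> 2" by simp
  ultimately show ?thesis by (meson order_trans)
qed

text \<open>The infimum over all \<open>N\<close> may fail to be attained, so only \<open>N \<le> j\<close> compete.\<close>

lemma rapid_weights_minorant:
  assumes C: "\<And>N. 0 < C N"
  obtains \<beta> where "\<beta> \<in> rapid_weights" "\<And>j. \<exists>N. \<beta> j = C N / real (Suc j) ^ N"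
proof -
  define f where "f = (\<lambda>j N. C N / real (Suc j) ^ N)"
  define \<beta> where "\<beta> = (\<lambda>j. Min (f j ` {..j}))"
  have f_pos: "0 < f j N" for j N using C by (simp add: f_def)
  have "\<exists>N. \<beta> j = f j N" for j
    using Min_in[of "f j ` {..j}"] unfolding \<beta>_def by blast
  then obtain M where M: "\<And>j. \<beta> j = f j (M j)" by metis
  have \<beta>: "\<beta> \<in> rapid_weights"
    unfolding rapid_weights_def
  proof (intro CollectI conjI allI)
    fix j show "0 < \<beta> j" by (simp add: M f_pos)
  next
    fix k
    \<comment> \<open>Exponent \<open>k\<close> competes as soon as \<open>k \<le> j\<close>; the
      finitely many earlier columns are paid for by the sum.\<close>
    have "real (Suc j) ^ k * \<beta> j \<le> C k + (\<Sum>j<k. real (Suc j) ^ k * \<beta> j)" for j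
    proof (cases "k \<le> j")
      case True
      then have "\<beta> j \<le> f j k" unfolding \<beta>_def by (intro Min_le) auto
      then have "real (Suc j) ^ k * \<beta> j \<le> C k" by (simp add: f_def field_simps)
      then show ?thesis using f_pos by (simp add: M add_increasing2 sum_nonneg less_imp_le)
    next
      case False
      then have "real (Suc j) ^ k * \<beta> j \<le> (\<Sum>j<k. real (Suc j) ^ k * \<beta> j)"
        using f_pos by (intro member_le_sum) (auto simp: M less_imp_le)
      then show ?thesis using C[of k] by linarith
    qed
    then show "\<exists>C. \<forall>j. real (Suc j) ^ k * \<beta> j \<le> C" by blast
  qed
  then show ?thesis using that[of \<beta>] M unfolding f_def by blast
qed

section \<open>The space of double sequences is bornological\<close>

lemma double_scale_apply [simp]: "double_scale c g i j = c * g i j"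
  by (simp add: double_scale_def)

lemma double_scale_simps [simp]:
  "double_scale c 0 = 0"
  "double_scale 0 g = 0"
  "double_scale c (double_scale d g) = double_scale (c * d) g"
  "double_scale 1 g = g"
  "double_scale c (g + h) = double_scale c g + double_scale c h"
  by (auto simp: double_scale_def fun_eq_iff algebra_simps)

text \<open>Membership of \<open>g\<close> in \<open>c W\<close>, that is, an upper bound for the
  Minkowski functional of \<open>W\<close> without taking an infimum. It is applied with positive
  \<open>c\<close>.\<close>

definition gauge_le :: "(nat \<Rightarrow> nat \<Rightarrow> complex) set \<Rightarrow> real \<Rightarrow> (nat \<Rightarrow> nat \<Rightarrow> complex) \<Rightarrow> bool" where
  "gauge_le W c g \<longleftrightarrow> double_scale (complex_of_real (1 / c)) g \<in> W"

text \<open>The vector \<open>(g + h) / (c + d)\<close> is the convex combination of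
  \<open>g / c\<close> and \<open>h / d\<close> with coefficients \<open>c / (c + d)\<close> and
  \<open>d / (c + d)\<close>.\<close>

lemma gauge_le_add:
  assumes W: "absolutely_convex double_scale W" and "0 < c" "0 < d" "gauge_le W c g" "gauge_le W d h"
  shows "gauge_le W (c + d) (g + h)"
proof -
  have "cmod (complex_of_real (c / (c + d))) + cmod (complex_of_real (d / (c + d))) \<le> 1"
    unfolding norm_of_real using assms(2,3) by (simp add: add_divide_distrib[symmetric])
  then have "double_scale (complex_of_real (c / (c + d))) (double_scale (complex_of_real (1 / c)) g)
      + double_scale (complex_of_real (d / (c + d))) (double_scale (complex_of_real (1 / d)) h) \<in> W"
    using W assms(4,5) unfolding absolutely_convex_def gauge_le_def by blast
  moreover have "complex_of_real (c / (c + d)) * complex_of_real (1 / c) = complex_of_real (1 / (c + d))"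
    "complex_of_real (d / (c + d)) * complex_of_real (1 / d) = complex_of_real (1 / (c + d))"
    unfolding of_real_mult[symmetric] using assms(2,3) by simp_all
  ultimately show ?thesis
    unfolding gauge_le_def double_scale_simps by simp
qed

lemma gauge_le_mono:
  assumes W: "absolutely_convex double_scale W" and "0 < c" "c \<le> d" "gauge_le W c g"
  shows "gauge_le W d g"
proof -
  \<comment> \<open>The coefficient 0 extracts balancedness from the two-point form of absolute
    convexity.\<close>
  have "cmod (complex_of_real (c / d)) + cmod 0 \<le> 1"
    unfolding norm_of_real using assms(2,3) by simp
  then have "double_scale (complex_of_real (c / d)) (double_scale (complex_of_real (1 / c)) g)
      + double_scale 0 (double_scale (complex_of_real (1 / c)) g) \<in> W"
    using W assms(4) unfolding absolutely_convex_def gauge_le_def by blast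
  moreover have "complex_of_real (c / d) * complex_of_real (1 / c) = complex_of_real (1 / d)"
    unfolding of_real_mult[symmetric] using assms(2,3) by simp
  ultimately show ?thesis
    unfolding gauge_le_def double_scale_simps by simp
qed

lemma gauge_le_scale:
  assumes "0 < c" "0 < t" "gauge_le W c (double_scale (complex_of_real t) g)"
  shows "gauge_le W (c / t) g"
proof -
  have "complex_of_real (1 / c) * complex_of_real t = complex_of_real (1 / (c / t))"
    unfolding of_real_mult[symmetric] by simp
  then show ?thesis using assms(3) unfolding gauge_le_def double_scale_simps by metis
qed

text \<open>The extra summand \<open>h\<close> starts the induction with a positive bound; an empty
  sum would have bound 0, which \<open>gauge_le_add\<close> does not admit.\<close>

lemma gauge_le_sum:
  assumes W: "absolutely_convex double_scale W" and "0 < d" "gauge_le W d h"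
    and "\<And>j. 0 < c j" "\<And>j::nat. gauge_le W (c j) (g j)"
  shows "gauge_le W (d + (\<Sum>j<J. c j)) (h + (\<Sum>j<J. g j))"
proof (induction J)
  case (Suc J)
  have "0 < d + (\<Sum>j<J. c j)" using assms(2,4) by (simp add: add_pos_nonneg sum_nonneg less_imp_le)
  then show ?case
    using gauge_le_add[OF W _ assms(4) Suc.IH assms(5)] by (simp only: sum.lessThan_Suc add.assoc)
qed (use assms in simp)

lemma gauge_le_bounded:
  assumes "double_bounded B" "absorbs double_scale W B"
  obtains r where "0 < r" "\<And>g. g \<in> B \<Longrightarrow> gauge_le W r g"
proof -
  obtain r where r: "0 < r" "\<And>c. r \<le> cmod c \<Longrightarrow> B \<subseteq> double_scale c ` W"
    using assms(2) unfolding absorbs_def by blast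
  have "gauge_le W r g" if g: "g \<in> B" for g
  proof -
    obtain u where u: "u \<in> W" "g = double_scale (complex_of_real r) u"
      using r(2)[of "complex_of_real r"] r(1) g by auto
    have "complex_of_real (1 / r) * complex_of_real r = 1"
      using r(1) by simp
    then have "double_scale (complex_of_real (1 / r)) g = u"
      unfolding u(2) double_scale_simps(3) by simp
    then show ?thesis using u(1) unfolding gauge_le_def by simp
  qed
  then show ?thesis using that r(1) by blast
qed

text \<open>A sequence of counterexamples for \<open>n = 0, 1, 2, \<dots>\<close> would be a bounded set: each condition
  with exponent \<open>k\<close> concerns all but finitely many of its members.\<close>

lemma absorbs_row_ball:
  assumes W: "absolutely_convex double_scale W"
    and born: "\<And>B. double_bounded B \<Longrightarrow> absorbs double_scale W B"
  obtains n r where "0 < r"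
    "\<And>g. \<lbrakk>g \<in> double_seqs; \<And>i j. real (Suc i) ^ n * cmod (g i j) \<le> 1\<rbrakk> \<Longrightarrow> gauge_le W r g"
proof -
  \<comment> \<open>The factor grows with \<open>n\<close>, so that counterexamples would escape
    every fixed multiple of \<open>W\<close>.\<close>
  have "\<exists>n. \<forall>g\<in>double_seqs. (\<forall>i j. real (Suc i) ^ n * cmod (g i j) \<le> 1) \<longrightarrow> gauge_le W (real (Suc n)) g"
  proof (rule ccontr)
    assume "\<not> ?thesis"
    then obtain x where x: "\<And>n. x n \<in> double_seqs"
      "\<And>n i j. real (Suc i) ^ n * cmod (x n i j) \<le> 1" "\<And>n. \<not> gauge_le W (real (Suc n)) (x n)"
      by metis
    have bdd: "double_bounded (range x)"
      unfolding double_bounded_def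
    proof (intro allI ballI)
      fix k b assume b: "b \<in> rapid_weights"
      obtain D where D: "0 < D" "\<And>j. real (Suc j) ^ 0 * b j \<le> D" using rapid_weights_bound[OF b] by metis
      have "\<forall>n. \<exists>c. \<forall>i j. real (Suc i) ^ k * b j * cmod (x n i j) \<le> c"
        using x(1) b unfolding double_seqs_def by blast
      then obtain c where c: "\<And>n i j. real (Suc i) ^ k * b j * cmod (x n i j) \<le> c n" by metis
      have "real (Suc i) ^ k * b j * cmod (x n i j) \<le> D + (\<Sum>n<k. \<bar>c n\<bar>)" for n i j
      proof (cases "n < k")
        case True
        then have "\<bar>c n\<bar> \<le> (\<Sum>n<k. \<bar>c n\<bar>)" by (intro member_le_sum) auto
        then show ?thesis using c[where n = n and i = i and j = j] D(1) by linarith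
      next
        case False
        have "real (Suc i) ^ k * b j * cmod (x n i j) \<le> real (Suc i) ^ n * b j * cmod (x n i j)"
          using False rapid_weights_pos[OF b, of j]
          by (intro mult_right_mono power_increasing) auto
        also have "\<dots> = b j * (real (Suc i) ^ n * cmod (x n i j))" by simp
        also have "\<dots> \<le> b j * 1"
          using x(2)[of i n j] rapid_weights_pos[OF b, of j] by (intro mult_left_mono) auto
        also have "\<dots> \<le> D" using D(2)[of j] by simp
        finally show ?thesis by (simp add: add_increasing2 sum_nonneg)
      qed
      then show "\<exists>c. \<forall>g\<in>range x. \<forall>i j. real (Suc i) ^ k * b j * cmod (g i j) \<le> c" by blast
    qed
    then obtain r where r: "0 < r" "\<And>g. g \<in> range x \<Longrightarrow> gauge_le W r g"
      using gauge_le_bounded born by metis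
    obtain n where "r \<le> real n" using real_arch_simple by blast
    then have "gauge_le W (real (Suc n)) (x n)"
      using gauge_le_mono[OF W r(1) _ r(2)[OF rangeI]] by simp
    then show False using x(3) by blast
  qed
  then obtain n where "\<And>g. \<lbrakk>g \<in> double_seqs; \<And>i j. real (Suc i) ^ n * cmod (g i j) \<le> 1\<rbrakk>
      \<Longrightarrow> gauge_le W (real (Suc n)) g" by blast
  then show ?thesis using that[of "real (Suc n)" n] by simp
qed

text \<open>Where \<open>i \<le> j\<^sup>N\<close>, powers of \<open>i\<close> cost only powers of \<open>j\<close>, so the members of the
  \<open>(n + 1, N)\<close>-ball restricted to this region form a bounded set; elsewhere one factor \<open>i\<close> pays
  for \<open>j\<^sup>N\<close>, which leaves a member of the \<open>(n, 0)\<close>-ball.\<close>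

lemma absorbs_column_balls:
  assumes W: "absolutely_convex double_scale W"
    and born: "\<And>B. double_bounded B \<Longrightarrow> absorbs double_scale W B"
  obtains n where "\<And>N. \<exists>r>0. \<forall>g\<in>double_seqs.
    (\<forall>i j. real (Suc i) ^ n * cmod (g i j) \<le> real (Suc j) ^ N) \<longrightarrow> gauge_le W r g"
proof -
  obtain n r where r: "0 < r"
    "\<And>g. \<lbrakk>g \<in> double_seqs; \<And>i j. real (Suc i) ^ n * cmod (g i j) \<le> 1\<rbrakk> \<Longrightarrow> gauge_le W r g"
    using absorbs_row_ball[OF assms] by metis
  have "\<exists>r>0. \<forall>g\<in>double_seqs.
    (\<forall>i j. real (Suc i) ^ Suc n * cmod (g i j) \<le> real (Suc j) ^ N) \<longrightarrow> gauge_le W r g" for N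
  proof -
    \<comment> \<open>Where \<open>i \<le> j^N\<close>, the factor \<open>i^k\<close> costs
      \<open>j^(N*k)\<close>; the entry itself is at most \<open>j^N\<close> because
      \<open>i^(n+1) \<ge> 1\<close>, which accounts for the remaining \<open>+ N\<close>.\<close>
    define D where "D = {g :: nat \<Rightarrow> nat \<Rightarrow> complex.
      \<forall>k i j. real (Suc i) ^ k * cmod (g i j) \<le> real (Suc j) ^ (N * k + N)}"
    have "double_bounded D"
    proof (rule double_boundedI)
      fix k
      have "\<forall>g\<in>D. \<forall>i j. real (Suc i) ^ k * cmod (g i j) \<le> 1 * real (Suc j) ^ (N * k + N)"
        unfolding D_def mult_1 by blast
      then show "\<exists>m C. \<forall>g\<in>D. \<forall>i j. real (Suc i) ^ k * cmod (g i j) \<le> C * real (Suc j) ^ m" by blast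
    qed
    then obtain t where t: "0 < t" "\<And>g. g \<in> D \<Longrightarrow> gauge_le W t g"
      using gauge_le_bounded born by metis
    have "gauge_le W (t + r) g"
      if g: "g \<in> double_seqs" and le: "\<And>i j. real (Suc i) ^ Suc n * cmod (g i j) \<le> real (Suc j) ^ N" for g
    proof -
      define h where "h = (\<lambda>i j. if Suc i \<le> Suc j ^ N then g i j else 0)"
      define h' where "h' = (\<lambda>i j. if Suc i \<le> Suc j ^ N then 0 else g i j)"
      have "g = h + h'" by (auto simp: h_def h'_def fun_eq_iff)
      moreover have "h \<in> D"
        unfolding D_def
      proof (intro CollectI allI)
        fix k i j
        show "real (Suc i) ^ k * cmod (h i j) \<le> real (Suc j) ^ (N * k + N)"
        proof (cases "Suc i \<le> Suc j ^ N")
          case True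
          then have "real (Suc i) \<le> real (Suc j) ^ N" by (metis of_nat_le_iff of_nat_power)
          then have "real (Suc i) ^ k \<le> real (Suc j) ^ (N * k)"
            by (metis power_mono power_mult of_nat_0_le_iff)
          moreover have "cmod (h i j) \<le> real (Suc i) ^ Suc n * cmod (g i j)"
            using mult_right_mono[of 1 "real (Suc i) ^ Suc n" "cmod (g i j)"] True
            by (simp add: h_def del: power_Suc)
          then have "cmod (h i j) \<le> real (Suc j) ^ N" using le[of i j] by linarith
          ultimately show ?thesis unfolding power_add by (intro mult_mono) auto
        qed (simp add: h_def)
      qed
      moreover have "h' \<in> double_seqs"
        using g by (rule double_seqs_mono[where C = 1]) (simp add: h'_def)
      moreover have "real (Suc i) ^ n * cmod (h' i j) \<le> 1" for i j
      proof (cases "Suc i \<le> Suc j ^ N")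
        case False
        then have "real (Suc j) ^ N \<le> real (Suc i)" by (metis of_nat_le_iff of_nat_power nat_le_linear)
        then have "real (Suc i) * (real (Suc i) ^ n * cmod (g i j)) \<le> real (Suc i) * 1"
          using order_trans[OF le[of i j]] unfolding power_Suc mult.assoc mult_1_right by blast
        then have "real (Suc i) ^ n * cmod (g i j) \<le> 1"
          by (rule mult_left_le_imp_le) simp
        then show ?thesis using False by (simp add: h'_def)
      qed (simp add: h'_def)
      ultimately show ?thesis using gauge_le_add[OF W t(1) r(1)] t(2) r(2) by blast
    qed
    then show ?thesis using t(1) r(1) by (intro exI[of _ "t + r"]) auto
  qed
  then show ?thesis using that by blast
qed

proposition double_seqs_bornological:
  assumes W: "absolutely_convex double_scale W"
    and born: "\<And>B. double_bounded B \<Longrightarrow> absorbs double_scale W B"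
  obtains n b where "b \<in> rapid_weights" "double_seqs \<inter> double_ball n b \<subseteq> W"
proof -
  obtain n where "\<And>N. \<exists>r>0. \<forall>g\<in>double_seqs.
    (\<forall>i j. real (Suc i) ^ n * cmod (g i j) \<le> real (Suc j) ^ N) \<longrightarrow> gauge_le W r g"
    using absorbs_column_balls[OF assms] by metis
  then obtain C where C: "\<And>N. 0 < C N"
    "\<And>N g. \<lbrakk>g \<in> double_seqs; \<And>i j. real (Suc i) ^ n * cmod (g i j) \<le> real (Suc j) ^ N\<rbrakk>
      \<Longrightarrow> gauge_le W (C N) g"
    by metis
  obtain \<beta> where \<beta>: "\<beta> \<in> rapid_weights" "\<And>j. \<exists>N. \<beta> j = C N / real (Suc j) ^ N"
    using rapid_weights_minorant C(1) by metis
  then obtain M where M: "\<And>j. \<beta> j = C (M j) / real (Suc j) ^ M j" by metis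
  \<comment> \<open>The factor 4 times the square makes the column bounds
    \<open>\<beta> j / b j\<close> sum to at most 1/2, which leaves 1/2 for the tail.\<close>
  define b where "b = (\<lambda>j. 4 * (real (Suc j) ^ 2 * \<beta> j))"
  have b: "b \<in> rapid_weights"
    unfolding b_def by (intro rapid_weights_scale rapid_weights_pow \<beta>(1)) simp
  have "g \<in> W" if g: "g \<in> double_seqs" "g \<in> double_ball n b" for g
  proof -
    define col where "col = (\<lambda>j i j'. if j' = j then g i j' else 0)"
    define tl where "tl = (\<lambda>J i j. if j < J then 0 else g i j)"
    have col: "gauge_le W (1 / (4 * real (Suc j) ^ 2)) (col j)" for j
    proof -
      \<comment> \<open>The largest scaling for which the bound \<open>1 / b j\<close> on column
        \<open>j\<close> still fits into the ball with exponent \<open>M j\<close>. Dividing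
        \<open>C (M j)\<close> by it gives \<open>\<beta> j / b j\<close>.\<close>
      define t where "t = b j * real (Suc j) ^ M j"
      have t: "0 < t" using rapid_weights_pos[OF b] by (simp add: t_def)
      have "gauge_le W (C (M j)) (double_scale (complex_of_real t) (col j))"
      proof (rule C(2))
        show "double_scale (complex_of_real t) (col j) \<in> double_seqs"
          by (intro double_seqs_scale double_seqs_mono[OF g(1), where C = 1]) (simp add: col_def)
      next
        fix i j'
        have "real (Suc i) ^ n * b j * cmod (g i j) * real (Suc j) ^ M j \<le> 1 * real (Suc j) ^ M j"
          using g(2) unfolding double_ball_def by (intro mult_right_mono) auto
        then show "real (Suc i) ^ n * cmod (double_scale (complex_of_real t) (col j) i j') \<le> real (Suc j') ^ M j"
          using t by (simp add: col_def norm_mult) (simp add: t_def mult_ac)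
      qed
      then have "gauge_le W (C (M j) / t) (col j)" using gauge_le_scale C(1) t by blast
      moreover have "C (M j) / t = 1 / (4 * real (Suc j) ^ 2)"
        using C(1)[of "M j"] by (simp add: t_def b_def M field_simps)
      ultimately show ?thesis by simp
    qed
    \<comment> \<open>The tail \<open>tl J\<close> lives on columns \<open>j \<ge> J\<close>, so the
      factor \<open>Suc J\<close> is at most \<open>Suc j\<close> there and passes into the weight,
      which remains rapid.\<close>
    have "double_bounded (range (\<lambda>J. double_scale (complex_of_real (real (Suc J))) (tl J)))"
      unfolding double_bounded_def
    proof (intro allI ballI)
      fix k and a :: "nat \<Rightarrow> real" assume a: "a \<in> rapid_weights"
      obtain c where c: "\<And>i j. real (Suc i) ^ k * (real (Suc j) ^ 1 * a j) * cmod (g i j) \<le> c"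
        using double_seqsD[OF g(1) rapid_weights_pow[OF a, of 1]] by blast
      have "real (Suc i) ^ k * a j * cmod (double_scale (complex_of_real (real (Suc J))) (tl J) i j) \<le> \<bar>c\<bar>" for J i j
      proof (cases "j < J")
        case False
        have "real (Suc i) ^ k * a j * (real (Suc J) * cmod (g i j))
            \<le> real (Suc i) ^ k * a j * (real (Suc j) * cmod (g i j))"
          using False rapid_weights_pos[OF a, of j] by (intro mult_left_mono mult_right_mono) auto
        also have "\<dots> \<le> c" using c[of i j] by (simp add: mult_ac)
        finally show ?thesis using False by (simp add: tl_def norm_mult del: of_nat_Suc)
      qed (simp add: tl_def)
      then show "\<exists>c. \<forall>g\<in>range (\<lambda>J. double_scale (complex_of_real (real (Suc J))) (tl J)).
          \<forall>i j. real (Suc i) ^ k * a j * cmod (g i j) \<le> c" by blast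
    qed
    then obtain r where r: "0 < r"
      "\<And>h. h \<in> range (\<lambda>J. double_scale (complex_of_real (real (Suc J))) (tl J)) \<Longrightarrow> gauge_le W r h"
      using gauge_le_bounded born by metis
    \<comment> \<open>\<open>J\<close> depends on \<open>g\<close>, but the bounds for the tail and
      for the columns do not, so the ball fixed beforehand serves every \<open>g\<close>.\<close>
    obtain J where J: "2 * r \<le> real J" using real_arch_simple by blast
    have "gauge_le W (r / real (Suc J)) (tl J)" by (rule gauge_le_scale) (use r in auto)
    moreover have "r / real (Suc J) \<le> 1 / 2" using J by (simp add: field_simps)
    ultimately have tl: "gauge_le W (1 / 2) (tl J)"
      using gauge_le_mono[OF W] r(1) by (metis divide_pos_pos of_nat_0_less_iff zero_less_Suc)
    have "gauge_le W (1 / 2 + (\<Sum>j<J. 1 / (4 * real (Suc j) ^ 2))) (tl J + (\<Sum>j<J. col j))"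
      by (rule gauge_le_sum[OF W _ tl _ col]) auto
    moreover have "tl J + (\<Sum>j<J. col j) = g"
    proof (intro ext)
      fix i j
      have "(\<Sum>j'<J. col j') i j = (\<Sum>j'<J. col j' i j)" by (induction J) auto
      also have "\<dots> = (if j < J then g i j else 0)" by (simp add: col_def)
      finally show "(tl J + (\<Sum>j<J. col j)) i j = g i j" by (simp add: tl_def)
    qed
    moreover have "1 / 2 + (\<Sum>j<J. 1 / (4 * real (Suc j) ^ 2)) \<le> 1"
    proof -
      have "(\<Sum>j<J. 1 / (4 * real (Suc j) ^ 2)) = (\<Sum>j<J. 1 / real (Suc j) ^ 2) / 4"
        by (simp add: sum_divide_distrib mult.commute)
      then show ?thesis using sum_inverse_squares_le[of J] by simp
    qed
    moreover have "0 < 1 / 2 + (\<Sum>j<J. 1 / (4 * real (Suc j) ^ 2))"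
      by (intro add_pos_nonneg sum_nonneg) auto
    ultimately have "gauge_le W 1 g"
      using gauge_le_mono[OF W, of "1 / 2 + (\<Sum>j<J. 1 / (4 * real (Suc j) ^ 2))" 1 g] by simp
    then show ?thesis by (simp add: gauge_le_def)
  qed
  then show ?thesis using that[OF b] by blast
qed

section \<open>Topologies generated by seminorms\<close>

text \<open>Nonnegativity comes from \<open>p (- x) = p x\<close> and subadditivity. The shape
  \<open>p (0 - x)\<close> is the one that membership of 0 in a subbasic ball around
  \<open>x\<close> supplies.\<close>

lemma seminorm_onD:
  fixes sc :: "complex \<Rightarrow> 'a::ab_group_add \<Rightarrow> 'a"
  assumes vs: "vector_space sc" and V: "module.subspace sc V" and p: "seminorm_on sc V p"
  shows seminorm_on_zero: "p 0 = 0"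
    and seminorm_on_nonneg: "x \<in> V \<Longrightarrow> 0 \<le> p x"
    and seminorm_on_diff: "x \<in> V \<Longrightarrow> y \<in> V \<Longrightarrow> p (y - x) \<le> p y + p (0 - x)"
    and seminorm_on_diff_commute: "x \<in> V \<Longrightarrow> y \<in> V \<Longrightarrow> p (x - y) = p (y - x)"
proof -
  interpret vector_space sc by fact
  have sub: "\<And>x y. x \<in> V \<Longrightarrow> y \<in> V \<Longrightarrow> p (x + y) \<le> p x + p y"
    and sc: "\<And>c x. x \<in> V \<Longrightarrow> p (sc c x) = cmod c * p x"
    using p unfolding seminorm_on_def by auto
  show z: "p 0 = 0" using sc[OF subspace_0[OF V], of 0] by simp
  have minus: "p (- x) = p x" if "x \<in> V" for x using sc[OF that, of "-1"] by simp
  show "x \<in> V \<Longrightarrow> 0 \<le> p x"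
    using sub[of x "- x"] minus[of x] subspace_neg[OF V, of x] z by simp
  show "x \<in> V \<Longrightarrow> y \<in> V \<Longrightarrow> p (y - x) \<le> p y + p (0 - x)"
    using sub[of y "- x"] subspace_neg[OF V, of x] by simp
  show "x \<in> V \<Longrightarrow> y \<in> V \<Longrightarrow> p (x - y) = p (y - x)"
    using minus[of "x - y"] subspace_diff[OF V] by simp
qed

text \<open>One inequality suffices for homogeneity: applied to the scalar \<open>inverse c\<close>
  it gives the reverse one.\<close>

lemma seminorm_onI:
  fixes sc :: "complex \<Rightarrow> 'a::ab_group_add \<Rightarrow> 'a"
  assumes vs: "vector_space sc" and V: "module.subspace sc V"
    and sub: "\<And>x y. x \<in> V \<Longrightarrow> y \<in> V \<Longrightarrow> p (x + y) \<le> p x + p y"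
    and le: "\<And>c x. x \<in> V \<Longrightarrow> p (sc c x) \<le> cmod c * p x"
  shows "seminorm_on sc V p"
proof -
  interpret vector_space sc by fact
  have zero: "p 0 = 0"
    using le[OF subspace_0[OF V], of 0] sub[OF subspace_0[OF V] subspace_0[OF V]] by simp
  have "p (sc c x) = cmod c * p x" if x: "x \<in> V" for c x
  proof (cases "c = 0")
    case False
    have "p (sc (inverse c) (sc c x)) \<le> cmod (inverse c) * p (sc c x)"
      using subspace_scale[OF V x] by (rule le)
    then have "cmod c * p x \<le> p (sc c x)"
      using False by (simp add: norm_inverse norm_divide field_simps)
    then show ?thesis using le[OF x] by (meson order_antisym)
  qed (simp add: zero)
  then show ?thesis using sub unfolding seminorm_on_def by blast
qed

lemma topspace_seminorm_topology:
  assumes "P \<noteq> {}"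
  shows "topspace (seminorm_topology V P) = V"
proof -
  obtain p where p: "p \<in> P" using assms by blast
  let ?S = "{{y \<in> V. p (y - x) < e} |p x e. p \<in> P \<and> x \<in> V \<and> 0 < e}"
  have "x \<in> \<Union>?S" if "x \<in> V" for x
  proof (rule UnionI)
    \<comment> \<open>\<open>p\<close> is an arbitrary function here, so the radius is chosen to
      exceed \<open>p 0\<close>.\<close>
    show "{y \<in> V. p (y - x) < \<bar>p 0\<bar> + 1} \<in> ?S"
      using p that by (intro CollectI exI[of _ p] exI[of _ x] exI[of _ "\<bar>p 0\<bar> + 1"]) auto
    show "x \<in> {y \<in> V. p (y - x) < \<bar>p 0\<bar> + 1}" using that by simp
  qed
  moreover have "\<Union>?S \<subseteq> V" by blast
  ultimately show ?thesis
    unfolding seminorm_topology_def topology_generated_by_topspace by blast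
qed

lemma openin_seminorm_topology:
  "\<lbrakk>p \<in> P; x \<in> V; 0 < e\<rbrakk> \<Longrightarrow> openin (seminorm_topology V P) {y \<in> V. p (y - x) < e}"
  unfolding seminorm_topology_def by (rule topology_generated_by_Basis) blast

text \<open>Induction on the generation of \<open>Q\<close>: a subbasic ball of radius
  \<open>e\<close> around \<open>x\<close> that contains 0 leaves the margin
  \<open>e - p (0 - x)\<close>, and directedness handles intersections. The sets in
  \<open>\<B>\<close> need not be balls of the given seminorms; the instances use explicit
  coordinate conditions.\<close>

lemma seminorm_topology_zero_base:
  assumes sub: "\<And>p x y. \<lbrakk>p \<in> P; x \<in> V; y \<in> V\<rbrakk> \<Longrightarrow> p (y - x) \<le> p y + p (0 - x)"
    and base: "\<And>p e. \<lbrakk>p \<in> P; 0 < e\<rbrakk> \<Longrightarrow> \<exists>U\<in>\<B>. \<forall>y\<in>V \<inter> U. p y < e"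
    and dir: "\<And>U U'. \<lbrakk>U \<in> \<B>; U' \<in> \<B>\<rbrakk> \<Longrightarrow> \<exists>U''\<in>\<B>. U'' \<subseteq> U \<inter> U'"
    and Q: "openin (seminorm_topology V P) Q" "0 \<in> Q"
  shows "\<exists>U\<in>\<B>. V \<inter> U \<subseteq> Q"
proof -
  let ?S = "{{y \<in> V. p (y - x) < e} |p x e. p \<in> P \<and> x \<in> V \<and> 0 < e}"
  have "generate_topology_on ?S Q"
    using Q(1) unfolding seminorm_topology_def openin_topology_generated_by_iff .
  then show ?thesis using Q(2)
  proof induction
    case (Int a b)
    then obtain U U' where "U \<in> \<B>" "V \<inter> U \<subseteq> a" "U' \<in> \<B>" "V \<inter> U' \<subseteq> b" by auto
    then show ?case using dir[of U U'] by blast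
  next
    case (UN K)
    then show ?case by (meson Sup_upper Union_iff order_trans)
  next
    case (Basis s)
    then obtain p x e where s: "s = {y \<in> V. p (y - x) < e}" "p \<in> P" "x \<in> V" by auto
    then have "0 < e - p (0 - x)" using Basis.prems by auto
    then obtain U where "U \<in> \<B>" "\<forall>y\<in>V \<inter> U. p y < e - p (0 - x)" using base s(2) by meson
    then show ?case using sub[OF s(2,3)] unfolding s(1) by (intro bexI[of _ U]) force+
  qed simp
qed

lemma continuous_seminorm_seminorm_topology:
  fixes sc :: "complex \<Rightarrow> 'a::ab_group_add \<Rightarrow> 'a"
  assumes vs: "vector_space sc" and V: "module.subspace sc V"
    and P: "\<And>p. p \<in> P \<Longrightarrow> seminorm_on sc V p" and p: "p \<in> P"
  shows "continuous_seminorm sc (seminorm_topology V P) p"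
proof -
  interpret vector_space sc by fact
  have top: "topspace (seminorm_topology V P) = V" using p by (intro topspace_seminorm_topology) auto
  have sub: "\<And>x y. x \<in> V \<Longrightarrow> y \<in> V \<Longrightarrow> p (x + y) \<le> p x + p y"
    using P[OF p] unfolding seminorm_on_def by auto
  note D = seminorm_onD[OF vs V P[OF p]]
  have "openin (seminorm_topology V P) {x \<in> V. p x \<in> U}" if U: "open U" for U
  proof (subst openin_subopen, intro ballI)
    fix x assume x: "x \<in> {x \<in> V. p x \<in> U}"
    then obtain e where e: "0 < e" "\<And>r. dist r (p x) < e \<Longrightarrow> r \<in> U"
      using U unfolding open_dist by blast
    have "p y \<in> U" if y: "y \<in> V" "p (y - x) < e" for y
    proof (rule e(2))
      have "p y \<le> p (y - x) + p x" "p x \<le> p (x - y) + p y"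
        using sub[of "y - x" x] sub[of "x - y" y] x y(1) subspace_diff[OF V] by auto
      then show "dist (p y) (p x) < e"
        using D(4)[of x y] x y by (simp add: dist_real_def)
    qed
    moreover have "x \<in> {y \<in> V. p (y - x) < e}" using x e(1) D(1) by simp
    ultimately show "\<exists>T. openin (seminorm_topology V P) T \<and> x \<in> T \<and> T \<subseteq> {x \<in> V. p x \<in> U}"
      using openin_seminorm_topology[OF p _ e(1)] x by blast
  qed
  then show ?thesis
    unfolding continuous_seminorm_def continuous_map_def top using P[OF p] by simp
qed

lemma openin_seminorm_ball:
  assumes "continuous_seminorm sc T p"
  shows "openin T {x \<in> topspace T. p x < e}"
proof -
  have "openin T {x \<in> topspace T. p x \<in> {..<e}}"
    by (rule openin_continuous_map_preimage[where Y = euclideanreal])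
      (use assms(1) in \<open>auto simp: continuous_seminorm_def\<close>)
  then show ?thesis by simp
qed

section \<open>Continuous seminorms on the sequence spaces\<close>

lemma fun_scale_apply [simp]: "fun_scale c f i = c * f i"
  by (simp add: fun_scale_def)

lemma vector_space_fun_scale: "vector_space fun_scale"
  by unfold_locales (auto simp: fun_eq_iff algebra_simps)

lemma module_fun_scale: "module fun_scale"
proof -
  interpret vector_space "fun_scale :: complex \<Rightarrow> ('a \<Rightarrow> complex) \<Rightarrow> _" by (rule vector_space_fun_scale)
  show ?thesis by unfold_locales
qed

text \<open>The exponent 0, absent from the definition, is recovered because the weights increase
  with the exponent.\<close>

lemma rapid_seqs_alt:
  "rapid_seqs = {x. \<forall>k. \<exists>C. \<forall>j. real (Suc j) ^ k * cmod (x j) \<le> C}"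
proof -
  have "\<exists>C. \<forall>j. real (Suc j) ^ k * cmod (x j) \<le> C"
    if x: "\<forall>k\<ge>1. \<exists>C. \<forall>j. real (Suc j) ^ k * cmod (x j) \<le> C" for k x
  proof -
    obtain C where C: "\<forall>j. real (Suc j) ^ Suc k * cmod (x j) \<le> C"
      using x[rule_format, of "Suc k"] by auto
    have "real (Suc j) ^ k * cmod (x j) \<le> real (Suc j) ^ Suc k * cmod (x j)" for j
      by (intro mult_right_mono power_increasing) auto
    then show ?thesis using C order_trans by blast
  qed
  then show ?thesis unfolding rapid_seqs_def bdd_above_def by fastforce
qed

lemma rapid_seqs_bound:
  assumes "x \<in> rapid_seqs"
  obtains C where "0 < C" "\<And>j. real (Suc j) ^ k * cmod (x j) \<le> C"
proof -
  obtain C where "\<And>j. real (Suc j) ^ k * cmod (x j) \<le> C"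
    using assms unfolding rapid_seqs_alt by blast
  then have "real (Suc j) ^ k * cmod (x j) \<le> \<bar>C\<bar> + 1" for j
    by (rule order_trans) simp
  then show ?thesis using that[of "\<bar>C\<bar> + 1"] by simp
qed

text \<open>The weight beats the growth of \<open>y\<close> with \<open>k\<close> powers to spare:
  two spare powers give summability, one gives small tails.\<close>

lemma slow_seqs_bound:
  assumes "y \<in> slow_seqs" "b \<in> rapid_weights"
  obtains C where "0 < C" "\<And>j. real (Suc j) ^ k * (b j * cmod (y j)) \<le> C"
proof -
  obtain m C where C: "\<And>j. cmod (y j) / real (Suc j) ^ m \<le> C"
    using assms(1) unfolding slow_seqs_def bdd_above_def by auto
  obtain D where D: "0 < D" "\<And>j. real (Suc j) ^ (k + m) * b j \<le> D" using rapid_weights_bound[OF assms(2)] by metis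
  have "real (Suc j) ^ k * (b j * cmod (y j)) \<le> D * (\<bar>C\<bar> + 1)" for j
  proof -
    have "real (Suc j) ^ k * (b j * cmod (y j))
        = (real (Suc j) ^ (k + m) * b j) * (cmod (y j) / real (Suc j) ^ m)"
      by (simp add: power_add)
    also have "\<dots> \<le> D * (\<bar>C\<bar> + 1)"
      using D C[of j] rapid_weights_pos[OF assms(2), of j] by (intro mult_mono) auto
    finally show ?thesis .
  qed
  then show ?thesis using that[of "D * (\<bar>C\<bar> + 1)"] D(1) by simp
qed

lemma subspace_rapid_seqs: "module.subspace fun_scale rapid_seqs"
proof -
  interpret vector_space "fun_scale :: complex \<Rightarrow> (nat \<Rightarrow> complex) \<Rightarrow> _" by (rule vector_space_fun_scale)
  show ?thesis
  proof (rule subspaceI)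
    show "0 \<in> rapid_seqs" by (auto simp: rapid_seqs_alt)
  next
    fix x y assume xy: "x \<in> rapid_seqs" "y \<in> rapid_seqs"
    show "x + y \<in> rapid_seqs"
      unfolding rapid_seqs_alt
    proof (intro CollectI allI)
      fix k
      obtain C D where C: "\<And>j. real (Suc j) ^ k * cmod (x j) \<le> C"
        and D: "\<And>j. real (Suc j) ^ k * cmod (y j) \<le> D"
        using rapid_seqs_bound xy by metis
      have "real (Suc j) ^ k * cmod ((x + y) j) \<le> C + D" for j
      proof -
        have "real (Suc j) ^ k * cmod ((x + y) j) \<le> real (Suc j) ^ k * (cmod (x j) + cmod (y j))"
          by (intro mult_left_mono) (auto simp: norm_triangle_ineq)
        also have "\<dots> \<le> C + D" unfolding distrib_left by (intro add_mono C D)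
        finally show ?thesis .
      qed
      then show "\<exists>C. \<forall>j. real (Suc j) ^ k * cmod ((x + y) j) \<le> C" by blast
    qed
  next
    fix c x assume x: "x \<in> rapid_seqs"
    show "fun_scale c x \<in> rapid_seqs"
      unfolding rapid_seqs_alt
    proof (intro CollectI allI)
      fix k
      obtain C where C: "\<And>j. real (Suc j) ^ k * cmod (x j) \<le> C" using rapid_seqs_bound[OF x] by metis
      have "real (Suc j) ^ k * cmod (fun_scale c x j) \<le> cmod c * C" for j
        using mult_left_mono[OF C[of j], of "cmod c"] by (simp add: norm_mult mult_ac)
      then show "\<exists>C. \<forall>j. real (Suc j) ^ k * cmod (fun_scale c x j) \<le> C" by blast
    qed
  qed
qed

lemma slow_seqsI:
  assumes "\<And>j. cmod (y j) \<le> C * real (Suc j) ^ k"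
  shows "y \<in> slow_seqs"
proof -
  \<comment> \<open>\<open>slow_seqs\<close> asks for a positive exponent, hence
    \<open>Suc k\<close>.\<close>
  have "cmod (y j) / real (Suc j) ^ Suc k \<le> \<bar>C\<bar>" for j
  proof -
    have "cmod (y j) \<le> \<bar>C\<bar> * real (Suc j) ^ Suc k"
    proof (rule order_trans[OF assms mult_mono])
      show "real (Suc j) ^ k \<le> real (Suc j) ^ Suc k" by (intro power_increasing) auto
    qed auto
    then show ?thesis by (simp add: divide_le_eq del: power_Suc of_nat_Suc)
  qed
  then show ?thesis unfolding slow_seqs_def bdd_above_def by (intro CollectI exI[of _ "Suc k"]) auto
qed

lemma slow_seqsE:
  assumes "y \<in> slow_seqs"
  obtains k C where "0 \<le> C" "\<And>j. cmod (y j) \<le> C * real (Suc j) ^ k"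
proof -
  obtain m C where C: "\<And>j. cmod (y j) / real (Suc j) ^ m \<le> C"
    using assms(1) unfolding slow_seqs_def bdd_above_def by auto
  have "0 \<le> C" using C[of 0] by (simp add: order_trans[OF norm_ge_zero])
  then show ?thesis using that[of C m] C by (simp add: divide_le_eq del: of_nat_Suc)
qed

lemma subspace_slow_seqs: "module.subspace fun_scale slow_seqs"
proof -
  interpret vector_space "fun_scale :: complex \<Rightarrow> (nat \<Rightarrow> complex) \<Rightarrow> _" by (rule vector_space_fun_scale)
  show ?thesis
  proof (rule subspaceI)
    show "0 \<in> slow_seqs" by (rule slow_seqsI[of _ 0 0]) simp
  next
    fix x y assume "x \<in> slow_seqs" "y \<in> slow_seqs"
    then obtain k C l D where C: "0 \<le> C" "\<And>j. cmod (x j) \<le> C * real (Suc j) ^ k"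
      and D: "0 \<le> D" "\<And>j. cmod (y j) \<le> D * real (Suc j) ^ l" using slow_seqsE by metis
    show "x + y \<in> slow_seqs"
    proof (rule slow_seqsI)
      fix j
      have "cmod (x j) \<le> C * real (Suc j) ^ (k + l)"
        by (rule order_trans[OF C(2) mult_left_mono[OF power_increasing]]) (use C(1) in auto)
      moreover have "cmod (y j) \<le> D * real (Suc j) ^ (k + l)"
        by (rule order_trans[OF D(2) mult_left_mono[OF power_increasing]]) (use D(1) in auto)
      ultimately show "cmod ((x + y) j) \<le> (C + D) * real (Suc j) ^ (k + l)"
        unfolding distrib_right by (auto intro: norm_triangle_le add_mono)
    qed
  next
    fix c x assume "x \<in> slow_seqs"
    then obtain k C where "\<And>j. cmod (x j) \<le> C * real (Suc j) ^ k" using slow_seqsE by metis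
    then show "fun_scale c x \<in> slow_seqs"
      by (intro slow_seqsI[of _ "cmod c * C" k]) (simp add: norm_mult mult.assoc mult_left_mono)
  qed
qed

lemma rapid_norm_upper:
  assumes "x \<in> rapid_seqs" shows "real (Suc j) ^ k * cmod (x j) \<le> rapid_norm k x"
proof -
  obtain C where "\<And>j. real (Suc j) ^ k * cmod (x j) \<le> C" using rapid_seqs_bound[OF assms] by metis
  then have "bdd_above (range (\<lambda>j. real (Suc j) ^ k * cmod (x j)))" unfolding bdd_above_def by blast
  then show ?thesis unfolding rapid_norm_def by (rule cSUP_upper[rotated]) simp
qed

lemma rapid_norm_least:
  "(\<And>j. real (Suc j) ^ k * cmod (x j) \<le> C) \<Longrightarrow> rapid_norm k x \<le> C"
  unfolding rapid_norm_def by (rule cSUP_least) auto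

lemma seminorm_on_rapid_norm: "seminorm_on fun_scale rapid_seqs (rapid_norm k)"
proof (rule seminorm_onI[OF vector_space_fun_scale subspace_rapid_seqs])
  fix x y assume xy: "x \<in> rapid_seqs" "y \<in> rapid_seqs"
  show "rapid_norm k (x + y) \<le> rapid_norm k x + rapid_norm k y"
  proof (rule rapid_norm_least)
    fix j
    have "real (Suc j) ^ k * cmod ((x + y) j) \<le> real (Suc j) ^ k * (cmod (x j) + cmod (y j))"
      by (intro mult_left_mono) (auto simp: norm_triangle_ineq)
    also have "\<dots> \<le> rapid_norm k x + rapid_norm k y"
      unfolding distrib_left by (intro add_mono rapid_norm_upper xy)
    finally show "real (Suc j) ^ k * cmod ((x + y) j) \<le> rapid_norm k x + rapid_norm k y" .
  qed
next
  fix c x assume x: "x \<in> rapid_seqs"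
  show "rapid_norm k (fun_scale c x) \<le> cmod c * rapid_norm k x"
    using mult_left_mono[OF rapid_norm_upper[OF x], of "cmod c"]
    by (intro rapid_norm_least) (simp add: norm_mult mult_ac)
qed

lemma topspace_s_top [simp]: "topspace s_top = rapid_seqs"
  unfolding s_top_def by (rule topspace_seminorm_topology) auto

lemma continuous_rapid_norm: "1 \<le> k \<Longrightarrow> continuous_seminorm fun_scale s_top (rapid_norm k)"
  unfolding s_top_def
  by (rule continuous_seminorm_seminorm_topology[OF vector_space_fun_scale subspace_rapid_seqs])
    (auto simp: seminorm_on_rapid_norm)

text \<open>The weights increase with the exponent, so a single pointwise condition replaces
  finitely many norms.\<close>

lemma s_top_zero_base:
  assumes "openin s_top Q" "0 \<in> Q"
  obtains n d where "0 < d" "{x \<in> rapid_seqs. \<forall>i. real (Suc i) ^ n * cmod (x i) \<le> d} \<subseteq> Q"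
proof -
  define U where "U = (\<lambda>n d. {x :: nat \<Rightarrow> complex. \<forall>i. real (Suc i) ^ n * cmod (x i) \<le> d})"
  have "\<exists>A\<in>{U n d |n d. 0 < d}. rapid_seqs \<inter> A \<subseteq> Q"
  proof (rule seminorm_topology_zero_base[OF _ _ _ assms(1)[unfolded s_top_def] assms(2)])
    fix p x y assume "p \<in> {rapid_norm k |k. k \<ge> 1}" "x \<in> rapid_seqs" "y \<in> rapid_seqs"
    then show "p (y - x) \<le> p y + p (0 - x)"
      using seminorm_on_diff[OF vector_space_fun_scale subspace_rapid_seqs seminorm_on_rapid_norm] by blast
  next
    fix p and e :: real assume pe: "p \<in> {rapid_norm k |k. k \<ge> 1}" "0 < e"
    then obtain k where k: "p = rapid_norm k" by blast
    \<comment> \<open>Half of \<open>e\<close>, since a pointwise bound passes to the supremum only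
      as a non-strict one.\<close>
    have "p y < e" if "y \<in> U k (e / 2)" for y
    proof -
      have "p y \<le> e / 2" using that unfolding k U_def by (intro rapid_norm_least) auto
      then show ?thesis using pe(2) by simp
    qed
    then show "\<exists>A\<in>{U n d |n d. 0 < d}. \<forall>y\<in>rapid_seqs \<inter> A. p y < e"
      using pe(2) half_gt_zero by blast
  next
    fix A A' assume "A \<in> {U n d |n d. 0 < d}" "A' \<in> {U n d |n d. 0 < d}"
    then obtain n d n' d' where A: "A = U n d" "0 < d" "A' = U n' d'" "0 < d'" by blast
    have mono: "x \<in> U k e" if x: "x \<in> U l c" "k \<le> l" "c \<le> e" for x k l and c e :: real
      unfolding U_def
    proof (intro CollectI allI)
      fix i
      have "real (Suc i) ^ k * cmod (x i) \<le> real (Suc i) ^ l * cmod (x i)"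
        using x(2) by (intro mult_right_mono power_increasing) auto
      also have "\<dots> \<le> c" using x(1) unfolding U_def by blast
      finally show "real (Suc i) ^ k * cmod (x i) \<le> e" using x(3) by simp
    qed
    have "U (max n n') (min d d') \<subseteq> A \<inter> A'"
      unfolding A by (intro subsetI IntI; erule mono) auto
    then show "\<exists>A''\<in>{U n d |n d. 0 < d}. A'' \<subseteq> A \<inter> A'"
      using A(2,4) by (intro bexI[of _ "U (max n n') (min d d')"]) (auto intro!: exI[of _ "max n n'"] exI[of _ "min d d'"])
  qed
  then show ?thesis using that unfolding U_def by blast
qed

text \<open>Homogeneity turns a ball inside \<open>{p < 1}\<close> into domination by one norm.
  Using an arbitrary pointwise bound \<open>d\<close> instead of a supremum makes the estimate
  directly applicable to truncations.\<close>

lemma continuous_seminorm_s_top: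
  assumes p: "continuous_seminorm fun_scale s_top p"
  obtains n c where "0 < c"
    "\<And>x d. \<lbrakk>x \<in> rapid_seqs; 0 < d; \<And>i. real (Suc i) ^ n * cmod (x i) \<le> d\<rbrakk> \<Longrightarrow> p x \<le> c * d"
proof -
  have pn: "seminorm_on fun_scale rapid_seqs p" using p unfolding continuous_seminorm_def by simp
  have p0: "p 0 = 0" by (rule seminorm_on_zero[OF vector_space_fun_scale subspace_rapid_seqs pn])
  have 0: "0 \<in> rapid_seqs"
    by (rule module.subspace_0[OF module_fun_scale subspace_rapid_seqs])
  have "openin s_top {x \<in> rapid_seqs. p x < 1}" "0 \<in> {x \<in> rapid_seqs. p x < 1}"
    using openin_seminorm_ball[OF p, of 1] p0 0 by simp_all
  then obtain n d where d: "0 < d"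
    "{x \<in> rapid_seqs. \<forall>i. real (Suc i) ^ n * cmod (x i) \<le> d} \<subseteq> {x \<in> rapid_seqs. p x < 1}"
    by (rule s_top_zero_base)
  have "p x \<le> (1 / d) * t" if x: "x \<in> rapid_seqs" "0 < t" "\<And>i. real (Suc i) ^ n * cmod (x i) \<le> t" for x t
  proof -
    define u where "u = fun_scale (complex_of_real (d / t)) x"
    have "u \<in> rapid_seqs"
      unfolding u_def by (rule module.subspace_scale[OF module_fun_scale subspace_rapid_seqs x(1)])
    moreover have "real (Suc i) ^ n * cmod (u i) \<le> d" for i
    proof -
      have "real (Suc i) ^ n * cmod (u i) = d / t * (real (Suc i) ^ n * cmod (x i))"
        using d(1) x(2) by (simp add: u_def norm_mult norm_divide)
      also have "\<dots> \<le> d / t * t" using d(1) x(2,3) by (intro mult_left_mono) auto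
      finally show ?thesis using x(2) by simp
    qed
    ultimately have "p u < 1" using d(2) by blast
    moreover have "p u = d / t * p x"
      using pn x(1) d(1) x(2) unfolding seminorm_on_def u_def by (auto simp: norm_divide)
    ultimately show ?thesis using d(1) x(2) by (simp add: field_simps)
  qed
  then show ?thesis using that[of "1 / d" n] d(1) by simp
qed

lemma sum_le_of_square_decay:
  fixes a :: "nat \<Rightarrow> real"
  assumes "\<And>j. 0 \<le> a j" "\<And>j. real (Suc j) ^ 2 * a j \<le> d"
  shows "summable a" "suminf a \<le> 2 * d"
proof -
  have le: "(\<Sum>j<m. a j) \<le> 2 * d" for m
  proof -
    have d: "0 \<le> d" using assms(1)[of 0] assms(2)[of 0] by simp
    have "(\<Sum>j<m. a j) \<le> (\<Sum>j<m. d * (1 / real (Suc j) ^ 2))"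
      using assms(2) by (intro sum_mono) (simp add: field_simps)
    also have "\<dots> = d * (\<Sum>j<m. 1 / real (Suc j) ^ 2)" by (simp add: sum_distrib_left)
    also have "\<dots> \<le> d * 2" by (intro mult_left_mono sum_inverse_squares_le d)
    finally show ?thesis by simp
  qed
  then show s: "summable a" using summableI_nonneg_bounded assms(1) by blast
  show "suminf a \<le> 2 * d" using suminf_le_const[OF s] le by blast
qed

text \<open>Boundedness gives constants with \<open>\<bar>x_j\<bar> \<le> r_k / j^k\<close> for all
  \<open>k\<close>, and \<open>rapid_weights_minorant\<close> selects from these bounds a rapid
  weight. With the converse \<open>bounded_s_top_box\<close>, the boxes form a fundamental system of
  bounded sets, which reduces polars to weights.\<close>

lemma bounded_s_top_dominated:
  assumes "bounded_in fun_scale s_top B"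
  obtains \<beta> where "\<beta> \<in> rapid_weights" "\<And>x j. x \<in> B \<Longrightarrow> cmod (x j) \<le> \<beta> j"
proof -
  have "\<exists>r>0. \<forall>x\<in>B. \<forall>j. real (Suc j) ^ k * cmod (x j) \<le> r" for k
  proof -
    \<comment> \<open>The generating norms of \<open>s_top\<close> start at exponent 1, hence
      \<open>Suc k\<close>.\<close>
    let ?U = "{x \<in> rapid_seqs. rapid_norm (Suc k) x < 1}"
    have z: "rapid_norm (Suc k) 0 = 0" "0 \<in> rapid_seqs"
      using seminorm_on_zero[OF vector_space_fun_scale subspace_rapid_seqs seminorm_on_rapid_norm]
      by (auto simp: rapid_seqs_alt)
    have "openin s_top ?U"
      using openin_seminorm_ball[OF continuous_rapid_norm[of "Suc k"]] z by simp
    then have "zero_nhd s_top ?U" unfolding zero_nhd_def using z by auto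
    then obtain r where r: "0 < r" "\<And>c. r \<le> cmod c \<Longrightarrow> B \<subseteq> fun_scale c ` ?U"
      using assms unfolding bounded_in_def absorbs_def by blast
    have "real (Suc j) ^ k * cmod (x j) \<le> r" if x: "x \<in> B" for x j
    proof -
      obtain u where u: "x = fun_scale (complex_of_real r) u" "u \<in> ?U"
        using r(2)[of "complex_of_real r"] r(1) x by auto
      have "real (Suc j) ^ k * cmod (u j) \<le> real (Suc j) ^ Suc k * cmod (u j)"
        by (intro mult_right_mono power_increasing) auto
      then have "real (Suc j) ^ k * cmod (u j) \<le> 1"
        using rapid_norm_upper[of u j "Suc k"] u(2) unfolding mem_Collect_eq by linarith
      then have "r * (real (Suc j) ^ k * cmod (u j)) \<le> r * 1" using r(1) by (intro mult_left_mono) auto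
      then show ?thesis using r(1) by (simp add: u(1) norm_mult mult_ac)
    qed
    then show ?thesis using r(1) by blast
  qed
  then obtain r where r: "\<And>k. 0 < r k" "\<And>k x j. x \<in> B \<Longrightarrow> real (Suc j) ^ k * cmod (x j) \<le> r k"
    by metis
  obtain \<beta> where \<beta>: "\<beta> \<in> rapid_weights" "\<And>j. \<exists>N. \<beta> j = r N / real (Suc j) ^ N"
    using rapid_weights_minorant r(1) by metis
  have "cmod (x j) \<le> \<beta> j" if "x \<in> B" for x j
  proof -
    obtain N where "\<beta> j = r N / real (Suc j) ^ N" using \<beta>(2) by blast
    then show ?thesis using r(2)[OF that, of j N] by (simp add: le_divide_eq mult.commute del: of_nat_Suc)
  qed
  then show ?thesis using that \<beta>(1) by blast
qed

lemma bounded_s_top_box: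
  assumes b: "b \<in> rapid_weights"
  shows "bounded_in fun_scale s_top {x. \<forall>j. cmod (x j) \<le> b j}"
proof -
  let ?B = "{x. \<forall>j. cmod (x j) \<le> b j}"
  have le: "real (Suc j) ^ k * cmod (x j) \<le> real (Suc j) ^ k * b j" if "x \<in> ?B" for x j k
    using that by (intro mult_left_mono) auto
  have sub: "x \<in> rapid_seqs" if "x \<in> ?B" for x
    unfolding rapid_seqs_alt
  proof (intro CollectI allI)
    fix k
    obtain C where "\<And>j. real (Suc j) ^ k * b j \<le> C" using rapid_weights_bound[OF b] by metis
    then show "\<exists>C. \<forall>j. real (Suc j) ^ k * cmod (x j) \<le> C" using le[OF that] order_trans by blast
  qed
  moreover have "absorbs fun_scale U ?B" if U: "zero_nhd s_top U" for U
  proof -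
    obtain Q where Q: "openin s_top Q" "0 \<in> Q" "Q \<subseteq> U" using U unfolding zero_nhd_def by metis
    obtain n d where d: "0 < d" "{x \<in> rapid_seqs. \<forall>i. real (Suc i) ^ n * cmod (x i) \<le> d} \<subseteq> Q"
      using Q(1,2) by (rule s_top_zero_base)
    obtain C where C: "0 < C" "\<And>j. real (Suc j) ^ n * b j \<le> C" using rapid_weights_bound[OF b] by metis
    have "x \<in> fun_scale c ` U" if c: "C / d \<le> cmod c" and x: "x \<in> ?B" for c x
    proof -
      have c0: "0 < cmod c" using C(1) d(1) c by (meson divide_pos_pos less_le_trans)
      have "fun_scale (inverse c) x \<in> U"
      proof -
        have "real (Suc i) ^ n * cmod (fun_scale (inverse c) x i) \<le> d" for i
        proof -
          have "real (Suc i) ^ n * cmod (x i) \<le> C" using le[OF x] C(2) order_trans by blast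
          also have "C \<le> d * cmod c" using c d(1) by (simp add: field_simps)
          finally show ?thesis using c0 by (simp add: norm_mult norm_inverse norm_divide field_simps)
        qed
        moreover have "fun_scale (inverse c) x \<in> rapid_seqs"
          by (rule module.subspace_scale[OF module_fun_scale subspace_rapid_seqs sub[OF x]])
        ultimately show ?thesis using d(2) Q(3) by blast
      qed
      moreover have "x = fun_scale c (fun_scale (inverse c) x)" using c0 by (auto simp: fun_eq_iff)
      ultimately show ?thesis by blast
    qed
    moreover have "0 < C / d" using C(1) d(1) by simp
    ultimately show ?thesis unfolding absorbs_def by blast
  qed
  ultimately show ?thesis unfolding bounded_in_def by auto
qed

lemma pairing_bound:
  assumes "\<And>j. cmod (x j) \<le> \<beta> j" "\<And>j. real (Suc j) ^ 2 * (\<beta> j * cmod (y j)) \<le> d"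
  shows "summable (\<lambda>j. x j * y j)" "cmod (\<Sum>j. x j * y j) \<le> 2 * d"
proof -
  have le: "real (Suc j) ^ 2 * norm (x j * y j) \<le> d" for j
    unfolding norm_mult
    by (rule order_trans[OF mult_left_mono[OF mult_right_mono[OF assms(1)]] assms(2)]) auto
  show "summable (\<lambda>j. x j * y j)"
    by (rule summable_norm_cancel, rule sum_le_of_square_decay(1)) (use le in auto)
  have "cmod (\<Sum>j. x j * y j) \<le> (\<Sum>j. norm (x j * y j))"
    by (rule summable_norm, rule sum_le_of_square_decay(1)) (use le in auto)
  also have "\<dots> \<le> 2 * d" by (rule sum_le_of_square_decay(2)) (use le in auto)
  finally show "cmod (\<Sum>j. x j * y j) \<le> 2 * d" .
qed

text \<open>Domination of \<open>B\<close> by a rapid weight makes the pairings converge and keeps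
  them uniformly bounded, so that the sum and the supremum in \<open>polar_seminorm\<close> have
  their intended meaning.\<close>

lemma polar_seminorm_upper:
  assumes B: "bounded_in fun_scale s_top B" and y: "y \<in> slow_seqs" and x: "x \<in> B"
  shows "summable (\<lambda>j. x j * y j)" "cmod (\<Sum>j. x j * y j) \<le> polar_seminorm B y"
proof -
  obtain \<beta> where \<beta>: "\<beta> \<in> rapid_weights" "\<And>x j. x \<in> B \<Longrightarrow> cmod (x j) \<le> \<beta> j"
    using bounded_s_top_dominated[OF B] by metis
  obtain d where d: "\<And>j. real (Suc j) ^ 2 * (\<beta> j * cmod (y j)) \<le> d"
    using slow_seqs_bound[OF y \<beta>(1)] by metis
  have pb: "summable (\<lambda>j. x j * y j)" "cmod (\<Sum>j. x j * y j) \<le> 2 * d" if "x \<in> B" for x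
    using pairing_bound[of x \<beta> y d] \<beta>(2)[OF that] d by blast+
  show "summable (\<lambda>j. x j * y j)" using pb(1) x by blast
  have "bdd_above ((\<lambda>x. cmod (\<Sum>j. x j * y j)) ` B)" unfolding bdd_above_def using pb(2) by blast
  then show "cmod (\<Sum>j. x j * y j) \<le> polar_seminorm B y"
    unfolding polar_seminorm_def using x by (rule cSUP_upper[rotated])
qed

lemma seminorm_on_polar:
  assumes B: "bounded_in fun_scale s_top B" "B \<noteq> {}"
  shows "seminorm_on fun_scale slow_seqs (polar_seminorm B)"
proof (rule seminorm_onI[OF vector_space_fun_scale subspace_slow_seqs])
  fix y z assume yz: "y \<in> slow_seqs" "z \<in> slow_seqs"
  show "polar_seminorm B (y + z) \<le> polar_seminorm B y + polar_seminorm B z"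
    unfolding polar_seminorm_def[of B "y + z"]
  proof (rule cSUP_least[OF B(2)])
    fix x assume x: "x \<in> B"
    have "(\<Sum>j. x j * (y + z) j) = (\<Sum>j. x j * y j) + (\<Sum>j. x j * z j)"
      using suminf_add[OF polar_seminorm_upper(1)[OF B(1) yz(1) x] polar_seminorm_upper(1)[OF B(1) yz(2) x]]
      by (simp add: distrib_left)
    then show "cmod (\<Sum>j. x j * (y + z) j) \<le> polar_seminorm B y + polar_seminorm B z"
      using polar_seminorm_upper(2)[OF B(1) yz(1) x] polar_seminorm_upper(2)[OF B(1) yz(2) x]
        norm_triangle_ineq[of "\<Sum>j. x j * y j" "\<Sum>j. x j * z j"] by simp
  qed
next
  fix c y assume y: "y \<in> slow_seqs"
  show "polar_seminorm B (fun_scale c y) \<le> cmod c * polar_seminorm B y"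
    unfolding polar_seminorm_def[of B "fun_scale c y"]
  proof (rule cSUP_least[OF B(2)])
    fix x assume x: "x \<in> B"
    have "(\<Sum>j. x j * fun_scale c y j) = c * (\<Sum>j. x j * y j)"
      using suminf_mult[OF polar_seminorm_upper(1)[OF B(1) y x], of c] by (simp add: mult_ac)
    then show "cmod (\<Sum>j. x j * fun_scale c y j) \<le> cmod c * polar_seminorm B y"
      using polar_seminorm_upper(2)[OF B(1) y x] by (simp add: norm_mult mult_left_mono)
  qed
qed

lemma topspace_s_dual_top [simp]: "topspace s_dual_top = slow_seqs"
proof -
  define B where "B = {x. \<forall>j. cmod (x j) \<le> (1/2) ^ j}"
  have "(\<lambda>j. 0) \<in> B" by (simp add: B_def)
  moreover have "bounded_in fun_scale s_top B"
    unfolding B_def by (rule bounded_s_top_box[OF rapid_weights_nonempty])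
  ultimately have "\<exists>B. bounded_in fun_scale s_top B \<and> B \<noteq> {}" by blast
  then show ?thesis unfolding s_dual_top_def by (intro topspace_seminorm_topology) blast
qed

lemma continuous_polar_seminorm:
  "\<lbrakk>bounded_in fun_scale s_top B; B \<noteq> {}\<rbrakk> \<Longrightarrow> continuous_seminorm fun_scale s_dual_top (polar_seminorm B)"
  unfolding s_dual_top_def
  by (rule continuous_seminorm_seminorm_topology[OF vector_space_fun_scale subspace_slow_seqs])
    (use seminorm_on_polar in blast)+

text \<open>The box contains the multiple by \<open>b j\<close> of the unit sequence at
  \<open>j\<close>; testing against it isolates one coordinate.\<close>

lemma weighted_le_polar_seminorm:
  assumes b: "b \<in> rapid_weights" and y: "y \<in> slow_seqs"
  shows "b j * cmod (y j) \<le> polar_seminorm {x. \<forall>j. cmod (x j) \<le> b j} y"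
proof -
  define x where "x = (\<lambda>k. if k = j then complex_of_real (b j) else 0)"
  have "x \<in> {x. \<forall>j. cmod (x j) \<le> b j}"
    using rapid_weights_pos[OF b] by (auto simp: x_def less_imp_le)
  then have "cmod (\<Sum>k. x k * y k) \<le> polar_seminorm {x. \<forall>j. cmod (x j) \<le> b j} y"
    by (rule polar_seminorm_upper(2)[OF bounded_s_top_box[OF b] y])
  moreover have "(\<Sum>k. x k * y k) = (\<Sum>k\<in>{j}. x k * y k)"
    by (rule suminf_finite) (auto simp: x_def)
  ultimately show ?thesis using rapid_weights_pos[OF b, of j] by (simp add: x_def norm_mult)
qed

text \<open>The strong dual topology is generated by weighted sup norms: a polar seminorm is a
  supremum of weighted sums, and a sum is controlled by a supremum with two more powers of
  \<open>j\<close>.\<close>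

lemma continuous_seminorm_s_dual_top:
  assumes q: "continuous_seminorm fun_scale s_dual_top q"
  obtains b where "b \<in> rapid_weights"
    "\<And>y d. \<lbrakk>y \<in> slow_seqs; 0 < d; \<And>j. b j * cmod (y j) \<le> d\<rbrakk> \<Longrightarrow> q y \<le> d"
proof -
  have qn: "seminorm_on fun_scale slow_seqs q" using q unfolding continuous_seminorm_def by simp
  have q0: "q 0 = 0" by (rule seminorm_on_zero[OF vector_space_fun_scale subspace_slow_seqs qn])
  have 0: "0 \<in> slow_seqs" by (rule slow_seqsI[of _ 0 0]) simp
  define U where "U = (\<lambda>b. {y :: nat \<Rightarrow> complex. \<forall>j. b j * cmod (y j) \<le> 1})"
  have "openin s_dual_top {y \<in> slow_seqs. q y < 1}" using openin_seminorm_ball[OF q] q0 0 by simp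
  then have "\<exists>A\<in>U ` rapid_weights. slow_seqs \<inter> A \<subseteq> {y \<in> slow_seqs. q y < 1}"
    unfolding s_dual_top_def
  proof (rule seminorm_topology_zero_base[rotated 3])
    show "0 \<in> {y \<in> slow_seqs. q y < 1}" using 0 q0 by simp
  next
    fix p y z assume "p \<in> {polar_seminorm B |B. bounded_in fun_scale s_top B \<and> B \<noteq> {}}"
      "y \<in> slow_seqs" "z \<in> slow_seqs"
    then show "p (z - y) \<le> p z + p (0 - y)"
      using seminorm_on_diff[OF vector_space_fun_scale subspace_slow_seqs seminorm_on_polar] by blast
  next
    fix p and e :: real
    assume p: "p \<in> {polar_seminorm B |B. bounded_in fun_scale s_top B \<and> B \<noteq> {}}" and e: "0 < e"
    then obtain B where B: "p = polar_seminorm B" "bounded_in fun_scale s_top B" "B \<noteq> {}" by blast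
    obtain \<beta> where \<beta>: "\<beta> \<in> rapid_weights" "\<And>x j. x \<in> B \<Longrightarrow> cmod (x j) \<le> \<beta> j"
      using bounded_s_top_dominated[OF B(2)] by metis
    \<comment> \<open>The square pays for the summation over \<open>j\<close>; the factor
      \<open>4 / e\<close> leads to the final bound \<open>2 * (e / 4)\<close>, strictly below
      \<open>e\<close>.\<close>
    define b where "b = (\<lambda>j. 4 / e * (real (Suc j) ^ 2 * \<beta> j))"
    have "b \<in> rapid_weights"
      unfolding b_def using e by (intro rapid_weights_scale rapid_weights_pow \<beta>(1)) simp
    moreover have "p y < e" if y: "y \<in> U b" for y
    proof -
      have "real (Suc j) ^ 2 * (\<beta> j * cmod (y j)) \<le> e / 4" for j
        using y e unfolding U_def b_def by (simp add: field_simps)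
      then have "p y \<le> 2 * (e / 4)"
        unfolding B(1) polar_seminorm_def using pairing_bound(2)[of _ \<beta> y "e / 4"] \<beta>(2)
        by (intro cSUP_least B(3)) blast
      then show ?thesis using e by simp
    qed
    ultimately show "\<exists>A\<in>U ` rapid_weights. \<forall>y\<in>slow_seqs \<inter> A. p y < e" by blast
  next
    fix A A' assume "A \<in> U ` rapid_weights" "A' \<in> U ` rapid_weights"
    then obtain b b' where b: "b \<in> rapid_weights" "b' \<in> rapid_weights" "A = U b" "A' = U b'" by blast
    have "U (\<lambda>j. b j + b' j) \<subseteq> A \<inter> A'"
      unfolding b(3,4) U_def
    proof (intro subsetI IntI CollectI allI)
      fix y j assume "y \<in> {y. \<forall>j. (b j + b' j) * cmod (y j) \<le> 1}"
      then have "b j * cmod (y j) + b' j * cmod (y j) \<le> 1" by (simp add: distrib_right)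
      moreover have "0 \<le> b j * cmod (y j)" "0 \<le> b' j * cmod (y j)"
        using rapid_weights_pos b by (simp_all add: less_imp_le)
      ultimately show "b j * cmod (y j) \<le> 1" "b' j * cmod (y j) \<le> 1" by linarith+
    qed
    then show "\<exists>A''\<in>U ` rapid_weights. A'' \<subseteq> A \<inter> A'" using rapid_weights_add[OF b(1,2)] by blast
  qed
  then obtain b where b: "b \<in> rapid_weights" "slow_seqs \<inter> U b \<subseteq> {y \<in> slow_seqs. q y < 1}" by blast
  have "q y \<le> d" if y: "y \<in> slow_seqs" "0 < d" "\<And>j. b j * cmod (y j) \<le> d" for y d
  proof -
    define u where "u = fun_scale (complex_of_real (1 / d)) y"
    have "u \<in> slow_seqs"
      unfolding u_def by (rule module.subspace_scale[OF module_fun_scale subspace_slow_seqs y(1)])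
    moreover have "u \<in> U b" using y(2,3) by (simp add: U_def u_def norm_divide field_simps)
    ultimately have "q u < 1" using b(2) by blast
    moreover have "q u = 1 / d * q y"
      using qn y(1,2) unfolding seminorm_on_def u_def by (auto simp: norm_divide)
    ultimately show ?thesis using y(2) by (simp add: field_simps)
  qed
  then show ?thesis using that b(1) by blast
qed

section \<open>The projective tensor product\<close>

lemma sum_fun_apply: "(\<Sum>i\<in>I. f i) x = (\<Sum>i\<in>I. f i x)"
  by (induction I rule: infinite_finite_induct) auto

text \<open>Scalars from the span are absorbed into the left factor. This is also what makes the set
  under the infimum in \<open>tensor_seminorm\<close> nonempty.\<close>

lemma alg_tensor_representation:
  assumes V: "module.subspace sc V" "module sc" and t: "t \<in> alg_tensor sc V sc' W"
  shows "\<exists>(n::nat) x y. (\<forall>i<n. x i \<in> V \<and> y i \<in> W) \<and> t = (\<Sum>i<n. elem_tensor sc V sc' W (x i) (y i))"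
  using t unfolding alg_tensor_def
proof (induction rule: module.span_induct_alt[OF module_fun_scale, consumes 1, case_names base step])
  case base
  show ?case by (intro exI[of _ 0]) auto
next
  case (step c e t)
  obtain u v where e: "e = elem_tensor sc V sc' W u v" "u \<in> V" "v \<in> W" using step by blast
  obtain n :: nat and x y where xy: "\<forall>i<n. x i \<in> V \<and> y i \<in> W"
    "t = (\<Sum>i<n. elem_tensor sc V sc' W (x i) (y i))" using step by metis
  have "fun_scale c e = elem_tensor sc V sc' W (sc c u) v"
    using e(2,3) by (auto simp: fun_eq_iff e(1) elem_tensor_def bilinear_form_on_def linear_on_def)
  moreover have "sc c u \<in> V" using module.subspace_scale[OF V(2,1) e(2)] .
  ultimately show ?case using xy e(3)
    by (intro exI[of _ "Suc n"] exI[of _ "x(n := sc c u)"] exI[of _ "y(n := v)"]) (auto simp: less_Suc_eq)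
qed

lemma elem_tensor_in_alg_tensor:
  "\<lbrakk>x \<in> V; y \<in> W\<rbrakk> \<Longrightarrow> elem_tensor sc V sc' W x y \<in> alg_tensor sc V sc' W"
  unfolding alg_tensor_def by (rule module.span_base[OF module_fun_scale]) blast

lemma subspace_alg_tensor: "module.subspace fun_scale (alg_tensor sc V sc' W)"
  unfolding alg_tensor_def by (rule module.subspace_span[OF module_fun_scale])

section \<open>The projective seminorm of two nonnegative functions\<close>

context
  fixes sc :: "complex \<Rightarrow> 'a::ab_group_add \<Rightarrow> 'a" and V :: "'a set"
    and sc' :: "complex \<Rightarrow> 'b::ab_group_add \<Rightarrow> 'b" and W :: "'b set"
    and p :: "'a \<Rightarrow> real" and q :: "'b \<Rightarrow> real"
  assumes V: "module sc" "module.subspace sc V"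
    and p: "\<And>x. x \<in> V \<Longrightarrow> 0 \<le> p x" and q: "\<And>y. y \<in> W \<Longrightarrow> 0 \<le> q y"
begin

lemma tensor_seminorm_le:
  assumes "\<And>i. i < (n::nat) \<Longrightarrow> x i \<in> V" "\<And>i. i < n \<Longrightarrow> y i \<in> W"
    and "t = (\<Sum>i<n. elem_tensor sc V sc' W (x i) (y i))"
  shows "tensor_seminorm sc V sc' W p q t \<le> (\<Sum>i<n. p (x i) * q (y i))"
  unfolding tensor_seminorm_def
proof (rule cInf_lower)
  show "bdd_below {\<Sum>i<n. p (x i) * q (y i) |(n::nat) x y.
            (\<forall>i<n. x i \<in> V \<and> y i \<in> W) \<and> t = (\<Sum>i<n. elem_tensor sc V sc' W (x i) (y i))}"
    by (rule bdd_belowI[of _ 0]) (auto intro!: sum_nonneg mult_nonneg_nonneg p q)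
qed (use assms in blast)

lemma tensor_seminorm_ge:
  assumes t: "t \<in> alg_tensor sc V sc' W"
    and "\<And>(n::nat) x y. \<lbrakk>\<And>i. i < n \<Longrightarrow> x i \<in> V; \<And>i. i < n \<Longrightarrow> y i \<in> W;
      t = (\<Sum>i<n. elem_tensor sc V sc' W (x i) (y i))\<rbrakk> \<Longrightarrow> c \<le> (\<Sum>i<n. p (x i) * q (y i))"
  shows "c \<le> tensor_seminorm sc V sc' W p q t"
  unfolding tensor_seminorm_def
  by (rule cInf_greatest) (use alg_tensor_representation[OF V(2,1) t] assms(2) in blast)+

lemma tensor_seminorm_elem:
  "\<lbrakk>x \<in> V; y \<in> W\<rbrakk> \<Longrightarrow> tensor_seminorm sc V sc' W p q (elem_tensor sc V sc' W x y) \<le> p x * q y"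
  using tensor_seminorm_le[of 1 "\<lambda>_. x" "\<lambda>_. y"] by simp

lemma tensor_seminorm_zero: "tensor_seminorm sc V sc' W p q 0 \<le> 0"
  using tensor_seminorm_le[of 0] by simp

text \<open>Representations of \<open>s\<close> and \<open>t\<close> concatenate to one of
  \<open>s + t\<close>; the two infima are then taken one after the other.\<close>

lemma tensor_seminorm_add:
  assumes "s \<in> alg_tensor sc V sc' W" "t \<in> alg_tensor sc V sc' W"
  shows "tensor_seminorm sc V sc' W p q (s + t)
    \<le> tensor_seminorm sc V sc' W p q s + tensor_seminorm sc V sc' W p q t"
proof -
  let ?\<pi> = "tensor_seminorm sc V sc' W p q"
  have split: "(\<Sum>i<n + m. f i) = (\<Sum>i<n. f i) + (\<Sum>i<m. f (n + i))"
    for f :: "nat \<Rightarrow> 'z::ab_group_add" and n m :: nat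
    by (induction m) (auto simp: add.assoc)
  have "?\<pi> (s + t) - ?\<pi> t \<le> ?\<pi> s"
  proof (rule tensor_seminorm_ge[OF assms(1)])
    fix n :: nat and x y assume x: "\<And>i. i < n \<Longrightarrow> x i \<in> V" "\<And>i. i < n \<Longrightarrow> y i \<in> W"
      "s = (\<Sum>i<n. elem_tensor sc V sc' W (x i) (y i))"
    have "?\<pi> (s + t) - (\<Sum>i<n. p (x i) * q (y i)) \<le> ?\<pi> t"
    proof (rule tensor_seminorm_ge[OF assms(2)])
      fix m :: nat and u v assume u: "\<And>i. i < m \<Longrightarrow> u i \<in> V" "\<And>i. i < m \<Longrightarrow> v i \<in> W"
        "t = (\<Sum>i<m. elem_tensor sc V sc' W (u i) (v i))"
      define x' where "x' = (\<lambda>i. if i < n then x i else u (i - n))"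
      define y' where "y' = (\<lambda>i. if i < n then y i else v (i - n))"
      have "?\<pi> (s + t) \<le> (\<Sum>i<n + m. p (x' i) * q (y' i))"
        by (rule tensor_seminorm_le) (use x u in \<open>auto simp: x'_def y'_def split\<close>)
      also have "\<dots> = (\<Sum>i<n. p (x i) * q (y i)) + (\<Sum>i<m. p (u i) * q (v i))"
        by (simp add: x'_def y'_def split)
      finally show "?\<pi> (s + t) - (\<Sum>i<n. p (x i) * q (y i)) \<le> (\<Sum>i<m. p (u i) * q (v i))" by simp
    qed
    then show "?\<pi> (s + t) - ?\<pi> t \<le> (\<Sum>i<n. p (x i) * q (y i))" by simp
  qed
  then show ?thesis by linarith
qed

lemma tensor_seminorm_sum:
  assumes "finite I" "\<And>i. i \<in> I \<Longrightarrow> t i \<in> alg_tensor sc V sc' W"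
  shows "tensor_seminorm sc V sc' W p q (\<Sum>i\<in>I. t i) \<le> (\<Sum>i\<in>I. tensor_seminorm sc V sc' W p q (t i))"
  using assms
proof (induction rule: finite_induct)
  case (insert i I)
  then have "(\<Sum>i\<in>I. t i) \<in> alg_tensor sc V sc' W"
    by (intro module.subspace_sum[OF module_fun_scale subspace_alg_tensor]) auto
  then have "tensor_seminorm sc V sc' W p q (t i + (\<Sum>i\<in>I. t i))
      \<le> tensor_seminorm sc V sc' W p q (t i) + tensor_seminorm sc V sc' W p q (\<Sum>i\<in>I. t i)"
    using insert.prems by (intro tensor_seminorm_add) auto
  also have "\<dots> \<le> tensor_seminorm sc V sc' W p q (t i) + (\<Sum>i\<in>I. tensor_seminorm sc V sc' W p q (t i))"
    using insert by (intro add_left_mono insert.IH) auto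
  finally show ?case unfolding sum.insert[OF insert(1,2)] .
qed (simp add: tensor_seminorm_zero)

end

section \<open>Tensors of sequences, their matrices and their truncations\<close>

abbreviation sseq_tensor :: "(((nat \<Rightarrow> complex) \<Rightarrow> (nat \<Rightarrow> complex) \<Rightarrow> complex) \<Rightarrow> complex) set" where
  "sseq_tensor \<equiv> alg_tensor fun_scale rapid_seqs fun_scale slow_seqs"

abbreviation etensor ::
  "(nat \<Rightarrow> complex) \<Rightarrow> (nat \<Rightarrow> complex) \<Rightarrow> ((nat \<Rightarrow> complex) \<Rightarrow> (nat \<Rightarrow> complex) \<Rightarrow> complex) \<Rightarrow> complex" where
  "etensor \<equiv> elem_tensor fun_scale rapid_seqs fun_scale slow_seqs"

text \<open>A tensor is a functional on bilinear forms; its value at the coordinate form is the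
  matrix coefficient at \<open>(i, j)\<close>, which is therefore linear in \<open>t\<close> and
  independent of any representation.\<close>

definition entries ::
  "(((nat \<Rightarrow> complex) \<Rightarrow> (nat \<Rightarrow> complex) \<Rightarrow> complex) \<Rightarrow> complex) \<Rightarrow> nat \<Rightarrow> nat \<Rightarrow> complex" where
  "entries t = (\<lambda>i j. t (\<lambda>x y. x i * y j))"

lemma entries_simps [simp]:
  "entries 0 = 0"
  "entries (s + t) = entries s + entries t"
  "entries (s - t) = entries s - entries t"
  "entries (fun_scale c t) = double_scale c (entries t)"
  by (auto simp: entries_def fun_eq_iff)

lemma entries_sum: "entries (\<Sum>k\<in>K. t k) i j = (\<Sum>k\<in>K. entries (t k) i j)"
  by (simp add: entries_def sum_fun_apply)

lemma entries_etensor [simp]: "entries (etensor x y) i j = x i * y j"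
proof -
  have "bilinear_form_on fun_scale rapid_seqs fun_scale slow_seqs (\<lambda>x y. x i * y j)"
    by (auto simp: bilinear_form_on_def linear_on_def algebra_simps)
  then show ?thesis by (simp add: entries_def elem_tensor_def)
qed

definition unit_seq :: "nat \<Rightarrow> nat \<Rightarrow> complex" where
  "unit_seq k = (\<lambda>i. if i = k then 1 else 0)"

definition truncate :: "nat \<Rightarrow> (nat \<Rightarrow> complex) \<Rightarrow> nat \<Rightarrow> complex" where
  "truncate m x = (\<lambda>i. if i < m then x i else 0)"

lemma unit_seq_rapid [simp]: "unit_seq k \<in> rapid_seqs"
  unfolding rapid_seqs_alt
proof (intro CollectI allI)
  fix n
  have "\<forall>j. real (Suc j) ^ n * cmod (unit_seq k j) \<le> real (Suc k) ^ n" by (simp add: unit_seq_def)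
  then show "\<exists>C. \<forall>j. real (Suc j) ^ n * cmod (unit_seq k j) \<le> C" by blast
qed

lemma unit_seq_slow [simp]: "unit_seq k \<in> slow_seqs"
  by (rule slow_seqsI[of _ 1 0]) (simp add: unit_seq_def)

lemma truncate_Suc: "truncate (Suc m) x = truncate m x + fun_scale (x m) (unit_seq m)"
  by (auto simp: truncate_def unit_seq_def fun_eq_iff less_Suc_eq)

lemma truncate_in:
  assumes "module.subspace fun_scale V" "\<And>k. unit_seq k \<in> V"
  shows "truncate m x \<in> V"
proof (induction m)
  case 0
  have "truncate 0 x = 0" by (simp add: truncate_def fun_eq_iff)
  then show ?case using module.subspace_0[OF module_fun_scale assms(1)] by (simp only:)
next
  case (Suc m)
  then show ?case unfolding truncate_Suc
    by (intro module.subspace_add[OF module_fun_scale] module.subspace_scale[OF module_fun_scale] assms)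
qed

lemmas truncate_rapid [simp] = truncate_in[OF subspace_rapid_seqs unit_seq_rapid]
lemmas truncate_slow [simp] = truncate_in[OF subspace_slow_seqs unit_seq_slow]

lemma linear_on_truncate:
  assumes f: "linear_on fun_scale V (*) f" and V: "module.subspace fun_scale V" "\<And>k. unit_seq k \<in> V"
  shows "f (truncate m x) = (\<Sum>k<m. x k * f (unit_seq k))"
proof (induction m)
  case 0
  \<comment> \<open>\<open>linear_on\<close> provides no separate clause for zero, so the zero
    sequence is written as a scalar multiple.\<close>
  have "truncate 0 x = fun_scale 0 (unit_seq 0)" by (simp add: truncate_def fun_eq_iff)
  then have "f (truncate 0 x) = 0 * f (unit_seq 0)" using f V(2) unfolding linear_on_def by metis
  then show ?case by simp
next
  case (Suc m)
  have "fun_scale (x m) (unit_seq m) \<in> V" by (rule module.subspace_scale[OF module_fun_scale V])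
  then have "f (truncate (Suc m) x) = f (truncate m x) + x m * f (unit_seq m)"
    unfolding truncate_Suc using f V(2)[of m] truncate_in[OF V, of m x] unfolding linear_on_def by simp
  then show ?case using Suc by simp
qed

text \<open>The tensor whose matrix is the upper left block of \<open>g\<close>. The coefficient
  sits in the left factor, so that every summand is an elementary tensor.\<close>

definition finite_tensor ::
  "nat \<Rightarrow> (nat \<Rightarrow> nat \<Rightarrow> complex) \<Rightarrow> ((nat \<Rightarrow> complex) \<Rightarrow> (nat \<Rightarrow> complex) \<Rightarrow> complex) \<Rightarrow> complex" where
  "finite_tensor m g = (\<Sum>i<m. \<Sum>j<m. etensor (fun_scale (g i j) (unit_seq i)) (unit_seq j))"

lemma scaled_unit_seq_rapid [simp]: "fun_scale c (unit_seq i) \<in> rapid_seqs"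
  by (rule module.subspace_scale[OF module_fun_scale subspace_rapid_seqs unit_seq_rapid])

lemma finite_tensor_in [simp]: "finite_tensor m g \<in> sseq_tensor"
  unfolding finite_tensor_def
  by (intro module.subspace_sum[OF module_fun_scale subspace_alg_tensor] elem_tensor_in_alg_tensor) auto

lemma entries_finite_tensor: "entries (finite_tensor m g) i j = (if i < m \<and> j < m then g i j else 0)"
  unfolding finite_tensor_def entries_sum entries_etensor
  by (auto simp: unit_seq_def if_distrib[of "\<lambda>x. x * _"] if_distrib[of "\<lambda>x. _ * x"] cong: if_cong)

lemma finite_tensor_apply:
  "finite_tensor m g A = (if bilinear_form_on fun_scale rapid_seqs fun_scale slow_seqs A
    then \<Sum>i<m. \<Sum>j<m. g i j * A (unit_seq i) (unit_seq j) else 0)"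
proof (cases "bilinear_form_on fun_scale rapid_seqs fun_scale slow_seqs A")
  case True
  then have "linear_on fun_scale rapid_seqs (*) (\<lambda>x. A x (unit_seq j))" for j
    unfolding bilinear_form_on_def by simp
  then have "A (fun_scale (g i j) (unit_seq i)) (unit_seq j) = g i j * A (unit_seq i) (unit_seq j)" for i j
    unfolding linear_on_def by simp
  then show ?thesis using True by (simp add: finite_tensor_def elem_tensor_def sum_fun_apply)
qed (simp add: finite_tensor_def elem_tensor_def sum_fun_apply)

lemma finite_tensor_sum:
  "finite_tensor m (\<lambda>i j. \<Sum>l\<in>L. g l i j) = (\<Sum>l\<in>L. finite_tensor m (g l))"
proof (rule ext)
  fix A
  have "(\<Sum>i<m. \<Sum>j<m. (\<Sum>l\<in>L. g l i j) * A (unit_seq i) (unit_seq j))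
      = (\<Sum>l\<in>L. \<Sum>i<m. \<Sum>j<m. g l i j * A (unit_seq i) (unit_seq j))"
    unfolding sum_distrib_right
    unfolding sum.swap[of _ L] ..
  then show "finite_tensor m (\<lambda>i j. \<Sum>l\<in>L. g l i j) A = (\<Sum>l\<in>L. finite_tensor m (g l)) A"
    by (simp add: finite_tensor_apply sum_fun_apply)
qed

text \<open>By bilinearity the truncated tensor depends only on a block of the matrix. Summed over a
  representation, the truncation thus forgets the representation.\<close>

lemma etensor_truncate:
  assumes x: "x \<in> rapid_seqs" and y: "y \<in> slow_seqs"
  shows "etensor (truncate m x) (truncate m y) = finite_tensor m (entries (etensor x y))"
proof (rule ext)
  fix A
  show "etensor (truncate m x) (truncate m y) A = finite_tensor m (entries (etensor x y)) A"
  proof (cases "bilinear_form_on fun_scale rapid_seqs fun_scale slow_seqs A")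
    case True
    then have lin: "\<And>y. y \<in> slow_seqs \<Longrightarrow> linear_on fun_scale rapid_seqs (*) (\<lambda>x. A x y)"
      "\<And>x. x \<in> rapid_seqs \<Longrightarrow> linear_on fun_scale slow_seqs (*) (A x)"
      unfolding bilinear_form_on_def by auto
    have "A (truncate m x) (truncate m y) = (\<Sum>i<m. x i * A (unit_seq i) (truncate m y))"
      by (rule linear_on_truncate[OF lin(1) subspace_rapid_seqs]) auto
    also have "\<dots> = (\<Sum>i<m. \<Sum>j<m. x i * y j * A (unit_seq i) (unit_seq j))"
      by (simp add: linear_on_truncate[OF lin(2) subspace_slow_seqs] sum_distrib_left mult.assoc)
    finally show ?thesis
      unfolding finite_tensor_apply entries_etensor using True by (simp add: elem_tensor_def)
  qed (simp add: finite_tensor_apply elem_tensor_def)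
qed

section \<open>The projective topology described by matrix entries\<close>

lemma continuous_seminorm_nonneg:
  "\<lbrakk>continuous_seminorm fun_scale s_top p; x \<in> rapid_seqs\<rbrakk> \<Longrightarrow> 0 \<le> p x"
  "\<lbrakk>continuous_seminorm fun_scale s_dual_top q; y \<in> slow_seqs\<rbrakk> \<Longrightarrow> 0 \<le> q y"
  using seminorm_on_nonneg[OF vector_space_fun_scale subspace_rapid_seqs]
    seminorm_on_nonneg[OF vector_space_fun_scale subspace_slow_seqs]
  by (auto simp: continuous_seminorm_def)

abbreviation sseq_tensor_seminorm where
  "sseq_tensor_seminorm \<equiv> tensor_seminorm fun_scale rapid_seqs fun_scale slow_seqs"

abbreviation sseq_projective where
  "sseq_projective \<equiv> projective_tensor fun_scale s_top fun_scale s_dual_top"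

lemma box_nonempty: "b \<in> rapid_weights \<Longrightarrow> {x :: nat \<Rightarrow> complex. \<forall>j. cmod (x j) \<le> b j} \<noteq> {}"
  using rapid_weights_pos by (auto intro!: exI[of _ "\<lambda>_. 0"] less_imp_le)

lemma topspace_projective [simp]: "topspace sseq_projective = sseq_tensor"
proof -
  have "continuous_seminorm fun_scale s_dual_top (polar_seminorm {x. \<forall>j. cmod (x j) \<le> (1/2) ^ j})"
    by (intro continuous_polar_seminorm bounded_s_top_box box_nonempty rapid_weights_nonempty)
  then show ?thesis
    unfolding projective_tensor_def topspace_s_top topspace_s_dual_top
    by (intro topspace_seminorm_topology) (use continuous_rapid_norm[of 1] in auto)
qed

text \<open>Every representation bounds the weighted entry by the sum of
  \<open>p (x l) * q (y l)\<close>, where \<open>p\<close> controls rows and \<open>q\<close>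
  controls columns; the bound passes to the infimum.\<close>

lemma entries_nhd:
  assumes b: "b \<in> rapid_weights"
  obtains Q where "openin sseq_projective Q" "0 \<in> Q" "\<And>t. t \<in> Q \<Longrightarrow> entries t \<in> double_ball n b"
proof -
  define p where "p = rapid_norm (Suc n)"
  define q where "q = polar_seminorm {x. \<forall>j. cmod (x j) \<le> b j}"
  have p: "continuous_seminorm fun_scale s_top p" unfolding p_def by (rule continuous_rapid_norm) simp
  have q: "continuous_seminorm fun_scale s_dual_top q"
    unfolding q_def by (intro continuous_polar_seminorm bounded_s_top_box box_nonempty b)
  let ?\<pi> = "sseq_tensor_seminorm p q"
  note \<pi> = module_fun_scale subspace_rapid_seqs continuous_seminorm_nonneg(1)[OF p] continuous_seminorm_nonneg(2)[OF q]
  have "openin sseq_projective {t \<in> sseq_tensor. ?\<pi> (t - 0) < 1}"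
    unfolding projective_tensor_def topspace_s_top topspace_s_dual_top
  proof (rule openin_seminorm_topology)
    show "0 \<in> sseq_tensor" by (rule module.subspace_0[OF module_fun_scale subspace_alg_tensor])
  qed (use p q in blast, simp)
  moreover have "?\<pi> 0 \<le> 0" by (rule tensor_seminorm_zero[OF \<pi>])
  then have "0 \<in> {t \<in> sseq_tensor. ?\<pi> (t - 0) < 1}"
    using module.subspace_0[OF module_fun_scale subspace_alg_tensor] unfolding diff_0_right by fastforce
  moreover have "entries t \<in> double_ball n b" if t: "t \<in> {t \<in> sseq_tensor. ?\<pi> (t - 0) < 1}" for t
    unfolding double_ball_def
  proof (intro CollectI allI)
    fix i j
    have "real (Suc i) ^ n * b j * cmod (entries t i j) \<le> ?\<pi> t"
    proof (rule tensor_seminorm_ge[OF \<pi>])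
      show "t \<in> sseq_tensor" using t by blast
    next
      fix N :: nat and x y
      assume xy: "\<And>i. i < N \<Longrightarrow> x i \<in> rapid_seqs" "\<And>i. i < N \<Longrightarrow> y i \<in> slow_seqs"
        and t: "t = (\<Sum>i<N. etensor (x i) (y i))"
      have "cmod (entries t i j) \<le> (\<Sum>l<N. cmod (x l i) * cmod (y l j))"
        unfolding t entries_sum entries_etensor norm_mult[symmetric] by (rule norm_sum)
      then have "real (Suc i) ^ n * b j * cmod (entries t i j)
          \<le> real (Suc i) ^ n * b j * (\<Sum>l<N. cmod (x l i) * cmod (y l j))"
        using rapid_weights_pos[OF b, of j] by (intro mult_left_mono) auto
      also have "\<dots> = (\<Sum>l<N. (real (Suc i) ^ n * cmod (x l i)) * (b j * cmod (y l j)))"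
        by (simp add: sum_distrib_left mult_ac)
      also have "\<dots> \<le> (\<Sum>l<N. p (x l) * q (y l))"
      proof (intro sum_mono mult_mono)
        fix l assume l: "l \<in> {..<N}"
        have "real (Suc i) ^ n * cmod (x l i) \<le> real (Suc i) ^ Suc n * cmod (x l i)"
          by (intro mult_right_mono power_increasing) auto
        also have "\<dots> \<le> p (x l)" unfolding p_def using l by (intro rapid_norm_upper xy) simp
        finally show "real (Suc i) ^ n * cmod (x l i) \<le> p (x l)" .
        show "b j * cmod (y l j) \<le> q (y l)"
          unfolding q_def using l by (intro weighted_le_polar_seminorm b xy) simp
        show "0 \<le> p (x l)" using l by (intro \<pi>(3) xy) simp
        show "0 \<le> b j * cmod (y l j)" using rapid_weights_pos[OF b, of j] by simp
      qed
      finally show "real (Suc i) ^ n * b j * cmod (entries t i j) \<le> (\<Sum>l<N. p (x l) * q (y l))" .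
    qed
    then show "real (Suc i) ^ n * b j * cmod (entries t i j) \<le> 1" using t by simp
  qed
  ultimately show ?thesis using that by blast
qed

text \<open>With truncations as \<open>x'\<close> and \<open>y'\<close>, each of the two error terms
  carries one small difference next to a factor that stays bounded.\<close>

lemma etensor_diff:
  assumes "x \<in> rapid_seqs" "x' \<in> rapid_seqs" "y \<in> slow_seqs" "y' \<in> slow_seqs"
  shows "etensor x y = etensor x' y' + etensor (x - x') y + etensor x' (y - y')"
proof (rule ext)
  fix A
  have d: "x - x' \<in> rapid_seqs" "y - y' \<in> slow_seqs"
    using assms module.subspace_diff[OF module_fun_scale] subspace_rapid_seqs subspace_slow_seqs by blast+
  show "etensor x y A = (etensor x' y' + etensor (x - x') y + etensor x' (y - y')) A"
  proof (cases "bilinear_form_on fun_scale rapid_seqs fun_scale slow_seqs A")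
    case True
    then have "A (x' + (x - x')) y = A x' y + A (x - x') y" "A x' (y' + (y - y')) = A x' y' + A x' (y - y')"
      using assms d unfolding bilinear_form_on_def linear_on_def by blast+
    then show ?thesis using True by (simp add: elem_tensor_def)
  qed (simp add: elem_tensor_def)
qed

text \<open>Cutting a representation off at \<open>m\<close> leaves \<open>finite_tensor m (entries t)\<close>, whose seminorm
  is controlled by the entries, and an error of order \<open>1/m\<close>.\<close>

lemma tensor_seminorm_entries:
  assumes p: "continuous_seminorm fun_scale s_top p" and q: "continuous_seminorm fun_scale s_dual_top q"
    and e: "0 < e"
  obtains n b where "b \<in> rapid_weights"
    "\<And>t. \<lbrakk>t \<in> sseq_tensor; entries t \<in> double_ball n b\<rbrakk> \<Longrightarrow> sseq_tensor_seminorm p q t < e"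
proof -
  obtain n c where c: "0 < c"
    "\<And>x d. \<lbrakk>x \<in> rapid_seqs; 0 < d; \<And>i. real (Suc i) ^ n * cmod (x i) \<le> d\<rbrakk> \<Longrightarrow> p x \<le> c * d"
    using continuous_seminorm_s_top[OF p] by metis
  obtain \<beta> where \<beta>: "\<beta> \<in> rapid_weights"
    "\<And>y d. \<lbrakk>y \<in> slow_seqs; 0 < d; \<And>j. \<beta> j * cmod (y j) \<le> d\<rbrakk> \<Longrightarrow> q y \<le> d"
    using continuous_seminorm_s_dual_top[OF q] by metis
  \<comment> \<open>The double sum of inverse squares is at most \<open>2 * 2\<close>, so this
    choice makes the contribution of the block at most \<open>e / 4\<close>.\<close>
  define K where "K = 16 * c / e"
  have K: "0 < K" using c(1) e by (simp add: K_def)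
  define b where "b = (\<lambda>j. K * (real (Suc j) ^ 2 * \<beta> j))"
  have b: "b \<in> rapid_weights" unfolding b_def by (intro rapid_weights_scale rapid_weights_pow \<beta>(1) K)
  let ?\<pi> = "sseq_tensor_seminorm p q"
  note p0 = continuous_seminorm_nonneg(1)[OF p] and q0 = continuous_seminorm_nonneg(2)[OF q]
  note \<pi> = module_fun_scale subspace_rapid_seqs p0 q0
  have sc: "p (fun_scale a x) = cmod a * p x" if "x \<in> rapid_seqs" for a x
    using p that unfolding continuous_seminorm_def seminorm_on_def by simp
  have pe: "p (unit_seq i) \<le> c * real (Suc i) ^ n" for i
    by (rule c(2)[OF unit_seq_rapid]) (auto simp: unit_seq_def)
  have qe: "q (unit_seq j) \<le> \<beta> j" for j
    by (rule \<beta>(2)[OF unit_seq_slow]) (use rapid_weights_pos[OF \<beta>(1)] in \<open>auto simp: unit_seq_def less_imp_le\<close>)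
  \<comment> \<open>The two extra row powers, and the square inside \<open>b\<close>, pay for
    summing over \<open>i\<close> and \<open>j\<close>.\<close>
  have "?\<pi> t < e" if t: "t \<in> sseq_tensor" "entries t \<in> double_ball (n + 2) b" for t
  proof -
    obtain N :: nat and x y where xy: "\<And>l. l < N \<Longrightarrow> x l \<in> rapid_seqs" "\<And>l. l < N \<Longrightarrow> y l \<in> slow_seqs"
      and t_eq: "t = (\<Sum>l<N. etensor (x l) (y l))"
      using alg_tensor_representation[OF subspace_rapid_seqs module_fun_scale t(1)] by metis
    \<comment> \<open>One power more than \<open>p\<close> needs, and likewise for \<open>y\<close>
      below: this gains the factor \<open>1 / Suc m\<close> beyond the cut.\<close>
    have "\<forall>l. \<exists>C>0. l < N \<longrightarrow> (\<forall>i. real (Suc i) ^ Suc n * cmod (x l i) \<le> C)"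
      using rapid_seqs_bound xy(1) by (metis zero_less_one)
    then obtain C where C: "\<And>l. 0 < C l" "\<And>l i. l < N \<Longrightarrow> real (Suc i) ^ Suc n * cmod (x l i) \<le> C l" by metis
    have "\<forall>l. \<exists>D>0. l < N \<longrightarrow> (\<forall>j. real (Suc j) ^ 1 * (\<beta> j * cmod (y l j)) \<le> D)"
      using slow_seqs_bound[OF _ \<beta>(1)] xy(2) by (metis zero_less_one)
    then obtain D where D: "\<And>l. 0 < D l" "\<And>l j. l < N \<Longrightarrow> real (Suc j) ^ 1 * (\<beta> j * cmod (y l j)) \<le> D l" by metis
    define S where "S = (\<Sum>l<N. c * C l * q (y l) + c * C l * D l)"
    have S: "0 \<le> S" unfolding S_def
      using c(1) C(1) D(1) q0 xy(2) by (intro sum_nonneg add_nonneg_nonneg mult_nonneg_nonneg) (auto intro: less_imp_le)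
    \<comment> \<open>\<open>m\<close> may depend on \<open>t\<close> and its representation,
      because the estimate of the block is uniform in \<open>m\<close>.\<close>
    obtain m where m: "4 * S / e \<le> real m" using real_arch_simple by blast
    define u where "u = (\<lambda>l. x l - truncate m (x l))"
    define v where "v = (\<lambda>l. y l - truncate m (y l))"
    have u: "u l \<in> rapid_seqs" "p (u l) \<le> c * (C l / real (Suc m))" if l: "l < N" for l
    proof -
      show "u l \<in> rapid_seqs" unfolding u_def
        by (intro module.subspace_diff[OF module_fun_scale subspace_rapid_seqs] xy l truncate_rapid)
      then show "p (u l) \<le> c * (C l / real (Suc m))"
      proof (rule c(2))
        fix i
        show "real (Suc i) ^ n * cmod (u l i) \<le> C l / real (Suc m)"
        proof (cases "i < m")
          case False
          have "real (Suc m) * (real (Suc i) ^ n * cmod (u l i)) \<le> real (Suc i) * (real (Suc i) ^ n * cmod (x l i))"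
            using False by (intro mult_mono) (auto simp: u_def truncate_def)
          also have "\<dots> \<le> C l" using C(2)[OF l, of i] by (simp add: mult.assoc)
          finally show ?thesis by (simp add: field_simps)
        qed (use C(1)[of l] in \<open>simp add: u_def truncate_def\<close>)
      qed (use C(1) in simp)
    qed
    have v: "v l \<in> slow_seqs" "q (v l) \<le> D l / real (Suc m)" if l: "l < N" for l
    proof -
      show "v l \<in> slow_seqs" unfolding v_def
        by (intro module.subspace_diff[OF module_fun_scale subspace_slow_seqs] xy l truncate_slow)
      then show "q (v l) \<le> D l / real (Suc m)"
      proof (rule \<beta>(2))
        fix j
        show "\<beta> j * cmod (v l j) \<le> D l / real (Suc m)"
        proof (cases "j < m")
          case False
          have "real (Suc m) * (\<beta> j * cmod (v l j)) \<le> real (Suc j) * (\<beta> j * cmod (y l j))"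
            using False rapid_weights_pos[OF \<beta>(1), of j]
            by (intro mult_mono) (auto simp: v_def truncate_def)
          also have "\<dots> \<le> D l" using D(2)[OF l, of j] by simp
          finally show ?thesis by (simp add: field_simps)
        qed (use D(1)[of l] in \<open>simp add: v_def truncate_def\<close>)
      qed (use D(1) in simp)
    qed
    have tr: "p (truncate m (x l)) \<le> c * C l" if l: "l < N" for l
    proof (rule c(2))
      fix i
      have "real (Suc i) ^ n * cmod (truncate m (x l) i) \<le> real (Suc i) ^ Suc n * cmod (x l i)"
        by (intro mult_mono power_increasing) (auto simp: truncate_def)
      then show "real (Suc i) ^ n * cmod (truncate m (x l) i) \<le> C l" using C(2)[OF l, of i] by linarith
    qed (use C(1) in auto)
    have fin: "(\<Sum>l<N. etensor (truncate m (x l)) (truncate m (y l))) = finite_tensor m (entries t)"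
    proof -
      have "(\<Sum>l<N. etensor (truncate m (x l)) (truncate m (y l)))
          = (\<Sum>l<N. finite_tensor m (entries (etensor (x l) (y l))))"
        by (intro sum.cong refl etensor_truncate xy) auto
      also have "\<dots> = finite_tensor m (entries t)"
        unfolding finite_tensor_sum[symmetric] t_eq entries_sum[abs_def] ..
      finally show ?thesis .
    qed
    let ?rest = "\<Sum>l<N. etensor (u l) (y l) + etensor (truncate m (x l)) (v l)"
    have decomp: "t = finite_tensor m (entries t) + ?rest"
    proof -
      have "t = (\<Sum>l<N. etensor (truncate m (x l)) (truncate m (y l))
          + (etensor (u l) (y l) + etensor (truncate m (x l)) (v l)))"
        unfolding t_eq u_def v_def using xy
        by (intro sum.cong refl) (subst etensor_diff[of _ "truncate m _" _ "truncate m _"], auto simp: add.assoc)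
      then show ?thesis unfolding sum.distrib fin .
    qed
    have main: "?\<pi> (finite_tensor m (entries t)) \<le> e / 4"
    proof -
      have "?\<pi> (finite_tensor m (entries t))
          \<le> (\<Sum>i<m. \<Sum>j<m. ?\<pi> (etensor (fun_scale (entries t i j) (unit_seq i)) (unit_seq j)))"
        unfolding finite_tensor_def
        by (intro order_trans[OF tensor_seminorm_sum[OF \<pi>]] sum_mono tensor_seminorm_sum[OF \<pi>]
          module.subspace_sum[OF module_fun_scale subspace_alg_tensor] elem_tensor_in_alg_tensor) auto
      also have "\<dots> \<le> (\<Sum>i<m. \<Sum>j<m. c / K * (1 / real (Suc i) ^ 2 * (1 / real (Suc j) ^ 2)))"
      proof (intro sum_mono)
        fix i j
        have "?\<pi> (etensor (fun_scale (entries t i j) (unit_seq i)) (unit_seq j))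
            \<le> p (fun_scale (entries t i j) (unit_seq i)) * q (unit_seq j)"
          by (rule tensor_seminorm_elem[OF \<pi>]) auto
        also have "\<dots> = cmod (entries t i j) * (p (unit_seq i) * q (unit_seq j))" by (simp add: sc)
        also have "\<dots> \<le> cmod (entries t i j) * (c * real (Suc i) ^ n * \<beta> j)"
          using c(1) by (intro mult_left_mono mult_mono pe qe q0) auto
        also have "\<dots> = c / K * (1 / real (Suc i) ^ 2 * (1 / real (Suc j) ^ 2)) *
            (real (Suc i) ^ (n + 2) * b j * cmod (entries t i j))"
        proof -
          have "z * (c * X * B) = c / K * (1 / I * (1 / J)) * (X * I * (K * (J * B)) * z)"
            if "I \<noteq> 0" "J \<noteq> 0" for I J X B z :: real
            using that K by (simp add: field_simps)
          then show ?thesis unfolding b_def power_add by this simp_all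
        qed
        also have "\<dots> \<le> c / K * (1 / real (Suc i) ^ 2 * (1 / real (Suc j) ^ 2)) * 1"
          using t(2) c(1) K unfolding double_ball_def by (intro mult_left_mono) auto
        finally show "?\<pi> (etensor (fun_scale (entries t i j) (unit_seq i)) (unit_seq j))
            \<le> c / K * (1 / real (Suc i) ^ 2 * (1 / real (Suc j) ^ 2))" by simp
      qed
      also have "\<dots> = c / K * ((\<Sum>i<m. 1 / real (Suc i) ^ 2) * (\<Sum>j<m. 1 / real (Suc j) ^ 2))"
        unfolding sum_product unfolding sum_distrib_left ..
      also have "\<dots> \<le> c / K * (2 * 2)"
        using c(1) K by (intro mult_left_mono mult_mono sum_inverse_squares_le sum_nonneg) auto
      also have "\<dots> = e / 4" using c(1) e by (simp add: K_def)
      finally show ?thesis .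
    qed
    have rest: "?\<pi> ?rest \<le> e / 4"
    proof -
      have "?\<pi> ?rest
          \<le> (\<Sum>l<N. ?\<pi> (etensor (u l) (y l) + etensor (truncate m (x l)) (v l)))"
        using u(1) v(1) xy
        by (intro tensor_seminorm_sum[OF \<pi>] module.subspace_add[OF module_fun_scale subspace_alg_tensor]
            elem_tensor_in_alg_tensor) auto
      also have "\<dots> \<le> (\<Sum>l<N. (c * C l * q (y l) + c * C l * D l) / real (Suc m))"
      proof (rule sum_mono)
        fix l assume "l \<in> {..<N}"
        then have l: "l < N" by simp
        have "?\<pi> (etensor (u l) (y l) + etensor (truncate m (x l)) (v l))
            \<le> p (u l) * q (y l) + p (truncate m (x l)) * q (v l)"
          using u(1)[OF l] v(1)[OF l] xy(2)[OF l]
          by (intro order_trans[OF tensor_seminorm_add[OF \<pi>]] add_mono tensor_seminorm_elem[OF \<pi>]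
              elem_tensor_in_alg_tensor) auto
        also have "\<dots> \<le> c * (C l / real (Suc m)) * q (y l) + c * C l * (D l / real (Suc m))"
          using c(1) C(1)[of l] u[OF l] v[OF l] tr[OF l] xy(2)[OF l] p0 q0
          by (intro add_mono mult_right_mono mult_mono) (auto simp: less_imp_le)
        also have "\<dots> = (c * C l * q (y l) + c * C l * D l) / real (Suc m)"
          by (simp add: add_divide_distrib)
        finally show "?\<pi> (etensor (u l) (y l) + etensor (truncate m (x l)) (v l))
            \<le> (c * C l * q (y l) + c * C l * D l) / real (Suc m)" .
      qed
      also have "\<dots> = S / real (Suc m)" unfolding S_def sum_divide_distrib ..
      also have "\<dots> \<le> e / 4" using m e by (simp add: field_simps)
      finally show ?thesis .
    qed
    have "?rest \<in> sseq_tensor"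
      using u(1) v(1) xy
      by (intro module.subspace_sum[OF module_fun_scale subspace_alg_tensor]
          module.subspace_add[OF module_fun_scale subspace_alg_tensor] elem_tensor_in_alg_tensor) auto
    then have "?\<pi> (finite_tensor m (entries t) + ?rest) \<le> ?\<pi> (finite_tensor m (entries t)) + ?\<pi> ?rest"
      by (intro tensor_seminorm_add[OF \<pi>] finite_tensor_in)
    then show ?thesis using main rest e unfolding decomp[symmetric] by linarith
  qed
  then show ?thesis using that b by blast
qed

lemma double_ball_inter:
  assumes "b \<in> rapid_weights" "b' \<in> rapid_weights"
  shows "double_ball (max n n') (\<lambda>j. b j + b' j) \<subseteq> double_ball n b \<inter> double_ball n' b'"
proof -
  have *: "g \<in> double_ball k a"
    if g: "g \<in> double_ball l c" "k \<le> l" "\<And>j. a j \<le> c j" "\<And>j. 0 \<le> a j" for g k l a c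
    unfolding double_ball_def
  proof (intro CollectI allI)
    fix i j
    have "real (Suc i) ^ k * a j * cmod (g i j) \<le> real (Suc i) ^ l * c j * cmod (g i j)"
      using g by (intro mult_right_mono mult_mono power_increasing) auto
    then show "real (Suc i) ^ k * a j * cmod (g i j) \<le> 1"
      using g(1) unfolding double_ball_def by (blast intro: order_trans)
  qed
  have "0 \<le> b j" "0 \<le> b' j" for j using assms rapid_weights_pos by (simp_all add: less_imp_le)
  note nonneg = this
  show ?thesis
  proof (intro subsetI IntI)
    fix g assume g: "g \<in> double_ball (max n n') (\<lambda>j. b j + b' j)"
    show "g \<in> double_ball n b" by (rule *[OF g]) (auto simp: nonneg)
    show "g \<in> double_ball n' b'" by (rule *[OF g]) (auto simp: nonneg)
  qed
qed

text \<open>Together with \<open>entries_nhd\<close>: at 0, the projective topology is the one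
  pulled back along \<open>entries\<close> from the weighted sup seminorms.\<close>

lemma projective_zero_base:
  assumes Q: "openin sseq_projective Q" "0 \<in> Q"
  obtains n b where "b \<in> rapid_weights"
    "\<And>t. \<lbrakk>t \<in> sseq_tensor; entries t \<in> double_ball n b\<rbrakk> \<Longrightarrow> t \<in> Q"
proof -
  define U where "U = (\<lambda>n b. {t. entries t \<in> double_ball n b})"
  let ?B = "{U n b |n b. b \<in> rapid_weights}"
  have "\<exists>A\<in>?B. sseq_tensor \<inter> A \<subseteq> Q"
  proof (rule seminorm_topology_zero_base[OF _ _ _ Q(1)[unfolded projective_tensor_def topspace_s_top topspace_s_dual_top] Q(2)])
    fix r x y assume "r \<in> {sseq_tensor_seminorm p q |p q. continuous_seminorm fun_scale s_top p \<and> continuous_seminorm fun_scale s_dual_top q}"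
      and xy: "x \<in> sseq_tensor" "y \<in> sseq_tensor"
    then obtain p q where r: "r = sseq_tensor_seminorm p q"
      and pq: "continuous_seminorm fun_scale s_top p" "continuous_seminorm fun_scale s_dual_top q" by blast
    have "r (y + (0 - x)) \<le> r y + r (0 - x)"
      unfolding r
    proof (rule tensor_seminorm_add[OF module_fun_scale subspace_rapid_seqs])
      show "0 - x \<in> sseq_tensor"
        using module.subspace_diff[OF module_fun_scale subspace_alg_tensor]
          module.subspace_0[OF module_fun_scale subspace_alg_tensor] xy by blast
    qed (fact continuous_seminorm_nonneg(1)[OF pq(1)] continuous_seminorm_nonneg(2)[OF pq(2)] xy(2))+
    then show "r (y - x) \<le> r y + r (0 - x)" by (metis add_diff_eq add_0_right)
  next
    fix r and e :: real
    assume "r \<in> {sseq_tensor_seminorm p q |p q. continuous_seminorm fun_scale s_top p \<and> continuous_seminorm fun_scale s_dual_top q}"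
      and e: "0 < e"
    then obtain p q where r: "r = sseq_tensor_seminorm p q"
      and pq: "continuous_seminorm fun_scale s_top p" "continuous_seminorm fun_scale s_dual_top q" by blast
    obtain n b where "b \<in> rapid_weights" "\<And>t. \<lbrakk>t \<in> sseq_tensor; entries t \<in> double_ball n b\<rbrakk> \<Longrightarrow> r t < e"
      unfolding r using tensor_seminorm_entries[OF pq e] by metis
    then show "\<exists>A\<in>?B. \<forall>t\<in>sseq_tensor \<inter> A. r t < e" unfolding U_def by blast
  next
    fix A A' assume "A \<in> ?B" "A' \<in> ?B"
    then obtain n b n' b' where b: "b \<in> rapid_weights" "b' \<in> rapid_weights" "A = U n b" "A' = U n' b'" by blast
    have "U (max n n') (\<lambda>j. b j + b' j) \<subseteq> A \<inter> A'"
      unfolding b(3,4) U_def using double_ball_inter[OF b(1,2)] by blast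
    then show "\<exists>A''\<in>?B. A'' \<subseteq> A \<inter> A'" using rapid_weights_add[OF b(1,2)] by blast
  qed
  then show ?thesis using that unfolding U_def by blast
qed

lemma entries_in_double_seqs:
  assumes "t \<in> sseq_tensor" shows "entries t \<in> double_seqs"
proof -
  have 1: "entries (etensor x y) \<in> double_seqs" if xy: "x \<in> rapid_seqs" "y \<in> slow_seqs" for x y
    unfolding double_seqs_def
  proof (intro CollectI allI ballI)
    fix n b assume b: "b \<in> rapid_weights"
    obtain C where C: "0 < C" "\<And>i. real (Suc i) ^ n * cmod (x i) \<le> C" using rapid_seqs_bound[OF xy(1)] by metis
    obtain D where D: "\<And>j. real (Suc j) ^ 0 * (b j * cmod (y j)) \<le> D" using slow_seqs_bound[OF xy(2) b] by metis
    have "real (Suc i) ^ n * b j * cmod (entries (etensor x y) i j) \<le> C * D" for i j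
    proof -
      have "real (Suc i) ^ n * b j * cmod (entries (etensor x y) i j)
          = (real (Suc i) ^ n * cmod (x i)) * (b j * cmod (y j))" by (simp add: norm_mult)
      also have "\<dots> \<le> C * D"
        using C D[of j] rapid_weights_pos[OF b, of j] by (intro mult_mono) auto
      finally show ?thesis .
    qed
    then show "\<exists>c. \<forall>i j. real (Suc i) ^ n * b j * cmod (entries (etensor x y) i j) \<le> c" by blast
  qed
  obtain n :: nat and x y where xy: "\<And>l. l < n \<Longrightarrow> x l \<in> rapid_seqs" "\<And>l. l < n \<Longrightarrow> y l \<in> slow_seqs"
    and t: "t = (\<Sum>l<n. etensor (x l) (y l))"
    using alg_tensor_representation[OF subspace_rapid_seqs module_fun_scale assms] by metis
  have "entries (\<Sum>l<k. etensor (x l) (y l)) \<in> double_seqs" if "k \<le> n" for k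
    using that
  proof (induction k)
    case 0
    have "(0 :: nat \<Rightarrow> nat \<Rightarrow> complex) \<in> double_seqs" unfolding double_seqs_def by auto
    then show ?case unfolding lessThan_0 sum.empty entries_simps(1) .
  next
    case (Suc k)
    then show ?case unfolding sum.lessThan_Suc entries_simps(2)
      using Suc.prems by (intro double_seqs_add Suc.IH 1 xy) linarith+
  qed
  then show ?thesis unfolding t by blast
qed

section \<open>Neighbourhoods of zero in locally convex spaces\<close>

context
  fixes sc :: "complex \<Rightarrow> 'e::ab_group_add \<Rightarrow> 'e" and T :: "'e topology"
  assumes lc: "locally_convex_space sc T"
begin

lemma lcs_module: "module sc"
proof -
  interpret vector_space sc using lc unfolding locally_convex_space_def by blast
  show ?thesis by unfold_locales
qed

lemma lcs_subspace: "module.subspace sc (topspace T)"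
  using lc unfolding locally_convex_space_def by blast

lemma lcs_continuous_scale: "continuous_map T T (sc c)"
proof -
  have "continuous_map (prod_topology euclidean T) T (\<lambda>(c, x). sc c x)"
    using lc unfolding locally_convex_space_def by blast
  moreover have "continuous_map T (prod_topology euclidean T) (\<lambda>x. (c, x))"
    by (intro continuous_map_pairedI) auto
  ultimately have "continuous_map T T ((\<lambda>(c, x). sc c x) \<circ> (\<lambda>x. (c, x)))"
    by (rule continuous_map_compose[rotated])
  then show ?thesis by (simp add: comp_def)
qed

lemma lcs_continuous_diff: "continuous_map (prod_topology T T) T (\<lambda>(x, y). x - y)"
proof -
  have "continuous_map (prod_topology T T) T (\<lambda>(x, y). x + y)"
    using lc unfolding locally_convex_space_def by blast
  moreover have "continuous_map (prod_topology T T) (prod_topology T T) (\<lambda>p. (fst p, sc (-1) (snd p)))"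
    by (intro continuous_map_pairedI continuous_map_fst
      continuous_map_compose[OF continuous_map_snd lcs_continuous_scale, unfolded comp_def])
  ultimately have "continuous_map (prod_topology T T) T ((\<lambda>(x, y). x + y) \<circ> (\<lambda>p. (fst p, sc (-1) (snd p))))"
    by (rule continuous_map_compose[rotated])
  then show ?thesis
    by (simp add: comp_def case_prod_unfold module.scale_minus_left[OF lcs_module] module.scale_one[OF lcs_module])
qed

lemma zero_nhd_open: "\<lbrakk>openin T Q; 0 \<in> Q\<rbrakk> \<Longrightarrow> zero_nhd T Q"
  unfolding zero_nhd_def using openin_subset by blast

lemma zero_nhd_inter: "\<lbrakk>zero_nhd T U; zero_nhd T V\<rbrakk> \<Longrightarrow> zero_nhd T (U \<inter> V)"
  unfolding zero_nhd_def
proof (intro conjI)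
  assume "U \<subseteq> topspace T \<and> (\<exists>Q. openin T Q \<and> 0 \<in> Q \<and> Q \<subseteq> U)"
    and "V \<subseteq> topspace T \<and> (\<exists>Q. openin T Q \<and> 0 \<in> Q \<and> Q \<subseteq> V)"
  then obtain P Q where *: "U \<subseteq> topspace T" "openin T P" "0 \<in> P" "P \<subseteq> U" "openin T Q" "0 \<in> Q" "Q \<subseteq> V"
    by (elim conjE exE)
  then show "U \<inter> V \<subseteq> topspace T" by blast
  show "\<exists>Q. openin T Q \<and> 0 \<in> Q \<and> Q \<subseteq> U \<inter> V"
    using * by (intro exI[of _ "P \<inter> Q"]) (auto intro: openin_Int)
qed

lemma zero_nhd_scale:
  assumes "zero_nhd T U"
  obtains V where "zero_nhd T V" "\<And>x. x \<in> V \<Longrightarrow> sc c x \<in> U"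
proof -
  obtain Q where Q: "openin T Q" "0 \<in> Q" "Q \<subseteq> U" using assms unfolding zero_nhd_def by blast
  have "openin T {x \<in> topspace T. sc c x \<in> Q}"
    by (rule openin_continuous_map_preimage[OF lcs_continuous_scale Q(1)])
  moreover have "0 \<in> {x \<in> topspace T. sc c x \<in> Q}"
    using Q(2) module.subspace_0[OF lcs_module lcs_subspace] module.scale_zero_right[OF lcs_module] by simp
  ultimately have "zero_nhd T {x \<in> topspace T. sc c x \<in> Q}" by (rule zero_nhd_open)
  then show ?thesis by (rule that) (use Q(3) in blast)
qed

lemma zero_nhd_diff:
  assumes "zero_nhd T U"
  obtains V where "zero_nhd T V" "\<And>x y. \<lbrakk>x \<in> V; y \<in> V\<rbrakk> \<Longrightarrow> x - y \<in> U"
proof -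
  obtain Q where Q: "openin T Q" "0 \<in> Q" "Q \<subseteq> U" using assms unfolding zero_nhd_def by blast
  let ?S = "{p \<in> topspace (prod_topology T T). (\<lambda>(x, y). x - y) p \<in> Q}"
  have S: "openin (prod_topology T T) ?S"
    by (rule openin_continuous_map_preimage[OF lcs_continuous_diff Q(1)])
  have zero: "(0, 0) \<in> ?S"
    using Q(2) module.subspace_0[OF lcs_module lcs_subspace] by simp
  obtain A B where AB: "openin T A" "openin T B" "0 \<in> A" "0 \<in> B" "A \<times> B \<subseteq> ?S"
    using openin_prod_topology_alt[THEN iffD1, OF S, THEN spec, THEN spec, THEN mp, OF zero] by (elim exE conjE)
  have "zero_nhd T (A \<inter> B)" using AB by (intro zero_nhd_open openin_Int) auto
  then show ?thesis
  proof (rule that)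
    fix x y assume "x \<in> A \<inter> B" "y \<in> A \<inter> B"
    then have "(x, y) \<in> ?S" using AB(5) by blast
    then show "x - y \<in> U" using Q(3) by auto
  qed
qed

lemma zero_nhd_add:
  assumes "zero_nhd T U"
  obtains V where "zero_nhd T V" "\<And>x y. \<lbrakk>x \<in> V; y \<in> V\<rbrakk> \<Longrightarrow> x + y \<in> U"
proof -
  obtain V where V: "zero_nhd T V" "\<And>x y. \<lbrakk>x \<in> V; y \<in> V\<rbrakk> \<Longrightarrow> x - y \<in> U"
    using assms by (rule zero_nhd_diff) blast
  obtain V' where V': "zero_nhd T V'" "\<And>x. x \<in> V' \<Longrightarrow> sc (-1) x \<in> V"
    using V(1) by (rule zero_nhd_scale[where c = "-1"]) blast
  have "x + y \<in> U" if "x \<in> V" "y \<in> V'" for x y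
    using V(2)[OF that(1) V'(2)[OF that(2)]]
    by (simp add: module.scale_minus_left[OF lcs_module] module.scale_one[OF lcs_module])
  then show ?thesis by (intro that[OF zero_nhd_inter[OF V(1) V'(1)]]) auto
qed

lemma zero_nhd_translate:
  assumes U: "zero_nhd T U" and z: "z \<in> topspace T"
  obtains Q where "openin T Q" "z \<in> Q" "\<And>w. w \<in> Q \<Longrightarrow> z - w \<in> U"
proof -
  obtain Q where Q: "openin T Q" "0 \<in> Q" "Q \<subseteq> U" using U unfolding zero_nhd_def by blast
  have "continuous_map T (prod_topology T T) (\<lambda>w. (z, w))"
    using z by (intro continuous_map_pairedI) auto
  then have "continuous_map T T ((\<lambda>(x, y). x - y) \<circ> (\<lambda>w. (z, w)))"
    using lcs_continuous_diff by (rule continuous_map_compose)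
  then have "continuous_map T T (\<lambda>w. z - w)" by (simp add: comp_def)
  then have "openin T {w \<in> topspace T. z - w \<in> Q}" using Q(1) by (rule openin_continuous_map_preimage)
  then show ?thesis by (rule that) (use Q(2,3) z in auto)
qed

lemma Hausdorff_zero:
  assumes "Hausdorff_space T" "z \<in> topspace T" "\<And>U. zero_nhd T U \<Longrightarrow> z \<in> U"
  shows "z = 0"
proof (rule ccontr)
  assume "z \<noteq> 0"
  moreover have "0 \<in> topspace T" by (rule module.subspace_0[OF lcs_module lcs_subspace])
  ultimately obtain A B where "openin T A" "openin T B" "0 \<in> A" "z \<in> B" "disjnt A B"
    using assms(1,2) unfolding Hausdorff_space_def by metis
  then show False using assms(3)[OF zero_nhd_open] unfolding disjnt_def by blast
qed

end

section \<open>The completion\<close>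

text \<open>The balls are cut out by non-strict conditions on single entries, hence closed under
  entrywise limits. This turns Cauchy estimates into estimates for the limit.\<close>

lemma double_ball_convergent:
  assumes "F \<noteq> bot" "\<And>i j. ((\<lambda>t. f t i j) \<longlongrightarrow> g i j) F" "\<forall>\<^sub>F t in F. f t - h \<in> double_ball n b"
  shows "g - h \<in> double_ball n b"
  unfolding double_ball_def
proof (intro CollectI allI)
  fix i j
  have "((\<lambda>t. real (Suc i) ^ n * b j * cmod ((f t - h) i j)) \<longlongrightarrow> real (Suc i) ^ n * b j * cmod ((g - h) i j)) F"
    unfolding fun_diff_def by (intro tendsto_intros assms(2))
  moreover have "\<forall>\<^sub>F t in F. real (Suc i) ^ n * b j * cmod ((f t - h) i j) \<le> 1"
    using assms(3) by (rule eventually_mono) (simp add: double_ball_def)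
  ultimately show "real (Suc i) ^ n * b j * cmod ((g - h) i j) \<le> 1"
    using assms(1) by (rule tendsto_upperbound)
qed

lemma double_ball_add:
  assumes "g \<in> double_ball n (\<lambda>j. 2 * b j)" "h \<in> double_ball n (\<lambda>j. 2 * b j)" "b \<in> rapid_weights"
  shows "g + h \<in> double_ball n b" and "g - h \<in> double_ball n b"
proof -
  \<comment> \<open>The unimodular factor \<open>s\<close> treats sum and difference at
    once.\<close>
  have *: "real (Suc i) ^ n * b j * cmod (g i j + s * h i j) \<le> 1" if "cmod s = 1" for i j s
  proof -
    have "real (Suc i) ^ n * b j * cmod (g i j + s * h i j)
        \<le> real (Suc i) ^ n * b j * (cmod (g i j) + cmod (h i j))"
      using rapid_weights_pos[OF assms(3), of j] that norm_triangle_ineq[of "g i j" "s * h i j"]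
      by (intro mult_left_mono) (auto simp: norm_mult)
    also have "\<dots> = (real (Suc i) ^ n * (2 * b j) * cmod (g i j) + real (Suc i) ^ n * (2 * b j) * cmod (h i j)) / 2"
      by (simp add: distrib_left)
    also have "\<dots> \<le> (1 + 1) / 2"
      using assms(1,2) unfolding double_ball_def by (intro divide_right_mono add_mono) auto
    finally show ?thesis by simp
  qed
  show "g + h \<in> double_ball n b" using *[of 1] unfolding double_ball_def by simp
  show "g - h \<in> double_ball n b" using *[of "-1"] unfolding double_ball_def by simp
qed

text \<open>The \<open>+ 1\<close> keeps the enlarged weight positive for \<open>c = 0\<close>, as
  \<open>rapid_weights\<close> demands.\<close>

lemma double_ball_scale:
  assumes "g \<in> double_ball n (\<lambda>j. (cmod c + 1) * b j)" "b \<in> rapid_weights"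
  shows "double_scale c g \<in> double_ball n b"
  unfolding double_ball_def
proof (intro CollectI allI)
  fix i j
  have "real (Suc i) ^ n * b j * cmod (double_scale c g i j) = cmod c * (real (Suc i) ^ n * b j * cmod (g i j))"
    by (simp add: norm_mult)
  also have "\<dots> \<le> (cmod c + 1) * (real (Suc i) ^ n * b j * cmod (g i j))"
    using rapid_weights_pos[OF assms(2), of j] by (intro mult_right_mono) auto
  also have "\<dots> \<le> 1" using assms(1) unfolding double_ball_def by (simp add: mult_ac)
  finally show "real (Suc i) ^ n * b j * cmod (double_scale c g i j) \<le> 1" .
qed

lemma double_seqsI:
  assumes "\<And>n b. b \<in> rapid_weights \<Longrightarrow> \<exists>h\<in>double_seqs. g - h \<in> double_ball n b"
  shows "g \<in> double_seqs"
  unfolding double_seqs_def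
proof (intro CollectI allI ballI)
  fix n b assume b: "b \<in> rapid_weights"
  obtain h where h: "h \<in> double_seqs" "g - h \<in> double_ball n b" using assms[OF b] by blast
  obtain c where c: "\<And>i j. real (Suc i) ^ n * b j * cmod (h i j) \<le> c" using double_seqsD[OF h(1) b] by blast
  have "real (Suc i) ^ n * b j * cmod (g i j) \<le> 1 + c" for i j
  proof -
    have "real (Suc i) ^ n * b j * cmod (g i j) \<le> real (Suc i) ^ n * b j * (cmod ((g - h) i j) + cmod (h i j))"
      using rapid_weights_pos[OF b, of j] norm_triangle_ineq[of "(g - h) i j" "h i j"]
      by (intro mult_left_mono) auto
    also have "\<dots> \<le> 1 + c"
      unfolding distrib_left using h(2) c unfolding double_ball_def by (intro add_mono) auto
    finally show ?thesis .
  qed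
  then show "\<exists>c. \<forall>i j. real (Suc i) ^ n * b j * cmod (g i j) \<le> c" by blast
qed

text \<open>Outside the block one index is at least \<open>m\<close>, so one spare power of each
  index together dominates \<open>Suc m\<close>.\<close>

lemma finite_tensor_converges:
  assumes g: "g \<in> double_seqs" and b: "b \<in> rapid_weights"
  obtains M where "\<And>m. M \<le> m \<Longrightarrow> g - entries (finite_tensor m g) \<in> double_ball n b"
proof -
  obtain c where c: "\<And>i j. real (Suc i) ^ Suc n * (real (Suc j) ^ 1 * b j) * cmod (g i j) \<le> c"
    using double_seqsD[OF g rapid_weights_pow[OF b, of 1]] by blast
  obtain M where M: "c \<le> real M" using real_arch_simple by blast
  have "g - entries (finite_tensor m g) \<in> double_ball n b" if m: "M \<le> m" for m
    unfolding double_ball_def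
  proof (intro CollectI allI)
    fix i j
    show "real (Suc i) ^ n * b j * cmod ((g - entries (finite_tensor m g)) i j) \<le> 1"
    proof (cases "i < m \<and> j < m")
      case False
      then have "m \<le> i \<or> m \<le> j" by auto
      then have "real (Suc m) * 1 \<le> real (Suc i) * real (Suc j)"
      proof
        assume "m \<le> i" then show ?thesis by (intro mult_mono) auto
      next
        assume "m \<le> j"
        then have "1 * real (Suc m) \<le> real (Suc i) * real (Suc j)" by (intro mult_mono) auto
        then show ?thesis by simp
      qed
      then have "real (Suc m) * (real (Suc i) ^ n * b j * cmod (g i j))
          \<le> real (Suc i) * real (Suc j) * (real (Suc i) ^ n * b j * cmod (g i j))"
        using rapid_weights_pos[OF b, of j] by (intro mult_right_mono) auto
      also have "\<dots> = real (Suc i) ^ Suc n * (real (Suc j) ^ 1 * b j) * cmod (g i j)"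
        by (simp only: power_Suc power_one_right mult_ac)
      also have "\<dots> \<le> real (Suc m) * 1" using c[of i j] M m by simp
      finally have "real (Suc i) ^ n * b j * cmod (g i j) \<le> 1"
        by (rule mult_left_le_imp_le) simp
      then show ?thesis using False by (simp add: entries_finite_tensor)
    qed (simp add: entries_finite_tensor)
  qed
  then show ?thesis using that by blast
qed

section \<open>The double sequences and an arbitrary completion\<close>

context
  fixes scE :: "complex \<Rightarrow> 'e::ab_group_add \<Rightarrow> 'e" and E :: "'e topology"
    and \<iota> :: "(((nat \<Rightarrow> complex) \<Rightarrow> (nat \<Rightarrow> complex) \<Rightarrow> complex) \<Rightarrow> complex) \<Rightarrow> 'e"
  assumes completion: "is_completed_projective_tensor fun_scale s_top fun_scale s_dual_top scE E \<iota>"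
begin

lemma completion_facts:
  shows lcs: "locally_convex_space scE E" and haus: "Hausdorff_space E" and complete: "complete_tvs E"
    and linear: "linear_on fun_scale sseq_tensor scE \<iota>" and embedding: "embedding_map sseq_projective E \<iota>"
    and dense: "E closure_of (\<iota> ` sseq_tensor) = topspace E"
proof -
  note C = completion[unfolded is_completed_projective_tensor_def is_completion_def topspace_projective]
  from C show "locally_convex_space scE E" by (elim conjE)
  from C show "Hausdorff_space E" by (elim conjE)
  from C show "complete_tvs E" by (elim conjE)
  from C show "linear_on fun_scale sseq_tensor scE \<iota>" by (elim conjE)
  from C show "embedding_map sseq_projective E \<iota>" by (elim conjE)
  from C show "E closure_of (\<iota> ` sseq_tensor) = topspace E" by (elim conjE)
qed

lemmas mod = lcs_module[OF lcs]
lemmas sub = lcs_subspace[OF lcs]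

lemmas sseq_tensor_closed =
  module.subspace_0[OF module_fun_scale subspace_alg_tensor]
  module.subspace_add[OF module_fun_scale subspace_alg_tensor]
  module.subspace_diff[OF module_fun_scale subspace_alg_tensor]
  module.subspace_scale[OF module_fun_scale subspace_alg_tensor]

lemma embed_add: "\<lbrakk>s \<in> sseq_tensor; t \<in> sseq_tensor\<rbrakk> \<Longrightarrow> \<iota> (s + t) = \<iota> s + \<iota> t"
  by (rule linear[unfolded linear_on_def, THEN conjunct1, THEN bspec, THEN bspec])

lemma embed_scale: "t \<in> sseq_tensor \<Longrightarrow> \<iota> (fun_scale c t) = scE c (\<iota> t)"
  by (rule linear[unfolded linear_on_def, THEN conjunct2, THEN spec, THEN bspec])

lemma embed_diff:
  assumes "s \<in> sseq_tensor" "t \<in> sseq_tensor"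
  shows "\<iota> (s - t) = \<iota> s - \<iota> t"
  using embed_add[OF sseq_tensor_closed(3)[OF assms] assms(2)] unfolding diff_add_cancel eq_diff_eq by (rule sym)

lemma embed_zero: "\<iota> 0 = 0"
  using embed_diff[OF sseq_tensor_closed(1,1)] unfolding diff_self .

lemma embed_homeomorphic: "homeomorphic_map sseq_projective (subtopology E (\<iota> ` sseq_tensor)) \<iota>"
  using embedding unfolding embedding_map_def topspace_projective .

lemma embed_continuous: "continuous_map sseq_projective E \<iota>"
  using homeomorphic_imp_continuous_map[OF embed_homeomorphic] unfolding continuous_map_in_subtopology by (rule conjunct1)

lemma embed_in:
  assumes "t \<in> sseq_tensor" shows "\<iota> t \<in> topspace E"
  using continuous_map_image_subset_topspace[OF embed_continuous] assms unfolding topspace_projective by (rule image_subset_iff[THEN iffD1, THEN bspec])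

lemma embed_small:
  assumes "zero_nhd E U"
  obtains n b where "b \<in> rapid_weights"
    "\<And>t. \<lbrakk>t \<in> sseq_tensor; entries t \<in> double_ball n b\<rbrakk> \<Longrightarrow> \<iota> t \<in> U"
proof -
  obtain Q where Q: "openin E Q" "0 \<in> Q" "Q \<subseteq> U" using assms unfolding zero_nhd_def by blast
  have "openin sseq_projective {t \<in> topspace sseq_projective. \<iota> t \<in> Q}"
    by (rule openin_continuous_map_preimage[OF embed_continuous Q(1)])
  moreover have "0 \<in> {t \<in> topspace sseq_projective. \<iota> t \<in> Q}"
    using Q(2) sseq_tensor_closed(1) embed_zero by simp
  ultimately obtain n b where "b \<in> rapid_weights"
    "\<And>t. \<lbrakk>t \<in> sseq_tensor; entries t \<in> double_ball n b\<rbrakk> \<Longrightarrow> t \<in> {t \<in> topspace sseq_projective. \<iota> t \<in> Q}"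
    by (rule projective_zero_base) blast
  with that show ?thesis using Q(3) by blast
qed

text \<open>Here the embedding property enters: the image of a projective neighbourhood is the trace
  of an open set of \<open>E\<close> on the image of the tensors.\<close>

lemma entries_small:
  assumes b: "b \<in> rapid_weights"
  obtains Q where "openin E Q" "0 \<in> Q"
    "\<And>t. \<lbrakk>t \<in> sseq_tensor; \<iota> t \<in> Q\<rbrakk> \<Longrightarrow> entries t \<in> double_ball n b"
proof -
  obtain P where P: "openin sseq_projective P" "0 \<in> P" "\<And>t. t \<in> P \<Longrightarrow> entries t \<in> double_ball n b"
    using b by (rule entries_nhd[where n = n]) blast
  note hom = embed_homeomorphic
  have inj: "inj_on \<iota> sseq_tensor" using homeomorphic_imp_injective_map[OF hom] by simp
  have "openin (subtopology E (\<iota> ` sseq_tensor)) (\<iota> ` P)"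
    using homeomorphic_map_openness_eq[OF hom] P(1) openin_subset by metis
  then obtain Q where Q: "openin E Q" "\<iota> ` P = Q \<inter> \<iota> ` sseq_tensor"
    unfolding openin_subtopology by blast
  have "entries t \<in> double_ball n b" if "t \<in> sseq_tensor" "\<iota> t \<in> Q" for t
  proof -
    have "\<iota> t \<in> \<iota> ` P" using that Q(2) by blast
    then have "t \<in> P" using inj that(1) openin_subset[OF P(1)] by (auto dest: inj_onD)
    then show ?thesis by (rule P(3))
  qed
  moreover have "0 \<in> Q" using Q(2) P(2) embed_zero by (metis IntE imageI)
  ultimately show ?thesis using that Q(1) by blast
qed

text \<open>The closure of the graph of \<open>\<iota>\<close>, with \<open>t\<close> replaced by \<open>entries t\<close>; it turns out to be the graph
  of an isomorphism of \<open>double_seqs\<close> onto the completion.\<close>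

definition represents :: "(nat \<Rightarrow> nat \<Rightarrow> complex) \<Rightarrow> 'e \<Rightarrow> bool" where
  "represents g z \<longleftrightarrow> g \<in> double_seqs \<and> z \<in> topspace E \<and>
     (\<forall>U n. \<forall>b\<in>rapid_weights. zero_nhd E U \<longrightarrow>
       (\<exists>t\<in>sseq_tensor. g - entries t \<in> double_ball n b \<and> z - \<iota> t \<in> U))"

lemma representsD:
  assumes "represents g z" "b \<in> rapid_weights" "zero_nhd E U"
  obtains t where "t \<in> sseq_tensor" "g - entries t \<in> double_ball n b" "z - \<iota> t \<in> U"
  using assms unfolding represents_def by blast

lemma represents_add:
  assumes "represents g z" "represents h w"
  shows "represents (g + h) (z + w)"
  unfolding represents_def
proof (intro conjI allI ballI impI)
  show "g + h \<in> double_seqs" "z + w \<in> topspace E"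
    using assms double_seqs_add module.subspace_add[OF mod sub] unfolding represents_def by blast+
next
  fix U n b assume b: "b \<in> rapid_weights" and U: "zero_nhd E U"
  obtain V where V: "zero_nhd E V" "\<And>x y. \<lbrakk>x \<in> V; y \<in> V\<rbrakk> \<Longrightarrow> x + y \<in> U"
    using lcs U by (rule zero_nhd_add) blast
  have b2: "(\<lambda>j. 2 * b j) \<in> rapid_weights" using b by (rule rapid_weights_scale) simp
  obtain s where s: "s \<in> sseq_tensor" "g - entries s \<in> double_ball n (\<lambda>j. 2 * b j)" "z - \<iota> s \<in> V"
    using assms(1) b2 V(1) by (rule representsD[where n = n]) blast
  obtain t where t: "t \<in> sseq_tensor" "h - entries t \<in> double_ball n (\<lambda>j. 2 * b j)" "w - \<iota> t \<in> V"
    using assms(2) b2 V(1) by (rule representsD[where n = n]) blast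
  have "g + h - entries (s + t) = (g - entries s) + (h - entries t)" by simp
  moreover have "z + w - \<iota> (s + t) = (z - \<iota> s) + (w - \<iota> t)" using embed_add[OF s(1) t(1)] by simp
  ultimately show "\<exists>t\<in>sseq_tensor. g + h - entries t \<in> double_ball n b \<and> z + w - \<iota> t \<in> U"
    using double_ball_add(1)[OF s(2) t(2) b] V(2)[OF s(3) t(3)] sseq_tensor_closed(2)[OF s(1) t(1)] by metis
qed

lemma represents_scale:
  assumes "represents g z"
  shows "represents (double_scale c g) (scE c z)"
  unfolding represents_def
proof (intro conjI allI ballI impI)
  show "double_scale c g \<in> double_seqs" "scE c z \<in> topspace E"
    using assms double_seqs_scale module.subspace_scale[OF mod sub] unfolding represents_def by blast+
next
  fix U n b assume b: "b \<in> rapid_weights" and U: "zero_nhd E U"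
  obtain V where V: "zero_nhd E V" "\<And>x. x \<in> V \<Longrightarrow> scE c x \<in> U"
    using lcs U by (rule zero_nhd_scale) blast
  have b2: "(\<lambda>j. (cmod c + 1) * b j) \<in> rapid_weights"
    using b by (rule rapid_weights_scale) (simp add: add_nonneg_pos)
  obtain t where t: "t \<in> sseq_tensor" "g - entries t \<in> double_ball n (\<lambda>j. (cmod c + 1) * b j)" "z - \<iota> t \<in> V"
    using assms b2 V(1) by (rule representsD[where n = n]) blast
  have "double_scale c g - entries (fun_scale c t) = double_scale c (g - entries t)"
    by (auto simp: fun_eq_iff right_diff_distrib)
  moreover have "scE c z - \<iota> (fun_scale c t) = scE c (z - \<iota> t)"
    using embed_scale[OF t(1)] module.scale_right_diff_distrib[OF mod] by simp
  ultimately show "\<exists>t\<in>sseq_tensor. double_scale c g - entries t \<in> double_ball n b \<and> scE c z - \<iota> t \<in> U"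
    using double_ball_scale[OF t(2) b] V(2)[OF t(3)] sseq_tensor_closed(4)[OF t(1)] by metis
qed

text \<open>Smallness passes from \<open>g\<close> to the entries of an approximating
  \<open>t\<close>, from there to \<open>\<iota> t\<close>, and finally to \<open>z\<close>.\<close>

lemma represents_continuous:
  assumes "zero_nhd E U"
  obtains n b where "b \<in> rapid_weights"
    "\<And>g z. \<lbrakk>represents g z; g \<in> double_ball n b\<rbrakk> \<Longrightarrow> z \<in> U"
proof -
  obtain V where V: "zero_nhd E V" "\<And>x y. \<lbrakk>x \<in> V; y \<in> V\<rbrakk> \<Longrightarrow> x + y \<in> U"
    using lcs assms by (rule zero_nhd_add) blast
  obtain n b where b: "b \<in> rapid_weights"
    and small: "\<And>t. \<lbrakk>t \<in> sseq_tensor; entries t \<in> double_ball n b\<rbrakk> \<Longrightarrow> \<iota> t \<in> V"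
    using V(1) by (rule embed_small) blast
  have b2: "(\<lambda>j. 2 * b j) \<in> rapid_weights" using b by (rule rapid_weights_scale) simp
  have "z \<in> U" if gz: "represents g z" and g: "g \<in> double_ball n (\<lambda>j. 2 * b j)" for g z
  proof -
    obtain t where t: "t \<in> sseq_tensor" "g - entries t \<in> double_ball n (\<lambda>j. 2 * b j)" "z - \<iota> t \<in> V"
      using gz b2 V(1) by (rule representsD[where n = n]) blast
    have "entries t \<in> double_ball n b" using double_ball_add(2)[OF g t(2) b] by simp
    then have "\<iota> t \<in> V" using small t(1) by blast
    then show ?thesis using V(2)[OF t(3)] by fastforce
  qed
  then show ?thesis using that b2 by blast
qed

text \<open>The relation is linear, so 0 represents \<open>z - w\<close>; by continuity this
  difference lies in every neighbourhood of 0.\<close>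

lemma represents_unique:
  assumes "represents g z" "represents g w"
  shows "z = w"
proof -
  have "represents (g + double_scale (-1) g) (z + scE (-1) w)"
    using assms by (intro represents_add represents_scale)
  moreover have "g + double_scale (-1) g = 0" by (simp add: fun_eq_iff)
  moreover have "z + scE (-1) w = z - w"
    by (simp add: module.scale_minus_left[OF mod] module.scale_one[OF mod])
  ultimately have 0: "represents 0 (z - w)" by metis
  have "z - w = 0"
  proof (rule Hausdorff_zero[OF lcs haus])
    show "z - w \<in> topspace E" using 0 unfolding represents_def by blast
  next
    fix U assume "zero_nhd E U"
    then obtain n b where nb: "b \<in> rapid_weights"
      "\<And>g z. \<lbrakk>represents g z; g \<in> double_ball n b\<rbrakk> \<Longrightarrow> z \<in> U"
      by (rule represents_continuous) blast
    show "z - w \<in> U" by (rule nb(2)[OF 0]) (simp add: double_ball_def)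
  qed
  then show ?thesis by simp
qed

text \<open>The images of the square truncations of \<open>g\<close> form a Cauchy sequence, since
  their differences are differences of two truncation errors.\<close>

lemma represents_total:
  assumes g: "g \<in> double_seqs"
  obtains z where "represents g z"
proof -
  define f where "f = (\<lambda>m. \<iota> (finite_tensor m g))"
  have "cauchy_filter_on E (filtermap f sequentially)"
    unfolding cauchy_filter_on_def
  proof (intro conjI allI impI)
    show "filtermap f sequentially \<noteq> bot" by (simp add: filtermap_bot_iff)
    show "\<forall>\<^sub>F x in filtermap f sequentially. x \<in> topspace E"
      unfolding eventually_filtermap f_def by (simp add: embed_in)
  next
    fix U assume "zero_nhd E U"
    then obtain n b where b: "b \<in> rapid_weights"
      and small: "\<And>t. \<lbrakk>t \<in> sseq_tensor; entries t \<in> double_ball n b\<rbrakk> \<Longrightarrow> \<iota> t \<in> U"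
      by (rule embed_small) blast
    have b2: "(\<lambda>j. 2 * b j) \<in> rapid_weights" using b by (rule rapid_weights_scale) simp
    obtain M where M: "\<And>m. M \<le> m \<Longrightarrow> g - entries (finite_tensor m g) \<in> double_ball n (\<lambda>j. 2 * b j)"
      using g b2 by (rule finite_tensor_converges[where n = n]) blast
    have "f m - f m' \<in> U" if "M \<le> m" "M \<le> m'" for m m'
    proof -
      have "entries (finite_tensor m g - finite_tensor m' g)
          = (g - entries (finite_tensor m' g)) - (g - entries (finite_tensor m g))" by simp
      then have "entries (finite_tensor m g - finite_tensor m' g) \<in> double_ball n b"
        using double_ball_add(2)[OF M[OF that(2)] M[OF that(1)] b] by metis
      then have "\<iota> (finite_tensor m g - finite_tensor m' g) \<in> U"
        by (intro small sseq_tensor_closed(3) finite_tensor_in)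
      then show ?thesis unfolding f_def by (simp add: embed_diff)
    qed
    moreover have "\<forall>\<^sub>F x in filtermap f sequentially. x \<in> f ` {M..}"
      unfolding eventually_filtermap by (rule eventually_sequentiallyI[of M]) auto
    ultimately show "\<exists>A. (\<forall>\<^sub>F x in filtermap f sequentially. x \<in> A) \<and> (\<forall>x\<in>A. \<forall>y\<in>A. x - y \<in> U)"
      by (intro exI[of _ "f ` {M..}"]) auto
  qed
  then obtain z where z: "limitin E (\<lambda>x. x) z (filtermap f sequentially)"
    using complete unfolding complete_tvs_def by blast
  have "represents g z"
    unfolding represents_def
  proof (intro conjI allI ballI impI)
    show "g \<in> double_seqs" by (rule g)
    show zE: "z \<in> topspace E" using z by (rule limitin_topspace)
    fix U n b assume b: "b \<in> rapid_weights" and U: "zero_nhd E U"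
    obtain Q where Q: "openin E Q" "z \<in> Q" "\<And>w. w \<in> Q \<Longrightarrow> z - w \<in> U"
      using lcs U zE by (rule zero_nhd_translate) blast
    obtain M where M: "\<And>m. M \<le> m \<Longrightarrow> g - entries (finite_tensor m g) \<in> double_ball n b"
      using g b by (rule finite_tensor_converges[where n = n]) blast
    have "\<forall>\<^sub>F m in sequentially. f m \<in> Q"
      using z Q(1,2) unfolding limitin_def eventually_filtermap by blast
    moreover have "\<forall>\<^sub>F m in sequentially. M \<le> m" by (rule eventually_ge_at_top)
    ultimately have "\<forall>\<^sub>F m in sequentially. z - f m \<in> U \<and> g - entries (finite_tensor m g) \<in> double_ball n b"
      by eventually_elim (use Q(3) M in blast)
    then obtain m where "z - f m \<in> U" "g - entries (finite_tensor m g) \<in> double_ball n b"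
      using eventually_happens'[OF sequentially_bot] by blast
    then show "\<exists>t\<in>sseq_tensor. g - entries t \<in> double_ball n b \<and> z - \<iota> t \<in> U"
      unfolding f_def by (intro bexI[of _ "finite_tensor m g"]) auto
  qed
  then show ?thesis using that by blast
qed

text \<open>The entries of tensors whose images approach \<open>z\<close> converge, and their limit
  represents \<open>z\<close>. A filter takes the place of a sequence because \<open>E\<close> need
  not have countable neighbourhood bases. Staying inside \<open>Q\<close> keeps the limit in the
  closed ball.\<close>

lemma represents_dense:
  assumes Q: "openin E Q" "z \<in> Q" and small: "\<And>t. \<lbrakk>t \<in> sseq_tensor; \<iota> t \<in> Q\<rbrakk> \<Longrightarrow> entries t \<in> double_ball n b"
  obtains g where "represents g z" "g \<in> double_ball n b"
proof -
  have zE: "z \<in> topspace E" using Q openin_subset by blast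
  define F where "F = inf (filtercomap \<iota> (nhdsin E z)) (principal {t \<in> sseq_tensor. \<iota> t \<in> Q})"
  have evF: "eventually P F \<longleftrightarrow> (\<exists>S. openin E S \<and> z \<in> S \<and> (\<forall>t\<in>sseq_tensor. \<iota> t \<in> S \<longrightarrow> \<iota> t \<in> Q \<longrightarrow> P t))" for P
  proof -
    have "eventually P F \<longleftrightarrow> (\<exists>R. (\<exists>S. openin E S \<and> z \<in> S \<and> (\<forall>x\<in>S. R x)) \<and>
        (\<forall>t. R (\<iota> t) \<longrightarrow> t \<in> sseq_tensor \<longrightarrow> \<iota> t \<in> Q \<longrightarrow> P t))"
      unfolding F_def eventually_inf_principal eventually_filtercomap eventually_nhdsin using zE by auto
    also have "\<dots> \<longleftrightarrow> (\<exists>S. openin E S \<and> z \<in> S \<and> (\<forall>t\<in>sseq_tensor. \<iota> t \<in> S \<longrightarrow> \<iota> t \<in> Q \<longrightarrow> P t))"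
    proof (intro iffI; elim exE conjE)
      fix R S assume "openin E S" "z \<in> S" "\<forall>x\<in>S. R x"
        "\<forall>t. R (\<iota> t) \<longrightarrow> t \<in> sseq_tensor \<longrightarrow> \<iota> t \<in> Q \<longrightarrow> P t"
      then show "\<exists>S. openin E S \<and> z \<in> S \<and> (\<forall>t\<in>sseq_tensor. \<iota> t \<in> S \<longrightarrow> \<iota> t \<in> Q \<longrightarrow> P t)"
        by (intro exI[of _ S]) simp
    next
      fix S assume "openin E S" "z \<in> S" "\<forall>t\<in>sseq_tensor. \<iota> t \<in> S \<longrightarrow> \<iota> t \<in> Q \<longrightarrow> P t"
      then show "\<exists>R. (\<exists>S. openin E S \<and> z \<in> S \<and> (\<forall>x\<in>S. R x)) \<and>
          (\<forall>t. R (\<iota> t) \<longrightarrow> t \<in> sseq_tensor \<longrightarrow> \<iota> t \<in> Q \<longrightarrow> P t)"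
        by (intro exI[of _ "\<lambda>x. x \<in> S"] conjI exI[of _ S]) simp_all
    qed
    finally show ?thesis .
  qed
  \<comment> \<open>Density: every open set around \<open>z\<close>, intersected with
    \<open>Q\<close>, meets the image of the tensors.\<close>
  have nb: "F \<noteq> bot"
  proof
    assume "F = bot"
    then have "eventually (\<lambda>_. False) F" by simp
    then obtain S where S: "openin E S" "z \<in> S" "\<And>t. \<lbrakk>t \<in> sseq_tensor; \<iota> t \<in> S; \<iota> t \<in> Q\<rbrakk> \<Longrightarrow> False"
      unfolding evF by blast
    have "z \<in> E closure_of (\<iota> ` sseq_tensor)" using dense zE by simp
    then have "\<exists>y\<in>\<iota> ` sseq_tensor. y \<in> S \<inter> Q"
      using openin_Int[OF S(1) Q(1)] S(2) Q(2) unfolding in_closure_of by blast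
    then show False using S(3) by blast
  qed
  have evnear: "\<forall>\<^sub>F t in F. t \<in> sseq_tensor \<and> z - \<iota> t \<in> V" if V: "zero_nhd E V" for V
  proof -
    obtain S where "openin E S" "z \<in> S" "\<And>w. w \<in> S \<Longrightarrow> z - w \<in> V"
      using lcs V zE by (rule zero_nhd_translate) blast
    then show ?thesis unfolding evF by blast
  qed
  have cauchy: "\<exists>V. zero_nhd E V \<and> (\<forall>s t. s \<in> sseq_tensor \<and> z - \<iota> s \<in> V \<longrightarrow> t \<in> sseq_tensor \<and> z - \<iota> t \<in> V
      \<longrightarrow> entries s - entries t \<in> double_ball k a)" if a: "a \<in> rapid_weights" for k a
  proof -
    obtain S where S: "openin E S" "0 \<in> S"
      "\<And>t. \<lbrakk>t \<in> sseq_tensor; \<iota> t \<in> S\<rbrakk> \<Longrightarrow> entries t \<in> double_ball k a"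
      using a by (rule entries_small[where n = k]) blast
    obtain V where V: "zero_nhd E V" "\<And>x y. \<lbrakk>x \<in> V; y \<in> V\<rbrakk> \<Longrightarrow> x - y \<in> S"
      using lcs zero_nhd_open[OF lcs S(1,2)] by (rule zero_nhd_diff) blast
    have "entries s - entries t \<in> double_ball k a"
      if "s \<in> sseq_tensor" "z - \<iota> s \<in> V" "t \<in> sseq_tensor" "z - \<iota> t \<in> V" for s t
    proof -
      have "\<iota> (s - t) = (z - \<iota> t) - (z - \<iota> s)" using embed_diff[OF that(1,3)] by simp
      then have "\<iota> (s - t) \<in> S" using V(2)[OF that(4,2)] by simp
      then show ?thesis using S(3)[OF sseq_tensor_closed(3)[OF that(1,3)]] by simp
    qed
    then show ?thesis using V(1) by blast
  qed
  have "\<exists>l. ((\<lambda>t. entries t i j) \<longlongrightarrow> l) F" for i j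
  proof -
    have "cauchy_filter (filtermap (\<lambda>t. entries t i j) F)"
      unfolding cauchy_filter_metric_filtermap
    proof (intro allI impI)
      fix e :: real assume e: "0 < e"
      \<comment> \<open>A geometric weight normalised to the value \<open>2 / e\<close> at column
        \<open>j\<close>: its ball with row exponent 0 confines the chosen entry to
        \<open>e / 2\<close>.\<close>
      define a where "a = (\<lambda>k. 2 ^ Suc j / e * (1/2 :: real) ^ k)"
      have "a \<in> rapid_weights" unfolding a_def using e by (intro rapid_weights_scale rapid_weights_nonempty) simp
      then obtain V where V: "zero_nhd E V"
        "\<And>s t. \<lbrakk>s \<in> sseq_tensor \<and> z - \<iota> s \<in> V; t \<in> sseq_tensor \<and> z - \<iota> t \<in> V\<rbrakk>
          \<Longrightarrow> entries s - entries t \<in> double_ball 0 a"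
        using cauchy by metis
      have aj: "a j = 2 / e" by (simp add: a_def power_one_over)
      have "dist (entries s i j) (entries t i j) < e"
        if "s \<in> sseq_tensor \<and> z - \<iota> s \<in> V" "t \<in> sseq_tensor \<and> z - \<iota> t \<in> V" for s t
      proof -
        have "real (Suc i) ^ 0 * a j * cmod ((entries s - entries t) i j) \<le> 1"
          using V(2)[OF that] unfolding double_ball_def by blast
        then have "cmod (entries s i j - entries t i j) \<le> e / 2" using e by (simp add: aj field_simps)
        then show ?thesis using e by (simp add: dist_norm)
      qed
      then show "\<exists>P. eventually P F \<and> (\<forall>x y. P x \<and> P y \<longrightarrow> dist (entries x i j) (entries y i j) < e)"
        using evnear[OF V(1)] by blast
    qed
    moreover have "filtermap (\<lambda>t. entries t i j) F \<noteq> bot" using nb by (simp add: filtermap_bot_iff)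
    ultimately show ?thesis
      using complete_UNIV_cuspace unfolding complete_uniform filterlim_def
      by (metis UNIV_I principal_UNIV top_greatest)
  qed
  then obtain g where g: "\<And>i j. ((\<lambda>t. entries t i j) \<longlongrightarrow> g i j) F" by metis
  \<comment> \<open>Let \<open>s\<close> run along \<open>F\<close> in the Cauchy estimate while
    \<open>t\<close> stays fixed.\<close>
  have near: "\<exists>V. zero_nhd E V \<and> (\<forall>t. t \<in> sseq_tensor \<and> z - \<iota> t \<in> V \<longrightarrow> g - entries t \<in> double_ball k a)"
    if a: "a \<in> rapid_weights" for k a
  proof -
    obtain V where V: "zero_nhd E V"
      "\<And>s t. \<lbrakk>s \<in> sseq_tensor \<and> z - \<iota> s \<in> V; t \<in> sseq_tensor \<and> z - \<iota> t \<in> V\<rbrakk>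
        \<Longrightarrow> entries s - entries t \<in> double_ball k a"
      using cauchy[OF a] by metis
    have "g - entries t \<in> double_ball k a" if "t \<in> sseq_tensor \<and> z - \<iota> t \<in> V" for t
      by (rule double_ball_convergent[OF nb g]) (use evnear[OF V(1)] V(2)[OF _ that] in \<open>rule eventually_mono\<close>)
    then show ?thesis using V(1) by blast
  qed
  have approx: "\<exists>t\<in>sseq_tensor. g - entries t \<in> double_ball k a \<and> z - \<iota> t \<in> U"
    if a: "a \<in> rapid_weights" and U: "zero_nhd E U" for k a U
  proof -
    obtain V where V: "zero_nhd E V"
      "\<And>t. t \<in> sseq_tensor \<and> z - \<iota> t \<in> V \<Longrightarrow> g - entries t \<in> double_ball k a"
      using near[OF a] by metis
    obtain t where "t \<in> sseq_tensor \<and> z - \<iota> t \<in> U \<inter> V"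
      using eventually_happens'[OF nb evnear[OF zero_nhd_inter[OF lcs U V(1)]]] by blast
    then show ?thesis using V(2) by blast
  qed
  \<comment> \<open>With this trivial neighbourhood, \<open>approx\<close> speaks about the matrices
    alone, as \<open>double_seqsI\<close> requires.\<close>
  have "zero_nhd E (topspace E)"
    by (rule zero_nhd_open[OF lcs]) (auto intro: module.subspace_0[OF mod sub])
  then have "g \<in> double_seqs"
    using approx entries_in_double_seqs by (intro double_seqsI) blast
  then have "represents g z"
    unfolding represents_def using zE approx by blast
  moreover have "g \<in> double_ball n b"
  proof -
    have "\<forall>\<^sub>F t in F. entries t - 0 \<in> double_ball n b"
      unfolding evF using small Q by auto
    then have "g - 0 \<in> double_ball n b" by (rule double_ball_convergent[OF nb g])
    then show ?thesis by simp
  qed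
  ultimately show ?thesis using that by blast
qed

text \<open>\<open>U\<close> is pulled back to \<open>W\<close>. Continuity of the relation makes
  images of bounded sets bounded, and totality brings their absorption by \<open>U\<close> back to
  \<open>W\<close>.\<close>

lemma completion_bornological: "bornological scE E"
  unfolding bornological_def
proof (intro conjI allI impI lcs)
  fix U assume U: "U \<subseteq> topspace E \<and> absolutely_convex scE U \<and> (\<forall>B. bounded_in scE E B \<longrightarrow> absorbs scE U B)"
  define W where "W = {g. \<exists>z\<in>U. represents g z}"
  have inv: "scE c (scE (inverse c) z) = z" "scE (inverse c) (scE c z) = z"
    "double_scale c (double_scale (inverse c) g) = g" if "c \<noteq> 0" for c z g
    using that module.scale_scale[OF mod] module.scale_one[OF mod] by simp_all
  have "absolutely_convex double_scale W"
    unfolding absolutely_convex_def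
  proof (intro ballI allI impI)
    fix g h a b assume "g \<in> W" "h \<in> W" and ab: "cmod a + cmod b \<le> 1"
    then obtain z w where "z \<in> U" "represents g z" "w \<in> U" "represents h w" unfolding W_def by blast
    then have "represents (double_scale a g + double_scale b h) (scE a z + scE b w)" "scE a z + scE b w \<in> U"
      using U ab unfolding absolutely_convex_def by (auto intro: represents_add represents_scale)
    then show "double_scale a g + double_scale b h \<in> W" unfolding W_def by blast
  qed
  moreover have "absorbs double_scale W B" if B: "double_bounded B" for B
  proof -
    define B' where "B' = {z. \<exists>g\<in>B. represents g z}"
    have "absorbs scE V B'" if V: "zero_nhd E V" for V
    proof -
      obtain n b where b: "b \<in> rapid_weights" "\<And>g z. \<lbrakk>represents g z; g \<in> double_ball n b\<rbrakk> \<Longrightarrow> z \<in> V"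
        using V by (rule represents_continuous) blast
      obtain c where c: "\<And>g i j. g \<in> B \<Longrightarrow> real (Suc i) ^ n * b j * cmod (g i j) \<le> c"
        using B b(1) unfolding double_bounded_def by metis
      \<comment> \<open>The radius \<open>\<bar>c\<bar> + 1\<close> dominates \<open>c\<close> and
        forces \<open>a\<close> to be nonzero.\<close>
      have "z \<in> scE a ` V" if a: "\<bar>c\<bar> + 1 \<le> cmod a" and z: "z \<in> B'" for a z
      proof -
        obtain g where g: "g \<in> B" "represents g z" using z unfolding B'_def by blast
        have "cmod a \<noteq> 0" using a by linarith
        then have a0: "a \<noteq> 0" by simp
        have "double_scale (inverse a) g \<in> double_ball n b"
          unfolding double_ball_def
        proof (intro CollectI allI)
          fix i j
          have "real (Suc i) ^ n * b j * cmod (g i j) \<le> cmod a" using c[OF g(1), of i j] a by linarith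
          then show "real (Suc i) ^ n * b j * cmod (double_scale (inverse a) g i j) \<le> 1"
            using a0 by (simp add: norm_mult norm_inverse norm_divide field_simps)
        qed
        then have "scE (inverse a) z \<in> V" using b(2) represents_scale[OF g(2)] by blast
        then show ?thesis using inv(1)[OF a0, of z] by (metis imageI)
      qed
      then show ?thesis unfolding absorbs_def by (intro exI[of _ "\<bar>c\<bar> + 1"]) auto
    qed
    then have "bounded_in scE E B'" unfolding bounded_in_def B'_def represents_def by blast
    then obtain r where r: "0 < r" "\<And>c. r \<le> cmod c \<Longrightarrow> B' \<subseteq> scE c ` U"
      using U unfolding absorbs_def by meson
    have "g \<in> double_scale c ` W" if c: "r \<le> cmod c" and g: "g \<in> B" for c g
    proof -
      have c0: "c \<noteq> 0" using c r(1) by auto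
      have "g \<in> double_seqs" using double_bounded_subset[OF B] g by blast
      then obtain z where z: "represents g z" by (rule represents_total) blast
      then have "z \<in> B'" using g unfolding B'_def by blast
      then obtain u where u: "u \<in> U" "z = scE c u" using r(2)[OF c] by blast
      have "represents (double_scale (inverse c) g) u"
        using represents_scale[OF z, of "inverse c"] inv(2)[OF c0] u(2) by simp
      then have "double_scale (inverse c) g \<in> W" using u(1) unfolding W_def by blast
      then show ?thesis using inv(3)[OF c0, of g] by (metis imageI)
    qed
    then show ?thesis unfolding absorbs_def using r(1) by blast
  qed
  ultimately obtain n b where b: "b \<in> rapid_weights" "double_seqs \<inter> double_ball n b \<subseteq> W"
    by (rule double_seqs_bornological) blast
  obtain Q where Q: "openin E Q" "0 \<in> Q"
    "\<And>t. \<lbrakk>t \<in> sseq_tensor; \<iota> t \<in> Q\<rbrakk> \<Longrightarrow> entries t \<in> double_ball n b"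
    using b(1) by (rule entries_small[where n = n]) blast
  \<comment> \<open>Near 0 every element has a small representing sequence, which lies in
    \<open>W\<close> and so represents a member of \<open>U\<close>; uniqueness identifies that
    member with \<open>z\<close>.\<close>
  have "z \<in> U" if z: "z \<in> Q" for z
  proof -
    obtain g where g: "represents g z" "g \<in> double_ball n b"
      using Q(1) z Q(3) by (rule represents_dense) blast
    then have "g \<in> W" using b(2) unfolding represents_def by blast
    then obtain z' where "z' \<in> U" "represents g z'" unfolding W_def by blast
    then show ?thesis using represents_unique[OF g(1)] by blast
  qed
  then show "zero_nhd E U" unfolding zero_nhd_def using U Q(1,2) by blast
qed

end

theorem proposition1:
  fixes scE :: "complex \<Rightarrow> 'e::ab_group_add \<Rightarrow> 'e"
    and E :: "'e topology"
    and \<iota> :: "(((nat \<Rightarrow> complex) \<Rightarrow> (nat \<Rightarrow> complex) \<Rightarrow> complex) \<Rightarrow> complex) \<Rightarrow> 'e"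
  assumes "is_completed_projective_tensor fun_scale s_top fun_scale s_dual_top scE E \<iota>"
  shows "bornological scE E"
  using assms by (rule completion_bornological)

end
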